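(* Let $v:[0,+\infty)\to\mathbb{R}$ be Lipschitz and bounded. Let $\alpha<\beta$ be real and let $w\in BV([\alpha,\beta],[0,+\infty))$, extended by zero to $\mathbb{R}\setminus[\alpha,\beta]$, with $\int_\alpha^\beta w(x)\,dx=1$. Let $\rho_0\in L^\infty\cap\mathcal{P}^{ac}_c(\mathbb{R})$. Then there exists $T>0$ such that for all $t\in(0,T)$ there exists a unique weak solution $\rho\in C^0([0,t],L^\infty\cap\mathcal{P}^{ac}_c(\mathbb{R}))$ of the Cauchy problem $$\begin{cases}\partial_t\rho(t,x)+\partial_x\big(V[\rho(t)](x)\,\rho(t,x)\big)=0, & x\in\mathbb{R},\ t>0,\\ \rho(0,x)=\rho_0(x), & x\in\mathbb{R},\end{cases}$$ where $V[\rho(t)](x)=v\left(\int\rho(t,y)\,w(y-x)\,dy\right)$.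
   Context: $L^\infty\cap\mathcal{P}^{ac}_c(\mathbb{R})$ is the set of compactly supported probability measures on $\mathbb{R}$ that are absolutely continuous with respect to Lebesgue measure with essentially bounded density (measures are identified with their densities). It is endowed with the $\infty$-Wasserstein distance $W_\infty(\mu,\nu)=\inf\{\pi\text{-}\mathrm{ess\,sup}\,|x-y| : \pi\in\Pi(\mu,\nu)\}$, where $\Pi(\mu,\nu)$ is the set of couplings of $\mu,\nu$; $C^0$ in time refers to this distance. A weak solution on $[0,t]$ satisfies $\rho(0)=\rho_0$ and $\int_0^t\int_{\mathbb{R}}\big(\partial_s\varphi+V[\rho(s)](x)\,\partial_x\varphi\big)\rho(s,x)\,dx\,ds=0$ for all $\varphi\in C_c^\infty((0,t)\times\mathbb{R})$. *)

theory Defs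
  imports "HOL-Probability.Probability" "HOL-Probability.Essential_Supremum"
begin

text \<open>
  Measures are identified with their Lebesgue densities: an expression
  \<open>g(x) \<rho>(s,x) dx\<close> is written as integration of \<open>g\<close> against the measure \<open>\<rho> s\<close>.
\<close>

definition Linf_Pac_c :: "real measure set" where
  "Linf_Pac_c =
    {\<mu>. prob_space \<mu> \<and>
        (\<exists>K. compact K \<and> emeasure \<mu> (- K) = 0) \<and>
        (\<exists>f \<in> borel_measurable borel. (\<forall>x. 0 \<le> f x) \<and>
           \<mu> = density lborel (\<lambda>x. ennreal (f x)) \<and>
           (\<exists>C::real. AE x in lborel. f x \<le> C))}"

definition couplings :: "real measure \<Rightarrow> real measure \<Rightarrow> (real \<times> real) measure set" where
  "couplings \<mu> \<nu> =
    {\<pi>. sets \<pi> = sets (borel \<Otimes>\<^sub>M borel) \<and> distr \<pi> borel fst = \<mu> \<and> distr \<pi> borel snd = \<nu>}"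

definition W_inf :: "real measure \<Rightarrow> real measure \<Rightarrow> ennreal" where
  "W_inf \<mu> \<nu> = (INF \<pi> \<in> couplings \<mu> \<nu>. esssup \<pi> (\<lambda>(x, y). ennreal \<bar>x - y\<bar>))"

definition W_inf_continuous_on :: "real set \<Rightarrow> (real \<Rightarrow> real measure) \<Rightarrow> bool" where
  "W_inf_continuous_on I \<rho> \<longleftrightarrow>
    (\<forall>s\<in>I. ((\<lambda>r. W_inf (\<rho> r) (\<rho> s)) \<longlongrightarrow> 0) (at s within I))"

definition bounded_variation_on :: "real \<Rightarrow> real \<Rightarrow> (real \<Rightarrow> real) \<Rightarrow> bool" where
  "bounded_variation_on a b w \<longleftrightarrow>
    (\<exists>C. \<forall>n (p :: nat \<Rightarrow> real). p ` {..n} \<subseteq> {a..b} \<longrightarrow> mono_on {..n} p \<longrightarrow>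
       (\<Sum>i<n. \<bar>w (p (Suc i)) - w (p i)\<bar>) \<le> C)"

primrec C_k :: "nat \<Rightarrow> ('a::real_normed_vector \<Rightarrow> real) \<Rightarrow> bool" where
  "C_k 0 f \<longleftrightarrow> continuous_on UNIV f"
| "C_k (Suc k) f \<longleftrightarrow> (\<forall>x. f differentiable (at x)) \<and>
     (\<forall>h. C_k k (\<lambda>x. frechet_derivative f (at x) h))"

text \<open>
  Elements of \<open>C\<^sub>c\<^sup>\<infinity>(\<Omega>)\<close> are extended by zero to the whole space; for open \<open>\<Omega>\<close> this extension
  is smooth because the support is a compact subset of \<open>\<Omega>\<close>.
\<close>

definition Cc_inf :: "'a::real_normed_vector set \<Rightarrow> ('a \<Rightarrow> real) set" where
  "Cc_inf \<Omega> =
    {\<phi>. (\<forall>k. C_k k \<phi>) \<and> compact (closure {x. \<phi> x \<noteq> 0}) \<and> closure {x. \<phi> x \<noteq> 0} \<subseteq> \<Omega>}"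

definition V :: "(real \<Rightarrow> real) \<Rightarrow> (real \<Rightarrow> real) \<Rightarrow> real measure \<Rightarrow> real \<Rightarrow> real" where
  "V v w \<mu> x = v (\<integral>y. w (y - x) \<partial>\<mu>)"

definition weak_solution ::
    "(real \<Rightarrow> real) \<Rightarrow> (real \<Rightarrow> real) \<Rightarrow> real measure \<Rightarrow> real \<Rightarrow> (real \<Rightarrow> real measure) \<Rightarrow> bool" where
  "weak_solution v w \<rho>\<^sub>0 t \<rho> \<longleftrightarrow>
    \<rho> 0 = \<rho>\<^sub>0 \<and>
    (\<forall>\<phi> \<in> Cc_inf ({0<..<t} \<times> UNIV).
       (LINT s:{0..t}|lborel.
          (\<integral>x. (deriv (\<lambda>r. \<phi> (r, x)) s + V v w (\<rho> s) x * deriv (\<lambda>y. \<phi> (s, y)) x) \<partial>(\<rho> s))) = 0)"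

text \<open>
  A curve on \<open>[0,t]\<close> is encoded as a function on all reals; its values outside \<open>[0,t]\<close>
  are irrelevant and have to be disregarded in uniqueness statements.
\<close>

definition C0_weak_solution ::
    "(real \<Rightarrow> real) \<Rightarrow> (real \<Rightarrow> real) \<Rightarrow> real measure \<Rightarrow> real \<Rightarrow> (real \<Rightarrow> real measure) \<Rightarrow> bool" where
  "C0_weak_solution v w \<rho>\<^sub>0 t \<rho> \<longleftrightarrow>
    (\<forall>s\<in>{0..t}. \<rho> s \<in> Linf_Pac_c) \<and> W_inf_continuous_on {0..t} \<rho> \<and> weak_solution v w \<rho>\<^sub>0 t \<rho>"

end

theory Submission
  imports Defs
begin

text \<open>
  All estimates rest on one observation. A kernel of bounded variation is a difference of two
  bounded nondecreasing functions, and the expectation of a nondecreasing function only depends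
  on the masses of half-lines. If the distribution functions of two measures agree up to a shift
  of size \<open>d\<close> of the argument (\<open>cdf_close d\<close>; on the line this is what \<open>W_inf \<le> d\<close> means),
  and if \<^emph>\<open>one\<close> of them has a density bounded by \<open>K\<close>, then the masses of half-lines differ by at
  most \<open>K d\<close>. Hence the velocity \<open>V\<close> is Lipschitz in space and in the measure with a constant
  proportional to \<open>K\<close> (\<open>kernel_estimate\<close>, \<open>V_estimate\<close>).

  Existence is a fixed point argument for flow maps rather than for measures. A map whose
  displacement is \<open>1/2\<close>-Lipschitz at most doubles densities, so on the set of flows with such
  displacements the velocity has a Lipschitz constant \<open>\<Lambda>\<close> depending on the data only. For
  \<open>\<Lambda> T \<le> 1/4\<close> the map that integrates the velocity along the flow preserves this set and is a
  contraction in the uniform distance (\<open>flow_exists\<close>). Pushing \<open>\<rho>\<^sub>0\<close> forward along the fixed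
  point \<open>X\<close> gives the solution (\<open>pushforward_C0_weak_solution\<close>).

  Uniqueness is a weak-strong comparison. Another solution \<open>\<sigma>\<close> has a bounded density at every time,
  but nothing bounds it uniformly in time, so neither the Lipschitz constant of its velocity
  nor its characteristics are under control; everything is expressed by the constructed flow.
  First, \<open>\<integral> \<psi> d\<sigma>(s)\<close> is differentiable in \<open>s\<close> with the expected derivative
  (\<open>weak_time_derivative\<close>). Therefore a smooth step moved along a curve \<open>a\<close> has a monotone
  expectation as soon as the speed of \<open>a\<close> dominates the velocity of \<open>\<sigma>\<close> in the transition window
  of the step (\<open>barrier\<close>). With the curves \<open>X s z \<plusminus> \<kappa> s\<close> this traps the distribution function of
  \<open>\<sigma> s\<close>: if the two velocity fields differ by at most \<open>\<eta>\<close>, then \<open>\<sigma> s\<close> and the constructed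
  solution are \<open>cdf_close\<close> up to \<open>2 \<eta> t\<close> (\<open>velocity_gap_imp_cdf_close\<close>). Feeding this into the
  stability estimate halves \<open>\<eta>\<close> (\<open>velocity_gap_halves\<close>), so the velocities agree, and then the
  distribution functions agree.
\<close>

section \<open>Smooth functions and test functions\<close>

text \<open>
  The germ of all test functions. The polynomial parameter makes the family closed under
  differentiation.
\<close>
definition flat :: "real poly \<Rightarrow> real \<Rightarrow> real" where
  "flat p x = (if x > 0 then poly p (1 / x) * exp (- (1 / x)) else 0)"

lemma poly_exp_decay: "((\<lambda>y. y ^ k * poly p y * exp (- y)) \<longlongrightarrow> (0::real)) at_top"
proof (induction p arbitrary: k)
  case 0
  then show ?case by simp
next
  case (pCons a p)
  have "((\<lambda>y. a * (y ^ k / exp y) + y ^ Suc k * poly p y * exp (- y)) \<longlongrightarrow> a * 0 + 0) at_top"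
    by (intro tendsto_intros tendsto_power_div_exp_0 pCons.IH)
  moreover have "a * (y ^ k / exp y) + y ^ Suc k * poly p y * exp (- y)
      = y ^ k * poly (pCons a p) y * exp (- y)" for y
    by (simp add: exp_minus field_simps)
  ultimately show ?case by simp
qed

text \<open>
  Away from \<open>0\<close> this is the chain rule; at \<open>0\<close> the substitution \<open>y = 1/x\<close> turns the difference
  quotient into a polynomial times \<open>exp (- y)\<close>.
\<close>
lemma flat_has_derivative:
  "(flat p has_real_derivative flat ([:0, 0, 1:] * (p - pderiv p)) x) (at x)"
proof -
  consider "x > 0" | "x < 0" | "x = 0" by linarith
  then show ?thesis
  proof cases
    case 1
    have i: "((\<lambda>x. 1 / x) has_real_derivative - (1 / x\<^sup>2)) (at x)"
      using 1 by (auto intro!: derivative_eq_intros simp: power2_eq_square)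
    have "((\<lambda>x. poly p (1 / x) * exp (- (1 / x))) has_real_derivative
        poly (pderiv p) (1 / x) * (- (1 / x\<^sup>2)) * exp (- (1 / x)) +
        exp (- (1 / x)) * (- (- (1 / x\<^sup>2))) * poly p (1 / x)) (at x)"
      by (intro DERIV_mult DERIV_chain2[OF poly_DERIV i] DERIV_chain2[OF DERIV_exp] DERIV_minus i)
    also have "poly (pderiv p) (1 / x) * (- (1 / x\<^sup>2)) * exp (- (1 / x)) +
        exp (- (1 / x)) * (- (- (1 / x\<^sup>2))) * poly p (1 / x)
        = flat ([:0, 0, 1:] * (p - pderiv p)) x"
      using 1 by (simp add: flat_def field_simps power2_eq_square)
    finally have "((\<lambda>x. poly p (1 / x) * exp (- (1 / x))) has_real_derivative
        flat ([:0, 0, 1:] * (p - pderiv p)) x) (at x)" .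
    then show ?thesis
      by (rule has_field_derivative_transform_within_open[where S="{0<..}"])
         (use 1 in \<open>auto simp: flat_def\<close>)
  next
    case 2
    have "((\<lambda>x. 0) has_real_derivative 0) (at x)" by simp
    then have "(flat p has_real_derivative 0) (at x)"
      by (rule has_field_derivative_transform_within_open[where S="{..<0}"])
         (use 2 in \<open>auto simp: flat_def\<close>)
    then show ?thesis using 2 by (simp add: flat_def)
  next
    case 3
    have "((\<lambda>h. flat p h / h) \<longlongrightarrow> 0) (at_right 0)"
    proof -
      have "((\<lambda>y. y ^ 1 * poly p y * exp (- y)) \<longlongrightarrow> 0) at_top"
        by (rule poly_exp_decay)
      then have "((\<lambda>h. inverse h ^ 1 * poly p (inverse h) * exp (- inverse h)) \<longlongrightarrow> 0)
          (at_right (0::real))"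
        by (rule filterlim_compose[OF _ filterlim_inverse_at_top_right])
      then show ?thesis
        by (rule Lim_transform_eventually)
           (auto simp: eventually_at_filter flat_def field_simps)
    qed
    moreover have "((\<lambda>h. flat p h / h) \<longlongrightarrow> 0) (at_left 0)"
      by (rule Lim_transform_eventually[OF tendsto_const])
         (auto simp: eventually_at_filter flat_def)
    ultimately have "((\<lambda>h. flat p h / h) \<longlongrightarrow> 0) (at 0)"
      by (rule filterlim_split_at[rotated])
    then show ?thesis
      using 3 by (simp add: DERIV_def flat_def)
  qed
qed

text \<open>
  A class of functions that is rich enough for all cut-offs below and visibly stable under
  directional derivatives, so that smoothness of every order follows by one induction.
\<close>
inductive_set flat_algebra :: "('a::real_normed_vector \<Rightarrow> real) set" where
  flat_affine: "bounded_linear l \<Longrightarrow> (\<lambda>x. flat p (l x + c)) \<in> flat_algebra"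
| const: "(\<lambda>x. c) \<in> flat_algebra"
| add: "f \<in> flat_algebra \<Longrightarrow> g \<in> flat_algebra \<Longrightarrow> (\<lambda>x. f x + g x) \<in> flat_algebra"
| mult: "f \<in> flat_algebra \<Longrightarrow> g \<in> flat_algebra \<Longrightarrow> (\<lambda>x. f x * g x) \<in> flat_algebra"
| inverse: "f \<in> flat_algebra \<Longrightarrow> (\<And>x. f x \<noteq> 0) \<Longrightarrow> (\<lambda>x. inverse (f x)) \<in> flat_algebra"

lemma flat_algebra_diff:
  assumes "f \<in> flat_algebra" "g \<in> flat_algebra"
  shows "(\<lambda>x. f x - g x) \<in> flat_algebra"
  using flat_algebra.add[OF assms(1) flat_algebra.mult[OF flat_algebra.const[of "-1"] assms(2)]]
  by simp

lemma flat_algebra_has_derivative: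
  assumes "f \<in> flat_algebra"
  shows "\<exists>f'. (\<forall>x. (f has_derivative f' x) (at x)) \<and> (\<forall>h. (\<lambda>x. f' x h) \<in> flat_algebra)"
  using assms
proof induction
  case (flat_affine l p c)
  note flat_chain = has_derivative_compose[OF _ has_field_derivative_imp_has_derivative[OF flat_has_derivative]]
  let ?q = "[:0, 0, 1:] * (p - pderiv p)"
  have "((\<lambda>x. flat p (l x + c)) has_derivative (\<lambda>h. flat ?q (l x + c) * l h)) (at x)" for x
    by (rule flat_chain) (auto intro!: derivative_eq_intros bounded_linear_imp_has_derivative flat_affine)
  moreover have "(\<lambda>x. flat ?q (l x + c) * l h) \<in> flat_algebra" for h
    by (intro flat_algebra.intros flat_affine)
  ultimately show ?case by (intro exI[of _ "\<lambda>x h. flat ?q (l x + c) * l h"]) auto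
next
  case (const c)
  show ?case by (intro exI[of _ "\<lambda>x h. 0"]) (auto intro: flat_algebra.const)
next
  case (add f g)
  then obtain f' g' where
    "\<And>x. (f has_derivative f' x) (at x)" "\<And>h. (\<lambda>x. f' x h) \<in> flat_algebra"
    "\<And>x. (g has_derivative g' x) (at x)" "\<And>h. (\<lambda>x. g' x h) \<in> flat_algebra" by blast
  then show ?case
    by (intro exI[of _ "\<lambda>x h. f' x h + g' x h"])
       (auto intro!: flat_algebra.intros has_derivative_add)
next
  case (mult f g)
  then obtain f' g' where
    "\<And>x. (f has_derivative f' x) (at x)" "\<And>h. (\<lambda>x. f' x h) \<in> flat_algebra"
    "\<And>x. (g has_derivative g' x) (at x)" "\<And>h. (\<lambda>x. g' x h) \<in> flat_algebra" by blast
  then show ?case using mult.hyps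
    by (intro exI[of _ "\<lambda>x h. f x * g' x h + f' x h * g x"])
       (auto intro!: flat_algebra.intros has_derivative_mult)
next
  case (inverse f)
  then obtain f' where
    f': "\<And>x. (f has_derivative f' x) (at x)" "\<And>h. (\<lambda>x. f' x h) \<in> flat_algebra" by blast
  have "(\<lambda>x. -1 * (inverse (f x) * f' x h * inverse (f x))) \<in> flat_algebra" for h
    by (intro flat_algebra.intros inverse f')
  then show ?case using inverse.hyps
    by (intro exI[of _ "\<lambda>x h. - (inverse (f x) * f' x h * inverse (f x))"])
       (auto intro!: Deriv.has_derivative_inverse f')
qed

text \<open>
  Every member has directional derivatives in the class again, which is exactly the recursion
  of \<open>C_k\<close>.
\<close>
lemma flat_algebra_C_k:
  assumes "f \<in> flat_algebra"
  shows "C_k k f"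
  using assms
proof (induction k arbitrary: f)
  case 0
  then obtain f' where "\<And>x. (f has_derivative f' x) (at x)"
    using flat_algebra_has_derivative by blast
  then show ?case
    by (auto intro!: continuous_at_imp_continuous_on has_derivative_continuous)
next
  case (Suc k)
  then obtain f' where f': "\<And>x. (f has_derivative f' x) (at x)" "\<And>h. (\<lambda>x. f' x h) \<in> flat_algebra"
    using flat_algebra_has_derivative by blast
  then have "frechet_derivative f (at x) = f' x" for x
    using frechet_derivative_at by metis
  with f' Suc.IH show ?case
    by (auto simp: differentiable_def)
qed

lemma flat_algebra_deriv:
  fixes f :: "real \<Rightarrow> real"
  assumes "f \<in> flat_algebra"
  shows "(f has_real_derivative deriv f x) (at x)" "continuous_on UNIV (deriv f)"
proof -
  obtain f' where f': "\<And>x. (f has_derivative f' x) (at x)" "\<And>h. (\<lambda>x. f' x h) \<in> flat_algebra"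
    using flat_algebra_has_derivative assms by blast
  have d: "(f has_real_derivative f' x 1) (at x)" for x
  proof -
    have "f' x h = f' x 1 * h" for h
      using linear_scale[OF has_derivative_linear[OF f'(1)], of x h 1] by simp
    then have "f' x = (*) (f' x 1)" by (rule ext)
    then show ?thesis using f'(1)[of x] by (simp add: has_field_derivative_def)
  qed
  then have e: "deriv f x = f' x 1" for x by (simp add: DERIV_imp_deriv)
  show "(f has_real_derivative deriv f x) (at x)" using d e by simp
  have "deriv f = (\<lambda>x. f' x 1)" using e by (rule ext)
  then show "continuous_on UNIV (deriv f)"
    using flat_algebra_C_k[OF f'(2), of 0 1] by simp
qed

lemma flat_algebra_compose_linear:
  assumes "f \<in> flat_algebra" "bounded_linear m"
  shows "(\<lambda>x. f (m x)) \<in> flat_algebra"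
  using assms(1)
proof induction
  case (flat_affine l p c)
  have "bounded_linear (\<lambda>x. l (m x))"
    using bounded_linear_compose[OF flat_affine assms(2)] .
  then show ?case by (rule flat_algebra.flat_affine)
qed (auto intro: flat_algebra.intros)

text \<open>The usual smooth transition from \<open>0\<close> on \<open>(-\<infinity>, 0]\<close> to \<open>1\<close> on \<open>[1, \<infinity>)\<close>.\<close>
definition smooth_step :: "real \<Rightarrow> real" where
  "smooth_step x = flat 1 x / (flat 1 x + flat 1 (1 - x))"

lemma flat_1_nonneg: "0 \<le> flat 1 x" and flat_1_pos: "0 < x \<Longrightarrow> 0 < flat 1 x"
  by (auto simp: flat_def)

lemma smooth_step_denominator: "0 < flat 1 x + flat 1 (1 - x)"
  using flat_1_pos[of x] flat_1_pos[of "1 - x"] flat_1_nonneg[of x] flat_1_nonneg[of "1 - x"]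
  by (cases "x > 0") auto

lemma smooth_step_affine:
  fixes a c :: real
  shows "(\<lambda>x. smooth_step (a * x + c)) \<in> flat_algebra"
proof -
  have "(\<lambda>x. flat 1 (a * x + c) * inverse (flat 1 (a * x + c) + flat 1 ((- a) * x + (1 - c)))) \<in> flat_algebra"
  proof (intro flat_algebra.intros bounded_linear_mult_right)
    show "flat 1 (a * x + c) + flat 1 (- a * x + (1 - c)) \<noteq> 0" for x
      using smooth_step_denominator[of "a * x + c"] by (simp add: algebra_simps)
  qed
  then show ?thesis
    by (simp add: smooth_step_def divide_inverse algebra_simps)
qed

lemma smooth_step_eq_0: "x \<le> 0 \<Longrightarrow> smooth_step x = 0"
  by (simp add: smooth_step_def flat_def)

lemma smooth_step_eq_1: "1 \<le> x \<Longrightarrow> smooth_step x = 1"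
  using smooth_step_denominator[of x] by (simp add: smooth_step_def flat_def)

lemma mono_flat_1: "mono (flat 1)"
proof (rule monoI)
  fix x y :: real assume "x \<le> y"
  then show "flat 1 x \<le> flat 1 y"
    by (auto simp: flat_def frac_le)
qed

lemma mono_smooth_step: "mono smooth_step"
proof (rule monoI)
  fix x y :: real assume "x \<le> y"
  then have "flat 1 x \<le> flat 1 y" "flat 1 (1 - y) \<le> flat 1 (1 - x)"
    by (intro monoD[OF mono_flat_1]; simp)+
  then have "flat 1 x * flat 1 (1 - y) \<le> flat 1 y * flat 1 (1 - x)"
    by (intro mult_mono flat_1_nonneg)
  then show "smooth_step x \<le> smooth_step y"
    unfolding smooth_step_def
      pos_divide_le_eq[OF smooth_step_denominator[of x]] times_divide_eq_left
      pos_le_divide_eq[OF smooth_step_denominator[of y]]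
    by (simp add: algebra_simps)
qed

lemma smooth_step_01: "0 \<le> smooth_step x" "smooth_step x \<le> 1"
  using smooth_step_denominator[of x] flat_1_nonneg[of x] flat_1_nonneg[of "1-x"]
  by (auto simp: smooth_step_def divide_simps)

text \<open>
  A smooth version of the indicator of \<open>(-\<infinity>, 0]\<close> whose transition takes place in \<open>[0, e]\<close>:
  expectations of its translates lie between two values of the distribution function
  at distance \<open>e\<close>.
\<close>
definition falling :: "real \<Rightarrow> real \<Rightarrow> real" where
  "falling e x = 1 - smooth_step (x / e)"

lemma falling_translate_algebra: "(\<lambda>x. falling e (x - c)) \<in> flat_algebra"
proof -
  have "(\<lambda>x. 1 - smooth_step ((1 / e) * x + - c / e)) \<in> flat_algebra"
    by (intro flat_algebra_diff flat_algebra.const smooth_step_affine)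
  then show ?thesis by (simp add: falling_def diff_divide_distrib)
qed

lemma falling_algebra: "falling e \<in> flat_algebra"
  using falling_translate_algebra[of e 0] by simp

lemma falling_01: "0 \<le> falling e x" "falling e x \<le> 1"
  using smooth_step_01 by (auto simp: falling_def)

lemma falling_eq_1: "0 < e \<Longrightarrow> x \<le> 0 \<Longrightarrow> falling e x = 1"
  by (simp add: falling_def smooth_step_eq_0 divide_nonpos_pos)

lemma falling_eq_0: "0 < e \<Longrightarrow> e \<le> x \<Longrightarrow> falling e x = 0"
  by (simp add: falling_def smooth_step_eq_1)

lemma deriv_falling_nonpos:
  assumes "0 < e"
  shows "deriv (falling e) x \<le> 0"
proof -
  have "mono_on UNIV (\<lambda>x. - falling e x)"
    by (rule mono_onI)
       (use assms in \<open>auto simp: falling_def intro!: monoD[OF mono_smooth_step] divide_right_mono\<close>)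
  moreover have "((\<lambda>x. - falling e x) has_real_derivative - deriv (falling e) x) (at x)"
    by (intro DERIV_minus flat_algebra_deriv falling_algebra)
  ultimately have "0 \<le> - deriv (falling e) x"
    by (rule mono_on_imp_deriv_nonneg) simp
  then show ?thesis by simp
qed

lemma deriv_falling_eq_0:
  assumes "0 < e" "x \<notin> {0..e}"
  shows "deriv (falling e) x = 0"
proof (cases "x < 0")
  case True
  have "((\<lambda>_. 1) has_real_derivative 0) (at x)" by simp
  then have "(falling e has_real_derivative 0) (at x)"
    by (rule has_field_derivative_transform_within_open[where S="{..<0}"])
       (use True assms in \<open>auto simp: falling_eq_1\<close>)
  then show ?thesis by (rule DERIV_imp_deriv)
next
  case False
  have "((\<lambda>_. 0) has_real_derivative 0) (at x)" by simp
  then have "(falling e has_real_derivative 0) (at x)"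
    by (rule has_field_derivative_transform_within_open[where S="{e<..}"])
       (use False assms in \<open>auto simp: falling_eq_0\<close>)
  then show ?thesis by (rule DERIV_imp_deriv)
qed

text \<open>
  A smooth version of the indicator of \<open>[a, \<infinity>)\<close> in time; its derivative is an approximate
  identity on \<open>[a, a + d]\<close>.
\<close>
definition rising :: "real \<Rightarrow> real \<Rightarrow> real \<Rightarrow> real" where
  "rising d a s = smooth_step ((s - a) / d)"

lemma rising_algebra: "rising d a \<in> flat_algebra"
proof -
  have "(\<lambda>x. smooth_step ((1 / d) * x + - a / d)) \<in> flat_algebra"
    by (rule smooth_step_affine)
  then show ?thesis by (simp add: rising_def[abs_def] diff_divide_distrib)
qed

lemma rising_falling: "rising d a s = 1 - falling d (s - a)"
  by (simp add: rising_def falling_def)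

lemma deriv_rising: "deriv (rising d a) s = - deriv (falling d) (s - a)"
proof (rule DERIV_imp_deriv)
  have "((\<lambda>s. 1 - falling d (s - a)) has_real_derivative 0 - deriv (falling d) (s - a) * 1) (at s)"
    by (intro DERIV_diff DERIV_const DERIV_chain2[OF flat_algebra_deriv(1)[OF falling_algebra]])
       (auto intro!: derivative_eq_intros)
  then show "(rising d a has_real_derivative - deriv (falling d) (s - a)) (at s)"
    by (simp add: rising_falling[abs_def])
qed

lemma Cc_inf_has_derivative:
  assumes "\<phi> \<in> Cc_inf \<Omega>"
  shows "\<exists>\<phi>'. (\<forall>x. (\<phi> has_derivative \<phi>' x) (at x)) \<and> (\<forall>h. continuous_on UNIV (\<lambda>x. \<phi>' x h))"
proof -
  have "C_k (Suc 0) \<phi>" using assms unfolding Cc_inf_def by blast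
  then show ?thesis
    by (intro exI[of _ "\<lambda>x. frechet_derivative \<phi> (at x)"]) (auto simp: frechet_derivative_works)
qed

lemma Cc_inf_zero:
  assumes "\<phi> \<in> Cc_inf \<Omega>" "x \<notin> \<Omega>"
  shows "\<phi> x = 0"
  using assms closure_subset[of "{x. \<phi> x \<noteq> 0}"] unfolding Cc_inf_def by blast

lemma deriv_partial:
  fixes \<phi> :: "real \<times> real \<Rightarrow> real"
  assumes "\<And>q. (\<phi> has_derivative \<phi>' q) (at q)"
  shows "deriv (\<lambda>r. \<phi> (r, x)) s = \<phi>' (s, x) (1, 0)" "deriv (\<lambda>y. \<phi> (s, y)) x = \<phi>' (s, x) (0, 1)"
proof -
  have "((\<phi> \<circ> (\<lambda>r. (r, x))) has_vector_derivative \<phi>' (s, x) (1, 0)) (at s)"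
    by (rule vector_derivative_diff_chain_within)
       (auto intro!: has_vector_derivative_Pair has_vector_derivative_id has_vector_derivative_const has_derivative_at_withinI[OF assms])
  then show "deriv (\<lambda>r. \<phi> (r, x)) s = \<phi>' (s, x) (1, 0)"
    by (intro DERIV_imp_deriv) (simp add: has_real_derivative_iff_has_vector_derivative comp_def)
  have "((\<phi> \<circ> (\<lambda>y. (s, y))) has_vector_derivative \<phi>' (s, x) (0, 1)) (at x)"
    by (rule vector_derivative_diff_chain_within)
       (auto intro!: has_vector_derivative_Pair has_vector_derivative_id has_vector_derivative_const has_derivative_at_withinI[OF assms])
  then show "deriv (\<lambda>y. \<phi> (s, y)) x = \<phi>' (s, x) (0, 1)"
    by (intro DERIV_imp_deriv) (simp add: has_real_derivative_iff_has_vector_derivative comp_def)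
qed

text \<open>
  The derivative along a curve \<open>(s, X s)\<close> of speed \<open>c\<close> is the transport operator
  \<open>\<partial>\<^sub>s + c \<partial>\<^sub>x\<close> of the weak formulation.
\<close>
lemma derivative_split:
  fixes \<phi> :: "real \<times> real \<Rightarrow> real"
  assumes "(\<phi> has_derivative \<phi>') (at q)"
  shows "\<phi>' (1, c) = \<phi>' (1, 0) + c * \<phi>' (0, 1)"
proof -
  interpret linear \<phi>' using assms by (rule has_derivative_linear)
  show ?thesis using add[of "(1, 0)" "(0, c)"] scale[of c "(0, 1)"] by simp
qed

section \<open>Functions of bounded variation\<close>

text \<open>
  The sums over partitions of \<open>[a, x]\<close> whose supremum is the total variation there; points
  may be repeated, so appending points to a partition never leads out of the class.
\<close>
definition variation_sums :: "(real \<Rightarrow> real) \<Rightarrow> real \<Rightarrow> real \<Rightarrow> real set" where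
  "variation_sums w a x = {\<Sum>i<n. \<bar>w (q (Suc i)) - w (q i)\<bar> | n (q :: nat \<Rightarrow> real).
     q ` {..n} \<subseteq> {a..x} \<and> mono_on {..n} q}"

text \<open>
  Appending \<open>x\<close> and \<open>y\<close> to a partition of \<open>[a, x]\<close> shows that the variation function grows from
  \<open>x\<close> to \<open>y\<close> by at least \<open>\<bar>w y - w x\<bar>\<close>.
\<close>
lemma variation_sums_extend:
  assumes s: "s \<in> variation_sums w a x" and xy: "a \<le> x" "x \<le> y"
  shows "\<exists>s'\<in>variation_sums w a y. s + \<bar>w y - w x\<bar> \<le> s'"
proof -
  obtain n and q :: "nat \<Rightarrow> real" where s_eq: "s = (\<Sum>i<n. \<bar>w (q (Suc i)) - w (q i)\<bar>)"
    and q: "q ` {..n} \<subseteq> {a..x}" "mono_on {..n} q"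
    using s unfolding variation_sums_def by auto
  define r where "r = q(Suc n := x, Suc (Suc n) := y)"
  have r_eq: "r i = q i" if "i \<le> n" for i
    using that by (auto simp: r_def)
  have rx: "r (Suc n) = x" "r (Suc (Suc n)) = y" by (auto simp: r_def)
  have qx: "a \<le> q i" "q i \<le> x" if "i \<le> n" for i
    using q(1) that by (auto simp: image_subset_iff)
  have "mono_on {..Suc (Suc n)} r"
  proof (rule mono_onI)
    fix i j assume ij: "i \<in> {..Suc (Suc n)}" "j \<in> {..Suc (Suc n)}" "i \<le> j"
    then consider "j \<le> n" | "j = Suc n" "i \<le> n" | "j = Suc n" "i = Suc n"
      | "j = Suc (Suc n)" "i \<le> n" | "j = Suc (Suc n)" "i = Suc n" | "j = Suc (Suc n)" "i = Suc (Suc n)"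
      by (auto simp: le_Suc_eq)
    then show "r i \<le> r j"
    proof cases
      case 1
      then show ?thesis using ij mono_onD[OF q(2), of i j] by (simp add: r_eq)
    next
      case 4
      then show ?thesis using ij qx(2)[of i] xy by (simp add: r_eq rx)
    qed (use ij qx xy in \<open>simp_all add: r_eq rx\<close>)
  qed
  moreover have "r ` {..Suc (Suc n)} \<subseteq> {a..y}"
  proof (rule image_subsetI)
    fix i assume "i \<in> {..Suc (Suc n)}"
    then consider "i \<le> n" | "i = Suc n" | "i = Suc (Suc n)" by (auto simp: le_Suc_eq)
    then show "r i \<in> {a..y}"
      by cases (use qx[of i] xy in \<open>auto simp: r_eq rx\<close>)
  qed
  ultimately have mem: "(\<Sum>i<Suc (Suc n). \<bar>w (r (Suc i)) - w (r i)\<bar>) \<in> variation_sums w a y"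
    unfolding variation_sums_def by blast
  have "(\<Sum>i<Suc (Suc n). \<bar>w (r (Suc i)) - w (r i)\<bar>)
      = (\<Sum>i<n. \<bar>w (r (Suc i)) - w (r i)\<bar>) + \<bar>w x - w (q n)\<bar> + \<bar>w y - w x\<bar>"
    by (simp add: rx r_eq)
  moreover have "(\<Sum>i<n. \<bar>w (r (Suc i)) - w (r i)\<bar>) = s"
    unfolding s_eq by (intro sum.cong) (auto simp: r_eq)
  ultimately show ?thesis using mem by (intro bexI[OF _ mem]) linarith
qed

text \<open>
  The Jordan decomposition on the whole line: \<open>p\<close> is \<open>w a\<close> plus the variation function, extended
  by constants. The jump of \<open>w\<close> from \<open>0\<close> to \<open>w a\<close> is absorbed by \<open>p\<close> and the jump from \<open>w b\<close> to
  \<open>0\<close> by \<open>n = p - w\<close>; both go in the right direction because \<open>w\<close> is nonnegative.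
\<close>
lemma bounded_variation_decomposition:
  fixes w :: "real \<Rightarrow> real"
  assumes "a < b" and bv: "bounded_variation_on a b w"
    and nonneg: "\<And>x. x \<in> {a..b} \<Longrightarrow> 0 \<le> w x" and zero: "\<And>x. x \<notin> {a..b} \<Longrightarrow> w x = 0"
  obtains p n M where "mono p" "mono n" "0 < M" "\<And>x. 0 \<le> p x" "\<And>x. p x \<le> M"
    "\<And>x. 0 \<le> n x" "\<And>x. n x \<le> M" "\<And>x. w x = p x - n (x::real)"
proof -
  obtain C where C: "\<And>n (q :: nat \<Rightarrow> real). q ` {..n} \<subseteq> {a..b} \<Longrightarrow> mono_on {..n} q \<Longrightarrow>
      (\<Sum>i<n. \<bar>w (q (Suc i)) - w (q i)\<bar>) \<le> C"
    using bv unfolding bounded_variation_on_def by blast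
  define T where "T x = Sup (variation_sums w a x)" for x
  have bdd: "s \<le> C" if s: "s \<in> variation_sums w a x" and x: "x \<le> b" for s x
  proof -
    obtain n and q :: "nat \<Rightarrow> real" where "s = (\<Sum>i<n. \<bar>w (q (Suc i)) - w (q i)\<bar>)"
      and q: "q ` {..n} \<subseteq> {a..x}" "mono_on {..n} q"
      using s unfolding variation_sums_def by auto
    moreover have "{a..x} \<subseteq> {a..b}" using x by auto
    ultimately show ?thesis using C[OF order.trans[OF q(1)] q(2)] by auto
  qed
  have bdda: "bdd_above (variation_sums w a x)" if "x \<le> b" for x
    using bdd[OF _ that] by (auto simp: bdd_above_def)
  have zero_in: "0 \<in> variation_sums w a x" if "a \<le> x" for x
    unfolding variation_sums_def
    by (rule CollectI, rule exI[of _ 0], rule exI[of _ "\<lambda>_. a"]) (use that in \<open>auto simp: mono_on_def\<close>)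
  have step: "T x + \<bar>w y - w x\<bar> \<le> T y" if "a \<le> x" "x \<le> y" "y \<le> b" for x y
  proof -
    have "T x \<le> T y - \<bar>w y - w x\<bar>"
      unfolding T_def[of x]
    proof (rule cSup_least)
      show "variation_sums w a x \<noteq> {}" using zero_in[of x] that by auto
      fix s assume "s \<in> variation_sums w a x"
      then obtain s' where "s' \<in> variation_sums w a y" "s + \<bar>w y - w x\<bar> \<le> s'"
        using variation_sums_extend[OF _ \<open>a \<le> x\<close> \<open>x \<le> y\<close>] by blast
      moreover have "s' \<le> T y"
        unfolding T_def using bdda that \<open>s' \<in> _\<close> by (intro cSup_upper) auto
      ultimately show "s \<le> T y - \<bar>w y - w x\<bar>" by linarith
    qed
    then show ?thesis by simp
  qed
  have T_nonneg: "0 \<le> T x" if "a \<le> x" "x \<le> b" for x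
    unfolding T_def using bdda that zero_in by (intro cSup_upper) auto
  define p where "p x = (if x < a then 0 else if x \<le> b then w a + T x else w a + T b)" for x
  define n where "n x = p x - w x" for x
  have wa: "0 \<le> w a" "0 \<le> w b" using nonneg \<open>a < b\<close> by auto
  have Tb: "0 \<le> T b" using T_nonneg \<open>a < b\<close> by auto
  have mp: "mono p"
  proof (rule monoI)
    fix x y :: real assume "x \<le> y"
    consider "x < a" | "a \<le> x" "y \<le> b" | "a \<le> x" "x \<le> b" "b < y" | "b < x" using \<open>x \<le> y\<close> by linarith
    then show "p x \<le> p y"
    proof cases
      case 1
      then show ?thesis using wa T_nonneg[of y] Tb by (auto simp: p_def)
    next
      case 2
      then show ?thesis using step[of x y] \<open>x \<le> y\<close> by (auto simp: p_def)
    next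
      case 3
      then show ?thesis using step[of x b] by (auto simp: p_def)
    next
      case 4
      then show ?thesis using \<open>x \<le> y\<close> \<open>a < b\<close> by (auto simp: p_def)
    qed
  qed
  have mn: "mono n"
  proof (rule monoI)
    fix x y :: real assume "x \<le> y"
    consider "y < a" | "x < a" "a \<le> y" "y \<le> b" | "x < a" "b < y" | "a \<le> x" "y \<le> b"
      | "a \<le> x" "x \<le> b" "b < y" | "b < x" using \<open>x \<le> y\<close> by linarith
    then show "n x \<le> n y"
    proof cases
      case 1
      then show ?thesis using zero \<open>x \<le> y\<close> by (auto simp: p_def n_def)
    next
      case 2
      then show ?thesis using zero[of x] step[of a y] T_nonneg[of a] \<open>a < b\<close> by (auto simp: p_def n_def)
    next
      case 3
      then show ?thesis using zero[of x] zero[of y] wa Tb \<open>a < b\<close> by (auto simp: p_def n_def)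
    next
      case 4
      then show ?thesis using step[of x y] \<open>x \<le> y\<close> by (auto simp: p_def n_def)
    next
      case 5
      then show ?thesis using step[of x b] zero[of y] wa nonneg[of x] by (auto simp: p_def n_def)
    next
      case 6
      then show ?thesis using zero[of x] zero[of y] \<open>x \<le> y\<close> \<open>a < b\<close> by (auto simp: p_def n_def)
    qed
  qed
  have p_low: "0 \<le> p x" for x
  proof -
    have "p (min x (a - 1)) \<le> p x" by (rule monoD[OF mp]) simp
    then show ?thesis by (auto simp: p_def)
  qed
  have n_low: "0 \<le> n x" for x
  proof -
    have "n (min x (a - 1)) \<le> n x" by (rule monoD[OF mn]) simp
    then show ?thesis using zero by (auto simp: p_def n_def)
  qed
  have p_up: "p x \<le> w a + T b" for x
  proof -
    have "p x \<le> p (max x (b + 1))" by (rule monoD[OF mp]) simp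
    then show ?thesis using \<open>a < b\<close> by (auto simp: p_def split: if_splits)
  qed
  have n_up: "n x \<le> w a + T b" for x
  proof -
    have "n x \<le> n (max x (b + 1))" by (rule monoD[OF mn]) simp
    then show ?thesis using \<open>a < b\<close> zero[of "max x (b + 1)"] by (auto simp: p_def n_def split: if_splits)
  qed
  show thesis
  proof (rule that[of p n "w a + T b + 1"])
    show "p x \<le> w a + T b + 1" for x using p_up[of x] by linarith
    show "n x \<le> w a + T b + 1" for x using n_up[of x] by linarith
    show "w x = p x - n x" for x by (simp add: n_def)
  qed (use mp mn p_low n_low wa Tb in auto)
qed

section \<open>Stability of expectations in terms of distribution functions\<close>

lemma mono_superlevel_cases:
  fixes p :: "real \<Rightarrow> real"
  assumes "mono p"
  shows "{y. l < p y} = {} \<or> {y. l < p y} = UNIV \<or> (\<exists>c. {y. l < p y} = {c..} \<or> {y. l < p y} = {c<..})"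
proof -
  let ?U = "{y. l < p y}"
  have up: "y \<in> ?U" if "x \<in> ?U" "x \<le> y" for x y
    using that monoD[OF assms, of x y] by auto
  show ?thesis
  proof (cases "?U = {} \<or> \<not> bdd_below ?U")
    case True
    then show ?thesis
    proof
      assume nb: "\<not> bdd_below ?U"
      have "y \<in> ?U" for y
      proof -
        obtain x where "x \<in> ?U" "x < y" using nb unfolding bdd_below_def by (metis not_le)
        then show ?thesis using up by auto
      qed
      then show ?thesis by blast
    qed auto
  next
    case False
    define c where "c = Inf ?U"
    have 1: "?U \<subseteq> {c..}" using False unfolding c_def by (auto intro: cInf_lower)
    have 2: "{c<..} \<subseteq> ?U"
    proof
      fix y assume "y \<in> {c<..}"
      then obtain x where "x \<in> ?U" "x < y"
        using False cInf_lessD[of ?U y] unfolding c_def by auto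
      then show "y \<in> ?U" using up by auto
    qed
    show ?thesis
    proof (cases "c \<in> ?U")
      case True
      then have "?U = {c..}" using 1 2 by (auto simp: order_le_less)
      then show ?thesis by blast
    next
      case False
      have "?U = {c<..}"
      proof
        show "?U \<subseteq> {c<..}" using 1 False by (auto simp: order_le_less)
      qed (rule 2)
      then show ?thesis by blast
    qed
  qed
qed

lemma nn_integral_layer_cake:
  fixes p :: "real \<Rightarrow> real"
  assumes "real_distribution \<mu>" and [measurable]: "p \<in> borel_measurable borel"
    and p: "\<And>y. 0 \<le> p y" "\<And>y. p y \<le> M"
  shows "(\<integral>\<^sup>+ y. ennreal (p y) \<partial>\<mu>) = (\<integral>\<^sup>+ l. emeasure \<mu> {y. l < p y} * indicator {0..<M} l \<partial>lborel)"
proof -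
  interpret real_distribution \<mu> by fact
  interpret P: pair_sigma_finite \<mu> lborel ..
  note events_eq_borel[measurable_cong]
  have "(\<integral>\<^sup>+ y. ennreal (p y) \<partial>\<mu>) = (\<integral>\<^sup>+ y. (\<integral>\<^sup>+ l. indicator {0..<M} l * indicator {z. snd z < p (fst z)} (y, l) \<partial>lborel) \<partial>\<mu>)"
  proof (intro nn_integral_cong)
    fix y
    have "(\<integral>\<^sup>+ l. indicator {0..<M} l * indicator {z. snd z < p (fst z)} (y, l) \<partial>lborel)
        = (\<integral>\<^sup>+ l. indicator {0..<p y} l \<partial>lborel)"
      using p(2)[of y] by (intro nn_integral_cong) (auto split: split_indicator)
    then show "ennreal (p y) = (\<integral>\<^sup>+ l. indicator {0..<M} l * indicator {z. snd z < p (fst z)} (y, l) \<partial>lborel)"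
      using p(1) by simp
  qed
  also have "\<dots> = (\<integral>\<^sup>+ l. (\<integral>\<^sup>+ y. indicator {0..<M} l * indicator {z. snd z < p (fst z)} (y, l) \<partial>\<mu>) \<partial>lborel)"
    by (rule P.Fubini'[symmetric]) measurable
  also have "\<dots> = (\<integral>\<^sup>+ l. emeasure \<mu> {y. l < p y} * indicator {0..<M} l \<partial>lborel)"
  proof (intro nn_integral_cong)
    fix l :: real
    have "(\<integral>\<^sup>+ y. indicator {0..<M} l * indicator {z. snd z < p (fst z)} (y, l) \<partial>\<mu>)
        = (\<integral>\<^sup>+ y. indicator {0..<M} l * indicator {y. l < p y} y \<partial>\<mu>)"
      by (intro nn_integral_cong) (auto split: split_indicator)
    also have "\<dots> = indicator {0..<M} l * emeasure \<mu> {y. l < p y}"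
      by (subst nn_integral_cmult_indicator) auto
    finally show "(\<integral>\<^sup>+ y. indicator {0..<M} l * indicator {z. snd z < p (fst z)} (y, l) \<partial>\<mu>)
      = emeasure \<mu> {y. l < p y} * indicator {0..<M} l" by (simp add: mult.commute)
  qed
  finally show ?thesis .
qed

lemma (in real_distribution) integrable_bounded:
  fixes f :: "real \<Rightarrow> real"
  assumes "f \<in> borel_measurable borel" "\<And>y. \<bar>f y\<bar> \<le> B"
  shows "integrable M f"
  by (rule integrable_const_bound[of _ B]) (use assms in auto)

text \<open>
  By the layer cake formula the expectation of \<open>p\<close> integrates the masses of its superlevel sets
  over levels in \<open>[0, M)\<close>, and all these sets are half-lines.
\<close>
lemma mono_expectation_le:
  fixes p :: "real \<Rightarrow> real"
  assumes "real_distribution \<mu>" "real_distribution \<nu>" and "mono p"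
    and p: "\<And>y. 0 \<le> p y" "\<And>y. p y \<le> M" and "0 \<le> e"
    and rays: "\<And>c. measure \<nu> {c..} \<le> measure \<mu> {c<..} + e"
  shows "(\<integral>y. p y \<partial>\<nu>) \<le> (\<integral>y. p y \<partial>\<mu>) + M * e"
proof -
  interpret A: real_distribution \<mu> by fact
  interpret B: real_distribution \<nu> by fact
  have M: "0 \<le> M" using p(1)[of 0] p(2)[of 0] by linarith
  have [measurable]: "p \<in> borel_measurable borel" by (rule borel_measurable_mono) fact
  have superlevel: "emeasure \<nu> {y. l < p y} \<le> emeasure \<mu> {y. l < p y} + ennreal e" for l
  proof -
    have "measure \<nu> {y. l < p y} \<le> measure \<mu> {y. l < p y} + e"
    proof -
      have i: "measure \<mu> {c<..} \<le> measure \<mu> {c..}" "measure \<nu> {c<..} \<le> measure \<nu> {c..}" for c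
        by (auto intro!: A.finite_measure_mono B.finite_measure_mono)
      consider "{y. l < p y} = {}" | "{y. l < p y} = UNIV" | c where "{y. l < p y} = {c..}"
        | c where "{y. l < p y} = {c<..}"
        using mono_superlevel_cases[OF \<open>mono p\<close>] by blast
      then show ?thesis
      proof cases
        case 2
        then show ?thesis using A.prob_space B.prob_space \<open>0 \<le> e\<close> by simp
      next
        case (3 c)
        then show ?thesis using rays[of c] i[of c] by simp
      next
        case (4 c)
        then show ?thesis using rays[of c] i[of c] by simp
      qed (use \<open>0 \<le> e\<close> in simp)
    qed
    then show ?thesis
      using \<open>0 \<le> e\<close>
      by (simp add: A.emeasure_eq_measure B.emeasure_eq_measure flip: ennreal_plus)
  qed
  have int: "integrable \<mu> p" "integrable \<nu> p"
    by (rule A.integrable_bounded[of _ M] B.integrable_bounded[of _ M]; use p in auto)+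
  have "ennreal (\<integral>y. p y \<partial>\<nu>) = (\<integral>\<^sup>+ y. ennreal (p y) \<partial>\<nu>)"
    using int p by (simp add: nn_integral_eq_integral)
  also have "\<dots> = (\<integral>\<^sup>+ l. emeasure \<nu> {y. l < p y} * indicator {0..<M} l \<partial>lborel)"
    by (rule nn_integral_layer_cake) (use p assms in auto)
  also have "\<dots> \<le> (\<integral>\<^sup>+ l. emeasure \<mu> {y. l < p y} * indicator {0..<M} l + ennreal e * indicator {0..<M} l \<partial>lborel)"
    by (intro nn_integral_mono) (auto simp: superlevel split: split_indicator)
  also have "\<dots> = (\<integral>\<^sup>+ l. emeasure \<mu> {y. l < p y} * indicator {0..<M} l \<partial>lborel)
      + (\<integral>\<^sup>+ l. ennreal e * indicator {0..<M} l \<partial>lborel)"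
  proof (rule nn_integral_add)
    note A.events_eq_borel[measurable_cong]
    have "{z \<in> space (borel \<Otimes>\<^sub>M \<mu>). fst z < p (snd z)} \<in> sets (borel \<Otimes>\<^sub>M \<mu>)"
      by measurable
    then have "(\<lambda>l. emeasure \<mu> (Pair l -` {z \<in> space (borel \<Otimes>\<^sub>M \<mu>). fst z < p (snd z)})) \<in> borel_measurable borel"
      by (rule A.measurable_emeasure_Pair)
    then have "(\<lambda>l. emeasure \<mu> {y. l < p y}) \<in> borel_measurable borel"
      by (simp add: space_pair_measure vimage_def)
    then show "(\<lambda>l. emeasure \<mu> {y. l < p y} * indicator {0..<M} l) \<in> borel_measurable lborel"
      by simp
  qed simp
  also have "(\<integral>\<^sup>+ l. emeasure \<mu> {y. l < p y} * indicator {0..<M} l \<partial>lborel) = (\<integral>\<^sup>+ y. ennreal (p y) \<partial>\<mu>)"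
    by (rule nn_integral_layer_cake[symmetric]) (use p assms in auto)
  also have "\<dots> = ennreal (\<integral>y. p y \<partial>\<mu>)"
    using int p by (simp add: nn_integral_eq_integral)
  also have "(\<integral>\<^sup>+ l. ennreal e * indicator {0..<M} l \<partial>lborel) = ennreal (M * e)"
    using M \<open>0 \<le> e\<close> by (simp add: nn_integral_cmult_indicator ennreal_mult mult.commute)
  also have "ennreal (\<integral>y. p y \<partial>\<mu>) + ennreal (M * e) = ennreal ((\<integral>y. p y \<partial>\<mu>) + M * e)"
    using M \<open>0 \<le> e\<close> p by (intro ennreal_plus[symmetric]) (auto intro!: integral_nonneg)
  finally show ?thesis
    using M \<open>0 \<le> e\<close> p by (subst (asm) ennreal_le_iff) (auto intro!: integral_nonneg add_nonneg_nonneg)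
qed

text \<open>
  The description of \<open>W_inf \<mu> \<nu> \<le> d\<close> by distribution functions. It is what a coupling within
  distance \<open>d\<close> implies and what the comparison of solutions produces, and it passes through
  expectations of monotone functions without constructing any coupling.
\<close>
definition cdf_close :: "real \<Rightarrow> real measure \<Rightarrow> real measure \<Rightarrow> bool" where
  "cdf_close d \<mu> \<nu> \<longleftrightarrow> (\<forall>x. cdf \<mu> x \<le> cdf \<nu> (x + d) \<and> cdf \<nu> x \<le> cdf \<mu> (x + d))"

lemma (in real_distribution) measure_greaterThan: "measure M {c<..} = 1 - cdf M c"
proof -
  have "{c<..} = space M - {..c}" by auto
  then show ?thesis unfolding cdf_def2 by (simp only:) (rule prob_compl, simp)
qed

text \<open>
  Closed and open half-lines have to be distinguished since \<open>\<nu>\<close> may have atoms; moving the end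
  point by a small \<open>\<eta>\<close> costs at most \<open>K \<eta>\<close>, because the Lipschitz bound is on the side of \<open>\<mu>\<close>.
\<close>
lemma mono_expectation_close:
  fixes p :: "real \<Rightarrow> real"
  assumes "real_distribution \<mu>" "real_distribution \<nu>" and "mono p"
    and p: "\<And>y. 0 \<le> p y" "\<And>y. p y \<le> M" and "0 \<le> d"
    and close: "cdf_close d \<mu> \<nu>" and lip: "K-lipschitz_on UNIV (cdf \<mu>)"
  shows "\<bar>(\<integral>y. p y \<partial>\<nu>) - (\<integral>y. p y \<partial>\<mu>)\<bar> \<le> M * (K * d)"
proof -
  interpret A: real_distribution \<mu> by fact
  interpret B: real_distribution \<nu> by fact
  have K: "0 \<le> K" using lip by (rule lipschitz_on_nonneg)
  have L: "cdf \<mu> y - cdf \<mu> x \<le> K * (y - x)" if "x \<le> y" for x y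
    using lipschitz_onD[OF lip, of y x] that by (auto simp: dist_real_def)
  have 1: "measure \<nu> {c..} \<le> measure \<mu> {c<..} + K * d" for c
  proof (rule field_le_epsilon)
    fix h :: real assume "h > 0"
    define \<eta> where "\<eta> = h / (K + 1)"
    have \<eta>: "\<eta> > 0" "K * \<eta> \<le> h" using K \<open>h > 0\<close> by (auto simp: \<eta>_def field_simps)
    have "measure \<nu> {c..} \<le> measure \<nu> {c - \<eta><..}"
      using \<eta> by (intro B.finite_measure_mono) auto
    also have "\<dots> = 1 - cdf \<nu> (c - \<eta>)" by (rule B.measure_greaterThan)
    also have "\<dots> \<le> 1 - cdf \<mu> (c - \<eta> - d)"
      using close[unfolded cdf_close_def, rule_format, of "c - \<eta> - d"] by simp
    also have "\<dots> \<le> 1 - cdf \<mu> c + K * (\<eta> + d)"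
      using L[of "c - \<eta> - d" c] \<eta> \<open>0 \<le> d\<close> by (simp add: algebra_simps)
    also have "\<dots> \<le> measure \<mu> {c<..} + K * d + h"
      using \<eta> by (simp add: A.measure_greaterThan algebra_simps)
    finally show "measure \<nu> {c..} \<le> measure \<mu> {c<..} + K * d + h" .
  qed
  have 2: "measure \<mu> {c..} \<le> measure \<nu> {c<..} + K * d" for c
  proof (rule field_le_epsilon)
    fix h :: real assume "h > 0"
    define \<eta> where "\<eta> = h / (K + 1)"
    have \<eta>: "\<eta> > 0" "K * \<eta> \<le> h" using K \<open>h > 0\<close> by (auto simp: \<eta>_def field_simps)
    have "measure \<mu> {c..} \<le> measure \<mu> {c - \<eta><..}"
      using \<eta> by (intro A.finite_measure_mono) auto
    also have "\<dots> = 1 - cdf \<mu> (c - \<eta>)" by (rule A.measure_greaterThan)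
    also have "\<dots> \<le> 1 - cdf \<mu> (c + d) + K * (d + \<eta>)"
      using L[of "c - \<eta>" "c + d"] \<eta> \<open>0 \<le> d\<close> by (simp add: algebra_simps)
    also have "\<dots> \<le> 1 - cdf \<nu> c + K * (d + \<eta>)"
      using close[unfolded cdf_close_def, rule_format, of c] by simp
    also have "\<dots> \<le> measure \<nu> {c<..} + K * d + h"
      using \<eta> by (simp add: B.measure_greaterThan algebra_simps)
    finally show "measure \<mu> {c..} \<le> measure \<nu> {c<..} + K * d + h" .
  qed
  have Kd: "0 \<le> K * d" using K \<open>0 \<le> d\<close> by simp
  have "(\<integral>y. p y \<partial>\<nu>) \<le> (\<integral>y. p y \<partial>\<mu>) + M * (K * d)"
    by (rule mono_expectation_le) (use assms Kd 1 in auto)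
  moreover have "(\<integral>y. p y \<partial>\<mu>) \<le> (\<integral>y. p y \<partial>\<nu>) + M * (K * d)"
    by (rule mono_expectation_le) (use assms Kd 2 in auto)
  ultimately show ?thesis by linarith
qed

text \<open>
  Evaluating the convolution at \<open>x'\<close> instead of \<open>x\<close> amounts to translating the measure, which is a
  perturbation of size \<open>\<bar>x - x'\<bar>\<close> in the sense of \<open>cdf_close\<close>. So continuity in space and in the
  measure are the same estimate.
\<close>
lemma kernel_estimate:
  fixes w p n :: "real \<Rightarrow> real"
  assumes \<mu>: "real_distribution \<mu>" and \<nu>: "real_distribution \<nu>" and m: "mono p" "mono n"
    and bounds: "\<And>y. 0 \<le> p y" "\<And>y. p y \<le> M" "\<And>y. 0 \<le> n y" "\<And>y. n y \<le> M"
    and w: "\<And>y. w y = p y - n y" and "0 \<le> d"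
    and close: "cdf_close d \<mu> \<nu>" and lip: "K-lipschitz_on UNIV (cdf \<mu>)"
  shows "\<bar>(\<integral>y. w (y - x) \<partial>\<nu>) - (\<integral>y. w (y - x') \<partial>\<mu>)\<bar> \<le> 2 * M * K * (d + \<bar>x - x'\<bar>)"
proof -
  interpret A: real_distribution \<mu> by fact
  interpret B: real_distribution \<nu> by fact
  define h where "h = x - x'"
  define \<mu>' where "\<mu>' = distr \<mu> borel (\<lambda>y. y + h)"
  have \<mu>': "real_distribution \<mu>'"
    unfolding \<mu>'_def by (rule A.real_distribution_distr) simp
  have [measurable]: "p \<in> borel_measurable borel" "n \<in> borel_measurable borel"
    using m by (auto intro: borel_measurable_mono)
  have cdf': "cdf \<mu>' z = cdf \<mu> (z - h)" for z
  proof -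
    have "(\<lambda>y. y + h) -` {..z} = {..z - h}" by auto
    then show ?thesis unfolding cdf_def2 \<mu>'_def by (subst measure_distr) auto
  qed
  have close': "cdf_close (d + \<bar>h\<bar>) \<mu>' \<nu>"
    unfolding cdf_close_def
  proof (intro allI conjI)
    fix z
    have "cdf \<mu>' z \<le> cdf \<nu> (z - h + d)"
      unfolding cdf' using close by (auto simp: cdf_close_def)
    also have "\<dots> \<le> cdf \<nu> (z + (d + \<bar>h\<bar>))" by (rule B.cdf_nondecreasing) simp
    finally show "cdf \<mu>' z \<le> cdf \<nu> (z + (d + \<bar>h\<bar>))" .
    have "cdf \<nu> z \<le> cdf \<mu> (z + d)"
      using close by (auto simp: cdf_close_def)
    also have "\<dots> \<le> cdf \<mu>' (z + (d + \<bar>h\<bar>))"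
      unfolding cdf' by (rule A.cdf_nondecreasing) simp
    finally show "cdf \<nu> z \<le> cdf \<mu>' (z + (d + \<bar>h\<bar>))" .
  qed
  have lip': "K-lipschitz_on UNIV (cdf \<mu>')"
  proof (rule lipschitz_onI)
    fix a b
    show "dist (cdf \<mu>' a) (cdf \<mu>' b) \<le> K * dist a b"
      unfolding cdf' using lipschitz_onD[OF lip, of "a - h" "b - h"] by (simp add: dist_real_def)
  qed (use lip in \<open>rule lipschitz_on_nonneg\<close>)
  have est: "\<bar>(\<integral>y. q (y - x) \<partial>\<nu>) - (\<integral>y. q (y - x') \<partial>\<mu>)\<bar> \<le> M * (K * (d + \<bar>h\<bar>))"
    if "mono q" "\<And>y. 0 \<le> q y" "\<And>y. q y \<le> M" for q :: "real \<Rightarrow> real"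
  proof -
    have mq: "mono (\<lambda>y. q (y - x))"
      using \<open>mono q\<close> by (auto simp: mono_def)
    have "\<bar>(\<integral>y. q (y - x) \<partial>\<nu>) - (\<integral>y. q (y - x) \<partial>\<mu>')\<bar> \<le> M * (K * (d + \<bar>h\<bar>))"
      by (rule mono_expectation_close[OF \<mu>' \<nu> mq _ _ _ close' lip']) (use that \<open>0 \<le> d\<close> in auto)
    also have "(\<integral>y. q (y - x) \<partial>\<mu>') = (\<integral>y. q (y + h - x) \<partial>\<mu>)"
      unfolding \<mu>'_def using borel_measurable_mono[OF mq] by (subst integral_distr) auto
    also have "(\<lambda>y. q (y + h - x)) = (\<lambda>y. q (y - x'))"
      by (simp add: h_def algebra_simps)
    finally show ?thesis .
  qed
  have w_split: "(\<integral>y. w (y - c) \<partial>\<kappa>) = (\<integral>y. p (y - c) \<partial>\<kappa>) - (\<integral>y. n (y - c) \<partial>\<kappa>)"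
    if "real_distribution \<kappa>" for \<kappa> c
  proof -
    interpret real_distribution \<kappa> by fact
    show ?thesis unfolding w
      by (rule Bochner_Integration.integral_diff; rule integrable_bounded[of _ M]) (use bounds in auto)
  qed
  have "\<bar>(\<integral>y. w (y - x) \<partial>\<nu>) - (\<integral>y. w (y - x') \<partial>\<mu>)\<bar> \<le> M * (K * (d + \<bar>h\<bar>)) + M * (K * (d + \<bar>h\<bar>))"
    unfolding w_split[OF \<mu>] w_split[OF \<nu>]
    using est[OF m(1) bounds(1,2)] est[OF m(2) bounds(3,4)] by linarith
  then show ?thesis by (simp add: h_def algebra_simps)
qed

lemma cdf_close_sym: "cdf_close d \<mu> \<nu> \<Longrightarrow> cdf_close d \<nu> \<mu>"
  by (auto simp: cdf_close_def)

text \<open>Right continuity of distribution functions lets \<open>d\<close> tend to \<open>0\<close>.\<close>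
lemma cdf_close_all_imp_eq:
  assumes "\<And>d. 0 < d \<Longrightarrow> cdf_close d \<mu> \<nu>" "real_distribution \<mu>" "real_distribution \<nu>"
  shows "\<mu> = \<nu>"
proof -
  interpret A: real_distribution \<mu> by fact
  interpret B: real_distribution \<nu> by fact
  have le: "cdf \<kappa> x \<le> cdf \<kappa>' x"
    if "\<And>d. 0 < d \<Longrightarrow> cdf \<kappa> x \<le> cdf \<kappa>' (x + d)" "real_distribution \<kappa>'" for \<kappa> \<kappa>' x
  proof -
    interpret real_distribution \<kappa>' by fact
    have "(cdf \<kappa>' \<longlongrightarrow> cdf \<kappa>' x) (at_right x)"
      using cdf_is_right_cont[of x] by (simp add: continuous_within)
    then show ?thesis
    proof (rule tendsto_lowerbound)
      show "\<forall>\<^sub>F y in at_right x. cdf \<kappa> x \<le> cdf \<kappa>' y"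
        unfolding eventually_at_filter
        using that(1)[of "y - x" for y] by (intro always_eventually) auto
    qed simp
  qed
  have "cdf \<mu> x = cdf \<nu> x" for x
    using le[of \<mu> x \<nu>] le[of \<nu> x \<mu>] assms by (auto simp: cdf_close_def intro!: antisym)
  then show ?thesis by (intro cdf_unique assms ext)
qed

lemma (in real_distribution) cdf_le_expectation:
  assumes [measurable]: "f \<in> borel_measurable borel" and "\<And>x. 0 \<le> f x" "\<And>x. f x \<le> 1"
  shows "(\<And>x. x \<le> c \<Longrightarrow> f x = 1) \<Longrightarrow> cdf M c \<le> (\<integral>x. f x \<partial>M)"
    and "(\<And>x. c \<le> x \<Longrightarrow> f x = 0) \<Longrightarrow> (\<integral>x. f x \<partial>M) \<le> cdf M c"
proof -
  have int: "integrable M f" by (rule integrable_bounded[of _ 1]) (use assms in auto)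
  have cdf: "cdf M c = (\<integral>x. indicator {..c} x \<partial>M)" by (simp add: cdf_def2)
  have ind: "integrable M (indicator {..c} :: real \<Rightarrow> real)"
    by (rule integrable_bounded[of _ 1]) (auto simp: indicator_def)
  show "cdf M c \<le> (\<integral>x. f x \<partial>M)" if "\<And>x. x \<le> c \<Longrightarrow> f x = 1"
    unfolding cdf by (rule integral_mono[OF ind int]) (use that assms in \<open>auto simp: indicator_def\<close>)
  show "(\<integral>x. f x \<partial>M) \<le> cdf M c" if "\<And>x. c \<le> x \<Longrightarrow> f x = 0"
    unfolding cdf by (rule integral_mono[OF int ind]) (use that assms in \<open>auto simp: indicator_def\<close>)
qed

section \<open>Measures with bounded density and the distance W-infinity\<close>

lemma Linf_Pac_c_D:
  assumes "\<mu> \<in> Linf_Pac_c"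
  shows "real_distribution \<mu>" "\<exists>C. C-lipschitz_on UNIV (cdf \<mu>)" "\<exists>R>0. AE x in \<mu>. \<bar>x\<bar> \<le> R"
proof -
  from assms obtain K f C where "prob_space \<mu>" and K: "compact K" "emeasure \<mu> (- K) = 0"
    and [measurable]: "f \<in> borel_measurable borel" and f: "\<And>x. 0 \<le> f x"
      "\<mu> = density lborel (\<lambda>x. ennreal (f x))" "AE x in lborel. f x \<le> C"
    unfolding Linf_Pac_c_def by blast
  interpret prob_space \<mu> by fact
  have sets: "sets \<mu> = sets borel" unfolding f by simp
  show rd: "real_distribution \<mu>"
    by standard (use sets in auto)
  interpret real_distribution \<mu> by fact
  define L where "L = max C 0"
  have "emeasure \<mu> {a<..b} \<le> ennreal (L * (b - a))" if "a \<le> b" for a b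
  proof -
    have "emeasure \<mu> {a<..b} = (\<integral>\<^sup>+ x. ennreal (f x) * indicator {a<..b} x \<partial>lborel)"
      unfolding f by (subst emeasure_density) auto
    also have "\<dots> \<le> (\<integral>\<^sup>+ x. ennreal L * indicator {a<..b} x \<partial>lborel)"
      by (rule nn_integral_mono_AE)
         (use f(3) in \<open>eventually_elim, auto simp: L_def ennreal_leI max.coboundedI1 split: split_indicator\<close>)
    also have "\<dots> = ennreal (L * (b - a))"
      using that by (simp add: nn_integral_cmult_indicator ennreal_mult L_def)
    finally show ?thesis .
  qed
  then have *: "cdf \<mu> b - cdf \<mu> a \<le> L * (b - a)" if "a \<le> b" for a b
    using emeasure_Ioc[OF that] that
    by (metis L_def emeasure_Ioc ennreal_le_iff max.cobounded2 mult_nonneg_nonneg diff_ge_0_iff_ge)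
  have "L-lipschitz_on UNIV (cdf \<mu>)"
  proof (rule lipschitz_onI)
    fix x y
    show "dist (cdf \<mu> x) (cdf \<mu> y) \<le> L * dist x y"
      using *[of x y] *[of y x] cdf_nondecreasing[of x y] cdf_nondecreasing[of y x]
      by (cases "x \<le> y") (auto simp: dist_real_def)
  qed (simp add: L_def)
  then show "\<exists>C. C-lipschitz_on UNIV (cdf \<mu>)" by blast
  from K(1) obtain R where R: "R > 0" "\<And>x. x \<in> K \<Longrightarrow> \<bar>x\<bar> \<le> R"
    by (metis bounded_pos compact_imp_bounded real_norm_def)
  have "AE x in \<mu>. x \<in> K"
  proof (rule AE_I[of _ _ "- K"])
    show "- K \<in> sets \<mu>"
      unfolding sets by (intro borel_comp borel_closed compact_imp_closed K)
  qed (use K in auto)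
  then have "AE x in \<mu>. \<bar>x\<bar> \<le> R" by eventually_elim (rule R)
  with R show "\<exists>R>0. AE x in \<mu>. \<bar>x\<bar> \<le> R" by blast
qed

text \<open>
  A Lipschitz bound on the distribution function turns \<open>K x - cdf \<mu> x\<close> into a nondecreasing
  function as well. Its measure complements \<open>\<mu>\<close> to \<open>K\<close> times Lebesgue measure, first on half-open
  intervals and hence on all Borel sets.
\<close>
lemma cdf_lipschitz_complement:
  assumes "real_distribution \<mu>" and lip: "K-lipschitz_on UNIV (cdf \<mu>)"
  defines "\<nu> \<equiv> interval_measure (\<lambda>x. K * x - cdf \<mu> x)"
  assumes A: "A \<in> sets borel"
  shows "emeasure \<mu> A + emeasure \<nu> A = ennreal K * emeasure lborel A"
proof -
  interpret real_distribution \<mu> by fact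
  have K: "0 \<le> K" using lip by (rule lipschitz_on_nonneg)
  have L: "cdf \<mu> y - cdf \<mu> x \<le> K * (y - x)" if "x \<le> y" for x y
    using lipschitz_onD[OF lip, of y x] that by (auto simp: dist_real_def)
  have \<nu>: "emeasure \<nu> {a<..b} = ennreal (K * (b - a) - (cdf \<mu> b - cdf \<mu> a))" if "a \<le> b" for a b
    unfolding \<nu>_def
  proof (subst emeasure_interval_measure_Ioc)
    show "continuous (at_right x) (\<lambda>x. K * x - cdf \<mu> x)" for x
      by (intro continuous_intros cdf_is_right_cont)
  qed (use that L in \<open>auto simp: algebra_simps\<close>)
  define S where "S = measure_of UNIV (sets borel) (\<lambda>A. emeasure \<mu> A + emeasure \<nu> A)"
  have S: "emeasure S B = emeasure \<mu> B + emeasure \<nu> B" if "B \<in> sets borel" for B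
    unfolding S_def
  proof (rule emeasure_measure_of_sigma)
    show "sigma_algebra UNIV (sets (borel :: real measure))"
      using sets.sigma_algebra_axioms[of borel] by simp
    show "countably_additive (sets borel) (\<lambda>A. emeasure \<mu> A + emeasure \<nu> A)"
    proof (rule countably_additiveI)
      fix F :: "nat \<Rightarrow> real set"
      assume F: "range F \<subseteq> sets borel" "disjoint_family F"
      have "(\<Sum>i. emeasure \<mu> (F i) + emeasure \<nu> (F i)) = (\<Sum>i. emeasure \<mu> (F i)) + (\<Sum>i. emeasure \<nu> (F i))"
        by (rule suminf_add[symmetric]) auto
      then show "(\<Sum>i. emeasure \<mu> (F i) + emeasure \<nu> (F i)) = emeasure \<mu> (\<Union>i. F i) + emeasure \<nu> (\<Union>i. F i)"
        using F by (subst (asm) (1 2) suminf_emeasure) (auto simp: \<nu>_def)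
    qed
  qed (use that in \<open>auto simp: positive_def\<close>)
  have Ioc: "sets (borel :: real measure) = sigma_sets UNIV (range (\<lambda>(a, b). {a<..b}))"
    by (subst borel_sigma_sets_Ioc) (simp add: sets_measure_of)
  have "S = density lborel (\<lambda>_. ennreal K)"
  proof (rule measure_eqI_generator_eq[where E="range (\<lambda>(a, b). {a<..b})" and \<Omega>=UNIV and A="\<lambda>i. {- real i<..real i}"])
    show "Int_stable (range (\<lambda>(a::real, b). {a<..b}))"
      by (auto simp: Int_stable_def image_iff Int_greaterThanAtMost)
    show "sets S = sigma_sets UNIV (range (\<lambda>(a::real, b). {a<..b}))"
      unfolding S_def using sets.sigma_sets_eq[of "borel :: real measure"] Ioc by simp
    show "sets (density lborel (\<lambda>_. ennreal K)) = sigma_sets UNIV (range (\<lambda>(a::real, b). {a<..b}))"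
      using Ioc by simp
    show "emeasure S X = emeasure (density lborel (\<lambda>_. ennreal K)) X"
      if "X \<in> range (\<lambda>(a, b). {a<..b})" for X
    proof -
      from that obtain a b where X: "X = {a<..b}" by auto
      show ?thesis
      proof (cases "a \<le> b")
        case True
        have "emeasure \<mu> {a<..b} = ennreal (cdf \<mu> b - cdf \<mu> a)"
          by (rule emeasure_Ioc[OF True])
        then show ?thesis
          using True K L[OF True] cdf_nondecreasing[OF True] unfolding X
          by (simp add: S \<nu> emeasure_density nn_integral_cmult_indicator ennreal_mult flip: ennreal_plus)
      qed (simp add: X)
    qed
    show "(\<Union>i. {- real i<..real i}) = UNIV" by (rule UN_Ioc_eq_UNIV)
    show "emeasure S {- real i<..real i} \<noteq> \<infinity>" for i
      by (simp add: S \<nu> emeasure_eq_measure)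
  qed auto
  then have "emeasure S A = ennreal K * emeasure lborel A"
    using A by (simp add: emeasure_density nn_integral_cmult_indicator)
  then show ?thesis using S[OF A] by simp
qed

text \<open>
  Both \<open>\<mu>\<close> and its complement in \<open>K\<close> times Lebesgue measure have densities by the
  Radon-Nikodym theorem; these add up to \<open>K\<close>, so the density of \<open>\<mu>\<close> is at most \<open>K\<close>.
\<close>
lemma Linf_Pac_c_I:
  assumes "real_distribution \<mu>" and lip: "K-lipschitz_on UNIV (cdf \<mu>)" and R: "AE x in \<mu>. \<bar>x\<bar> \<le> R"
  shows "\<mu> \<in> Linf_Pac_c"
proof -
  interpret real_distribution \<mu> by fact
  have K: "0 \<le> K" using lip by (rule lipschitz_on_nonneg)
  define \<nu> where "\<nu> = interval_measure (\<lambda>x. K * x - cdf \<mu> x)"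
  have sum: "emeasure \<mu> A + emeasure \<nu> A = ennreal K * emeasure lborel A" if "A \<in> sets borel" for A
    unfolding \<nu>_def by (rule cdf_lipschitz_complement) fact+
  have sets_\<nu>: "sets \<nu> = sets borel" by (simp add: \<nu>_def)
  have "absolutely_continuous lborel \<mu>"
    unfolding absolutely_continuous_def
  proof
    fix N assume "N \<in> null_sets (lborel :: real measure)"
    then have N: "N \<in> sets borel" "emeasure lborel N = 0" by auto
    then have "emeasure \<mu> N + emeasure \<nu> N = 0" using sum[of N] by simp
    then show "N \<in> null_sets \<mu>" using N by (auto simp: null_sets_def)
  qed
  then obtain f where [measurable]: "f \<in> borel_measurable borel" and f: "density lborel f = \<mu>"
    using sigma_finite_measure.Radon_Nikodym[OF lborel.sigma_finite_measure_axioms, of \<mu>] by (auto simp: events_eq_borel)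
  have "absolutely_continuous lborel \<nu>"
    unfolding absolutely_continuous_def
  proof
    fix N assume "N \<in> null_sets (lborel :: real measure)"
    then have N: "N \<in> sets borel" "emeasure lborel N = 0" by auto
    then have "emeasure \<mu> N + emeasure \<nu> N = 0" using sum[of N] by simp
    then show "N \<in> null_sets \<nu>" using N by (auto simp: null_sets_def sets_\<nu>)
  qed
  then obtain g where [measurable]: "g \<in> borel_measurable borel" and g: "density lborel g = \<nu>"
    using sigma_finite_measure.Radon_Nikodym[OF lborel.sigma_finite_measure_axioms, of \<nu>] by (auto simp: sets_\<nu>)
  have "density lborel (\<lambda>x. f x + g x) = density lborel (\<lambda>_. ennreal K)"
  proof (rule measure_eqI)
    fix A assume "A \<in> sets (density lborel (\<lambda>x. f x + g x))"
    then have A: "A \<in> sets borel" by simp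
    have "emeasure (density lborel (\<lambda>x. f x + g x)) A = emeasure (density lborel f) A + emeasure (density lborel g) A"
      using A by (simp add: emeasure_density nn_integral_add distrib_right)
    then show "emeasure (density lborel (\<lambda>x. f x + g x)) A = emeasure (density lborel (\<lambda>_. ennreal K)) A"
      using A sum[OF A] unfolding f g by (simp add: emeasure_density nn_integral_cmult_indicator)
  qed simp
  then have "AE x in lborel. f x + g x = ennreal K"
    by (subst (asm) sigma_finite_measure.density_unique_iff[OF lborel.sigma_finite_measure_axioms]) auto
  then have fK: "AE x in lborel. f x \<le> ennreal K"
    by eventually_elim (metis le_iff_add)
  define f' where "f' x = min K (enn2real (f x))" for x
  have "AE x in lborel. f x = ennreal (f' x)"
    using fK
  proof eventually_elim
    case (elim x)
    then have "f x < top" by (auto intro: le_less_trans)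
    with elim K show ?case
      by (cases "f x") (auto simp: f'_def min_absorb2)
  qed
  then have "density lborel f = density lborel (\<lambda>x. ennreal (f' x))"
    by (intro density_cong) (auto simp: f'_def)
  then have dens: "\<mu> = density lborel (\<lambda>x. ennreal (f' x))" using f by simp
  have "emeasure \<mu> (- {- R..R}) = 0"
  proof -
    have "emeasure \<mu> {x \<in> space \<mu>. \<not> \<bar>x\<bar> \<le> R} = 0"
      using R by (subst (asm) AE_iff_measurable[OF _ refl]) auto
    also have "{x \<in> space \<mu>. \<not> \<bar>x\<bar> \<le> R} = - {- R..R}" by auto
    finally show ?thesis .
  qed
  then have "\<exists>K. compact K \<and> emeasure \<mu> (- K) = 0" by (intro exI[of _ "{- R..R}"]) auto
  moreover have "f' \<in> borel_measurable borel" "\<forall>x. 0 \<le> f' x" "AE x in lborel. f' x \<le> K"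
    using K by (auto simp: f'_def[abs_def])
  ultimately show ?thesis
    unfolding Linf_Pac_c_def using dens prob_space_axioms by blast
qed

lemma W_inf_less_coupling:
  assumes "W_inf \<mu> \<nu> < ennreal d"
  obtains \<pi> where "\<pi> \<in> couplings \<mu> \<nu>" "AE z in \<pi>. \<bar>fst z - snd z\<bar> \<le> d"
proof -
  from assms obtain \<pi> where \<pi>: "\<pi> \<in> couplings \<mu> \<nu>" "esssup \<pi> (\<lambda>(x, y). ennreal \<bar>x - y\<bar>) < ennreal d"
    unfolding W_inf_def INF_less_iff by blast
  have "AE z in \<pi>. (\<lambda>(x, y). ennreal \<bar>x - y\<bar>) z \<le> esssup \<pi> (\<lambda>(x, y). ennreal \<bar>x - y\<bar>)"
    by (rule esssup_AE)
  then have "AE z in \<pi>. \<bar>fst z - snd z\<bar> \<le> d"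
  proof eventually_elim
    case (elim z)
    then have "ennreal \<bar>fst z - snd z\<bar> < ennreal d" using \<pi>(2) by (auto simp: split_beta)
    then show ?case by (simp add: ennreal_less_iff)
  qed
  with \<pi>(1) that show thesis by blast
qed

lemma W_inf_distr_le:
  assumes "real_distribution M" and [measurable]: "X \<in> borel_measurable borel" "Y \<in> borel_measurable borel"
    and d: "\<And>z. \<bar>X z - Y z\<bar> \<le> d"
  shows "W_inf (distr M borel X) (distr M borel Y) \<le> ennreal d"
proof -
  interpret real_distribution M by fact
  note events_eq_borel[measurable_cong]
  define \<pi> where "\<pi> = distr M (borel \<Otimes>\<^sub>M borel) (\<lambda>z. (X z, Y z))"
  have "\<pi> \<in> couplings (distr M borel X) (distr M borel Y)"
    unfolding couplings_def \<pi>_def by (auto simp: distr_distr comp_def)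
  then have "W_inf (distr M borel X) (distr M borel Y) \<le> esssup \<pi> (\<lambda>(x, y). ennreal \<bar>x - y\<bar>)"
    unfolding W_inf_def by (rule INF_lower)
  also have "\<dots> \<le> ennreal d"
  proof (rule esssup_I)
    show "(\<lambda>(x, y). ennreal \<bar>x - y\<bar>) \<in> borel_measurable \<pi>"
      unfolding \<pi>_def by (simp add: split_beta)
    show "AE x in \<pi>. (case x of (x, y) \<Rightarrow> ennreal \<bar>x - y\<bar>) \<le> ennreal d"
      unfolding \<pi>_def by (subst AE_distr_iff) (auto simp: split_beta d intro!: ennreal_leI)
  qed
  finally show ?thesis .
qed

lemma coupling_prob_space:
  assumes "\<pi> \<in> couplings \<mu> \<nu>" and "real_distribution \<mu>"
  shows "prob_space \<pi>" "fst \<in> borel_measurable \<pi>" "snd \<in> borel_measurable \<pi>" "space \<pi> = UNIV"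
    "\<mu> = distr \<pi> borel fst" "\<nu> = distr \<pi> borel snd"
proof -
  have sets: "sets \<pi> = sets (borel \<Otimes>\<^sub>M borel)" and m: "\<mu> = distr \<pi> borel fst" "\<nu> = distr \<pi> borel snd"
    using assms(1) by (auto simp: couplings_def)
  note sets[measurable_cong]
  show 1: "fst \<in> borel_measurable \<pi>" and "snd \<in> borel_measurable \<pi>" by measurable
  show "space \<pi> = UNIV" using sets_eq_imp_space_eq[OF sets] by (simp add: space_pair_measure)
  show "\<mu> = distr \<pi> borel fst" "\<nu> = distr \<pi> borel snd" by fact+
  have "prob_space (distr \<pi> borel fst)"
    using assms(2) m by (simp add: real_distribution_def)
  then show "prob_space \<pi>" by (rule prob_space_distrD[OF 1])
qed

lemma coupling_cdf_close:
  assumes \<pi>: "\<pi> \<in> couplings \<mu> \<nu>" and "real_distribution \<mu>"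
    and d: "AE z in \<pi>. \<bar>fst z - snd z\<bar> \<le> d"
  shows "cdf_close d \<mu> \<nu>"
proof -
  note c = coupling_prob_space[OF \<pi> assms(2)]
  interpret prob_space \<pi> by (rule c)
  note c(2,3)[measurable]
  have "cdf \<mu> x = measure \<pi> {z. fst z \<le> x}" "cdf \<nu> x = measure \<pi> {z. snd z \<le> x}" for x
    by (subst c, simp add: cdf_def2 measure_distr c(4) vimage_def)+
  moreover have "{z. fst z \<le> x} \<in> events" "{z. snd z \<le> x} \<in> events" for x
    using measurable_sets[OF c(2), of "{..x}"] measurable_sets[OF c(3), of "{..x}"]
    by (auto simp: c(4) vimage_def)
  ultimately show ?thesis
    unfolding cdf_close_def using d
    by (auto intro!: finite_measure_mono_AE elim: eventually_mono)
qed

lemma W_inf_less_cdf_close: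
  assumes "real_distribution \<mu>" "W_inf \<mu> \<nu> < ennreal d"
  shows "cdf_close d \<mu> \<nu>"
  using W_inf_less_coupling[OF assms(2)] coupling_cdf_close[OF _ assms(1)] by metis

lemma W_inf_less_AE_bound:
  assumes \<mu>: "real_distribution \<mu>" "W_inf \<mu> \<nu> < ennreal d" and R: "AE x in \<nu>. \<bar>x\<bar> \<le> R"
  shows "AE x in \<mu>. \<bar>x\<bar> \<le> R + d"
proof -
  obtain \<pi> where \<pi>: "\<pi> \<in> couplings \<mu> \<nu>" "AE z in \<pi>. \<bar>fst z - snd z\<bar> \<le> d"
    using W_inf_less_coupling[OF assms(2)] .
  note c = coupling_prob_space[OF \<pi>(1) \<mu>(1)]
  have "AE z in \<pi>. \<bar>snd z\<bar> \<le> R"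
    using R by (subst (asm) c(6), subst (asm) AE_distr_iff) (use c(3) in auto)
  with \<pi>(2) have "AE z in \<pi>. \<bar>fst z\<bar> \<le> R + d" by eventually_elim linarith
  then show ?thesis
    by (subst c(5), subst AE_distr_iff) (use c(2) in auto)
qed

text \<open>
  Integrands are only compared on nearby points of a common bounded support. Allowing two
  different integrands covers functions that vary along with the measure.
\<close>
lemma W_inf_less_integral:
  fixes f g :: "real \<Rightarrow> real"
  assumes \<mu>: "real_distribution \<mu>" "W_inf \<mu> \<nu> < ennreal d"
    and supp: "AE x in \<mu>. \<bar>x\<bar> \<le> R" "AE x in \<nu>. \<bar>x\<bar> \<le> R"
    and int: "integrable \<mu> f" "integrable \<nu> g"
    and e: "\<And>x y. \<bar>x\<bar> \<le> R \<Longrightarrow> \<bar>y\<bar> \<le> R \<Longrightarrow> \<bar>x - y\<bar> \<le> d \<Longrightarrow> \<bar>f x - g y\<bar> \<le> e"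
  shows "\<bar>(\<integral>x. f x \<partial>\<mu>) - (\<integral>x. g x \<partial>\<nu>)\<bar> \<le> e"
proof -
  obtain \<pi> where \<pi>: "\<pi> \<in> couplings \<mu> \<nu>" "AE z in \<pi>. \<bar>fst z - snd z\<bar> \<le> d"
    using W_inf_less_coupling[OF assms(2)] .
  note c = coupling_prob_space[OF \<pi>(1) \<mu>(1)]
  interpret prob_space \<pi> by (rule c)
  note c(2,3)[measurable]
  have s: "AE z in \<pi>. \<bar>snd z\<bar> \<le> R" "AE z in \<pi>. \<bar>fst z\<bar> \<le> R"
    using supp(2) by (subst (asm) c(6), subst (asm) AE_distr_iff, use c(3) in auto)
      (use supp(1) in \<open>subst (asm) c(5), subst (asm) AE_distr_iff, use c(2) in auto\<close>)
  have m: "f \<in> borel_measurable borel" "g \<in> borel_measurable borel"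
    using int[THEN borel_measurable_integrable] c(5,6)
    by (metis measurable_distr_eq1)+
  have i: "integrable \<pi> (\<lambda>z. f (fst z))" "integrable \<pi> (\<lambda>z. g (snd z))"
    using int unfolding c(5) c(6) integrable_distr_eq[OF c(2) m(1)] integrable_distr_eq[OF c(3) m(2)]
    by auto
  have "(\<integral>x. f x \<partial>\<mu>) - (\<integral>x. g x \<partial>\<nu>) = (\<integral>z. f (fst z) \<partial>\<pi>) - (\<integral>z. g (snd z) \<partial>\<pi>)"
    by (subst c(5), subst c(6), subst (1 2) integral_distr) (use m in auto)
  also have "\<dots> = (\<integral>z. f (fst z) - g (snd z) \<partial>\<pi>)"
    using i by (simp add: Bochner_Integration.integral_diff)
  also have "\<bar>\<dots>\<bar> \<le> (\<integral>z. \<bar>f (fst z) - g (snd z)\<bar> \<partial>\<pi>)"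
    by (rule integral_abs_bound)
  also have "\<dots> \<le> (\<integral>z. e \<partial>\<pi>)"
  proof (rule integral_mono_AE)
    show "AE z in \<pi>. \<bar>f (fst z) - g (snd z)\<bar> \<le> e"
      using s \<pi>(2) by eventually_elim (use e in auto)
  qed (use i in auto)
  also have "\<dots> = e" by (simp add: prob_space)
  finally show ?thesis .
qed

lemma W_inf_self:
  assumes "real_distribution \<mu>"
  shows "W_inf \<mu> \<mu> = 0"
proof -
  interpret real_distribution \<mu> by fact
  have "distr \<mu> borel (\<lambda>x. x) = \<mu>" by (rule distr_id2) (simp add: events_eq_borel)
  then have "W_inf \<mu> \<mu> \<le> ennreal 0"
    using W_inf_distr_le[OF assms, of "\<lambda>x. x" "\<lambda>x. x" 0] by simp
  then show ?thesis by simp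
qed

section \<open>The nonlocal velocity field\<close>

text \<open>
  The data of the problem with the Jordan decomposition \<open>w = p - n\<close> fixed; \<open>Lv\<close> and \<open>B\<close> are the
  Lipschitz constant and the bound of \<open>v\<close>.
\<close>
locale nonlocal_velocity =
  fixes v w p n :: "real \<Rightarrow> real" and M Lv B :: real
  assumes m: "mono p" "mono n"
    and bounds: "\<And>y. 0 \<le> p y" "\<And>y. p y \<le> M" "\<And>y. 0 \<le> n y" "\<And>y. n y \<le> M"
    and w: "\<And>y. w y = p y - n y" and w_nonneg: "\<And>y. 0 \<le> w y" and M_pos: "0 < M"
    and v_lip: "Lv-lipschitz_on {0..} v" and v_bound: "\<And>x. 0 \<le> x \<Longrightarrow> \<bar>v x\<bar> \<le> B"
begin

lemma Lv_nonneg: "0 \<le> Lv" using v_lip by (rule lipschitz_on_nonneg)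

lemma B_nonneg: "0 \<le> B" using v_bound[of 0] by simp

lemma V_bound: "\<bar>V v w \<mu> x\<bar> \<le> B"
  unfolding V_def by (intro v_bound Bochner_Integration.integral_nonneg w_nonneg)

text \<open>
  The constant involves the density bound \<open>K\<close> of \<open>\<mu>\<close> alone; the uniqueness proof depends on this
  asymmetry.
\<close>
lemma V_estimate:
  assumes "real_distribution \<mu>" "real_distribution \<nu>" "0 \<le> d" "cdf_close d \<mu> \<nu>" "K-lipschitz_on UNIV (cdf \<mu>)"
  shows "\<bar>V v w \<nu> x - V v w \<mu> x'\<bar> \<le> 2 * Lv * M * K * (d + \<bar>x - x'\<bar>)"
proof -
  have "\<bar>V v w \<nu> x - V v w \<mu> x'\<bar> \<le> Lv * \<bar>(\<integral>y. w (y - x) \<partial>\<nu>) - (\<integral>y. w (y - x') \<partial>\<mu>)\<bar>"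
    using lipschitz_onD[OF v_lip, of "\<integral>y. w (y - x) \<partial>\<nu>" "\<integral>y. w (y - x') \<partial>\<mu>"]
    by (auto simp: V_def dist_real_def intro!: Bochner_Integration.integral_nonneg w_nonneg)
  also have "\<dots> \<le> Lv * (2 * M * K * (d + \<bar>x - x'\<bar>))"
    by (intro mult_left_mono Lv_nonneg kernel_estimate[OF assms(1,2) m bounds w assms(3,4,5)])
  finally show ?thesis by (simp add: algebra_simps)
qed

end

section \<open>Existence by a contraction on flow maps\<close>

text \<open>
  Displacement with Lipschitz constant \<open>1/2\<close>. Such maps are increasing bijections, shrink
  distances at most by the factor \<open>1/2\<close> and therefore at most double densities.
\<close>
definition near_identity :: "(real \<Rightarrow> real) \<Rightarrow> bool" where
  "near_identity Y \<longleftrightarrow> (\<forall>z z'. \<bar>(Y z - z) - (Y z' - z')\<bar> \<le> \<bar>z - z'\<bar> / 2)"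

lemma near_identity_bounds:
  assumes "near_identity Y"
  shows "z \<le> z' \<Longrightarrow> (z' - z) / 2 \<le> Y z' - Y z" "\<bar>Y z - Y z'\<bar> \<le> 3 / 2 * \<bar>z - z'\<bar>"
  using assms[unfolded near_identity_def, rule_format, of z z'] by (auto simp: abs_if split: if_splits)

lemma near_identity_lipschitz:
  assumes "near_identity Y"
  shows "(3/2)-lipschitz_on UNIV Y"
  by (rule lipschitz_onI) (use near_identity_bounds(2)[OF assms] in \<open>auto simp: dist_real_def\<close>)

lemma near_identity_measurable:
  assumes "near_identity Y"
  shows "Y \<in> borel_measurable borel"
  using near_identity_lipschitz[OF assms]
  by (intro borel_measurable_continuous_onI lipschitz_on_continuous_on)

lemma near_identity_le_iff:
  assumes "near_identity Y"
  shows "Y z \<le> Y z' \<longleftrightarrow> z \<le> z'"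
  using near_identity_bounds(1)[OF assms, of z z'] near_identity_bounds(1)[OF assms, of z' z]
  by (cases "z \<le> z'") auto

lemma near_identity_surj:
  assumes "near_identity Y"
  obtains z where "Y z = y"
proof -
  define N where "N = 2 * \<bar>y - Y 0\<bar> + 1"
  have "N > 0" by (simp add: N_def add_nonneg_pos)
  have "Y (- N) \<le> y" "y \<le> Y N"
    using near_identity_bounds(1)[OF assms, of 0 N] near_identity_bounds(1)[OF assms, of "- N" 0]
    by (auto simp: N_def abs_if field_simps split: if_splits)
  moreover have "continuous_on {- N..N} Y"
    using near_identity_lipschitz[OF assms] lipschitz_on_continuous_on continuous_on_subset by blast
  ultimately obtain z where "Y z = y" using IVT'[of Y "- N" y N] \<open>N > 0\<close> by auto
  then show thesis by (rule that)
qed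

context real_distribution
begin

lemma cdf_distr_near_identity:
  assumes "near_identity Y"
  shows "cdf (distr M borel Y) (Y z) = cdf M z"
proof -
  have "Y -` {..Y z} = {..z}" using near_identity_le_iff[OF assms] by auto
  then show ?thesis
    unfolding cdf_def2 using near_identity_measurable[OF assms] by (subst measure_distr) auto
qed

text \<open>
  The distribution function of the image is \<open>cdf M\<close> composed with the inverse of \<open>Y\<close>, which is
  \<open>2\<close>-Lipschitz.
\<close>
lemma cdf_distr_lipschitz:
  assumes Y: "near_identity Y" and lip: "C-lipschitz_on UNIV (cdf M)"
  shows "(2 * C)-lipschitz_on UNIV (cdf (distr M borel Y))"
proof (rule lipschitz_onI)
  have C: "0 \<le> C" using lip by (rule lipschitz_on_nonneg)
  then show "0 \<le> 2 * C" by simp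
  fix x y
  obtain z z' where z: "Y z = x" "Y z' = y" using near_identity_surj[OF Y] by metis
  have "dist (cdf M z) (cdf M z') \<le> C * dist z z'" by (rule lipschitz_onD[OF lip]) auto
  also have "\<dots> \<le> C * (2 * dist x y)"
    using near_identity_bounds(1)[OF Y, of z z'] near_identity_bounds(1)[OF Y, of z' z]
    by (intro mult_left_mono C) (auto simp: dist_real_def z abs_if field_simps split: if_splits)
  finally show "dist (cdf (distr M borel Y) x) (cdf (distr M borel Y) y) \<le> 2 * C * dist x y"
    using cdf_distr_near_identity[OF Y] z by (auto simp: algebra_simps)
qed

lemma cdf_close_distr:
  assumes [measurable]: "X \<in> borel_measurable borel" "Y \<in> borel_measurable borel"
    and d: "\<And>z. \<bar>X z - Y z\<bar> \<le> d"
  shows "cdf_close d (distr M borel X) (distr M borel Y)"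
proof -
  have "X z \<le> x \<Longrightarrow> Y z \<le> x + d" "Y z \<le> x \<Longrightarrow> X z \<le> x + d" for z x
    using d[of z] by (auto simp: abs_if split: if_splits)
  moreover have "X -` {..x} \<in> events" "Y -` {..x} \<in> events" for x
    using measurable_sets[of X borel borel "{..x}"] measurable_sets[of Y borel borel "{..x}"] by auto
  ultimately show ?thesis
    unfolding cdf_close_def cdf_def2 by (auto simp: measure_distr intro!: finite_measure_mono)
qed

end

text \<open>
  The flows among which the solution is sought. Membership is a closed condition, so the fixed
  point theorem applies; the time modulus \<open>B\<close> is inherited from the bound on \<open>v\<close>.
\<close>
definition slow_flow :: "real \<Rightarrow> (real \<Rightarrow> real \<Rightarrow> real) \<Rightarrow> bool" where
  "slow_flow B X \<longleftrightarrow> (\<forall>s s' z. \<bar>X s z - X s' z\<bar> \<le> B * \<bar>s - s'\<bar>) \<and> (\<forall>s. near_identity (X s))"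

lemma slow_flow_time: "slow_flow B X \<Longrightarrow> \<bar>X s z - X s' z\<bar> \<le> B * \<bar>s - s'\<bar>"
  and slow_flow_space: "slow_flow B X \<Longrightarrow> near_identity (X s)"
  by (auto simp: slow_flow_def)

lemma continuous_on_lipschitz_prod:
  fixes f :: "real \<Rightarrow> real \<Rightarrow> real"
  assumes "0 \<le> a" "0 \<le> b" and "\<And>s s' z z'. \<bar>f s z - f s' z'\<bar> \<le> a * \<bar>s - s'\<bar> + b * \<bar>z - z'\<bar>"
  shows "continuous_on UNIV (\<lambda>q. f (fst q) (snd q))"
proof (rule lipschitz_on_continuous_on[where L="a + b"], rule lipschitz_onI)
  fix q q' :: "real \<times> real"
  have "dist (f (fst q) (snd q)) (f (fst q') (snd q')) \<le> a * dist (fst q) (fst q') + b * dist (snd q) (snd q')"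
    using assms(3) by (simp add: dist_real_def)
  also have "\<dots> \<le> a * dist q q' + b * dist q q'"
    by (intro add_mono mult_left_mono assms dist_fst_le dist_snd_le)
  finally show "dist (f (fst q) (snd q)) (f (fst q') (snd q')) \<le> (a + b) * dist q q'"
    by (simp add: algebra_simps)
qed (use assms in auto)

lemma closed_eval_le:
  fixes c :: real
  shows "closed {D :: 'a::topological_space \<Rightarrow>\<^sub>C real. \<bar>D x - D y\<bar> \<le> c}"
proof -
  have e: "continuous_on UNIV (\<lambda>D :: 'a \<Rightarrow>\<^sub>C real. D x)" for x
  proof (rule lipschitz_on_continuous_on[where L=1], rule lipschitz_onI)
    fix D E :: "'a \<Rightarrow>\<^sub>C real"
    show "dist (D x) (E x) \<le> 1 * dist D E" using dist_bounded[of D x E] by simp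
  qed simp
  show "closed {D :: 'a \<Rightarrow>\<^sub>C real. \<bar>D x - D y\<bar> \<le> c}"
    by (intro closed_Collect_le continuous_intros e)
qed

lemma integral_abs_le_Icc:
  fixes f :: "real \<Rightarrow> real"
  assumes "\<And>r. \<bar>f r\<bar> \<le> c" "0 \<le> a" "a \<le> b" "f integrable_on {a..b}"
  shows "\<bar>integral {a..b} f\<bar> \<le> c * (b - a)"
  using integral_bound[of a b f c] has_integral_bound_real[of c "{}" f "integral {a..b} f" a b] assms
  by (metis (no_types, lifting) Diff_empty abs_ge_zero content_real finite.emptyI integrable_integral
      order_trans real_norm_def)

context nonlocal_velocity
begin

text \<open>The velocity seen by the particle that starts at \<open>z\<close> and is carried along by \<open>X\<close>.\<close>
definition flow_velocity :: "real measure \<Rightarrow> (real \<Rightarrow> real \<Rightarrow> real) \<Rightarrow> real \<Rightarrow> real \<Rightarrow> real" where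
  "flow_velocity \<mu> X s z = V v w (distr \<mu> borel (X s)) (X s z)"

context
  fixes \<mu> :: "real measure" and C \<Lambda> T :: real
  assumes \<mu>: "real_distribution \<mu>" and C: "C-lipschitz_on UNIV (cdf \<mu>)"
    and \<Lambda>_def: "\<Lambda> = 4 * Lv * M * C" and T: "0 \<le> T" "\<Lambda> * T \<le> 1 / 4"
begin

interpretation \<mu>: real_distribution \<mu> by (rule \<mu>)

lemma \<Lambda>_nonneg: "0 \<le> \<Lambda>"
  using lipschitz_on_nonneg[OF C] Lv_nonneg M_pos by (auto simp: \<Lambda>_def)

lemma pushforward_distribution: "near_identity Y \<Longrightarrow> real_distribution (distr \<mu> borel Y)"
  using near_identity_measurable by (intro \<mu>.real_distribution_distr) auto

lemma pushforward_V_estimate: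
  assumes "near_identity Y" "near_identity Y'" "\<And>z. \<bar>Y z - Y' z\<bar> \<le> d"
  shows "\<bar>V v w (distr \<mu> borel Y) x - V v w (distr \<mu> borel Y') x'\<bar> \<le> \<Lambda> * (d + \<bar>x - x'\<bar>)"
proof -
  have "0 \<le> d" using assms(3)[of 0] by linarith
  have "cdf_close d (distr \<mu> borel Y') (distr \<mu> borel Y)"
    by (rule \<mu>.cdf_close_distr)
       (use assms near_identity_measurable in \<open>auto simp: abs_minus_commute\<close>)
  then have "\<bar>V v w (distr \<mu> borel Y) x - V v w (distr \<mu> borel Y') x'\<bar> \<le> 2 * Lv * M * (2 * C) * (d + \<bar>x - x'\<bar>)"
    by (intro V_estimate pushforward_distribution \<mu>.cdf_distr_lipschitz assms C \<open>0 \<le> d\<close>)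
  then show ?thesis by (simp add: \<Lambda>_def)
qed

lemma flow_velocity_lipschitz:
  assumes "slow_flow B X"
  shows "\<bar>flow_velocity \<mu> X r z - flow_velocity \<mu> X r' z'\<bar> \<le> 2 * \<Lambda> * B * \<bar>r - r'\<bar> + 3 / 2 * \<Lambda> * \<bar>z - z'\<bar>"
proof -
  have "\<bar>flow_velocity \<mu> X r z - flow_velocity \<mu> X r' z'\<bar> \<le> \<Lambda> * (B * \<bar>r - r'\<bar> + \<bar>X r z - X r' z'\<bar>)"
    unfolding flow_velocity_def
    by (rule pushforward_V_estimate) (use assms in \<open>auto simp: slow_flow_def\<close>)
  also have "\<bar>X r z - X r' z'\<bar> \<le> B * \<bar>r - r'\<bar> + 3 / 2 * \<bar>z - z'\<bar>"
    using slow_flow_time[OF assms, of r z r'] near_identity_bounds(2)[OF slow_flow_space[OF assms], of r' z z']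
    by linarith
  then have "\<Lambda> * (B * \<bar>r - r'\<bar> + \<bar>X r z - X r' z'\<bar>) \<le> \<Lambda> * (B * \<bar>r - r'\<bar> + (B * \<bar>r - r'\<bar> + 3 / 2 * \<bar>z - z'\<bar>))"
    by (intro mult_left_mono \<Lambda>_nonneg) simp
  finally show ?thesis by (simp add: algebra_simps)
qed

text \<open>
  The flow enters twice, through the measure it transports and through the point where the
  velocity is evaluated; each contributes \<open>\<Lambda> d\<close>.
\<close>
lemma flow_velocity_diff_flow:
  assumes "slow_flow B X" "slow_flow B Y" "\<And>z. \<bar>X r z - Y r z\<bar> \<le> d"
  shows "\<bar>flow_velocity \<mu> X r z - flow_velocity \<mu> Y r z\<bar> \<le> 2 * \<Lambda> * d"
proof -
  have "\<bar>flow_velocity \<mu> X r z - flow_velocity \<mu> Y r z\<bar> \<le> \<Lambda> * (d + \<bar>X r z - Y r z\<bar>)"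
    unfolding flow_velocity_def
    by (rule pushforward_V_estimate) (use assms in \<open>auto simp: slow_flow_def\<close>)
  also have "\<dots> \<le> \<Lambda> * (d + d)"
    by (intro mult_left_mono add_left_mono assms \<Lambda>_nonneg)
  finally show ?thesis by (simp add: algebra_simps)
qed

lemma flow_velocity_continuous:
  assumes "slow_flow B X"
  shows "continuous_on UNIV (\<lambda>q. flow_velocity \<mu> X (fst q) (snd q))"
  by (rule continuous_on_lipschitz_prod[where a="2 * \<Lambda> * B" and b="3 / 2 * \<Lambda>"])
     (use flow_velocity_lipschitz[OF assms] \<Lambda>_nonneg B_nonneg in auto)

lemma flow_velocity_continuous_time:
  assumes "slow_flow B X"
  shows "continuous_on S (\<lambda>r. flow_velocity \<mu> X r z)"
proof -
  have "continuous_on S ((\<lambda>q. flow_velocity \<mu> X (fst q) (snd q)) \<circ> (\<lambda>r. (r, z)))"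
    by (intro continuous_on_compose continuous_intros continuous_on_subset[OF flow_velocity_continuous[OF assms]]) auto
  then show ?thesis by (simp add: comp_def)
qed

text \<open>
  Freezing time outside \<open>[0, T]\<close> defines flows for all times, so that their displacements live
  in the Banach space of bounded continuous functions on the plane.
\<close>
definition clock :: "real \<Rightarrow> real" where "clock s = max 0 (min T s)"

lemma clock: "0 \<le> clock s" "clock s \<le> T" "\<bar>clock s - clock s'\<bar> \<le> \<bar>s - s'\<bar>"
  using T by (auto simp: clock_def)

lemma \<Lambda>_clock: "\<Lambda> * clock s \<le> 1 / 4"
proof -
  have "\<Lambda> * clock s \<le> \<Lambda> * T" by (intro mult_left_mono clock \<Lambda>_nonneg)
  then show ?thesis using T by simp
qed

lemma flow_velocity_integrable:
  assumes "slow_flow B X"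
  shows "(\<lambda>r. flow_velocity \<mu> X r z) integrable_on {a..b}"
  by (intro integrable_continuous_real flow_velocity_continuous_time assms)

definition picard :: "(real \<Rightarrow> real \<Rightarrow> real) \<Rightarrow> real \<Rightarrow> real \<Rightarrow> real" where
  "picard X s z = z + integral {0..clock s} (\<lambda>r. flow_velocity \<mu> X r z)"

text \<open>
  The velocity along \<open>X\<close> is \<open>3/2 \<Lambda>\<close>-Lipschitz in the starting point, so integrating it up to
  \<open>T\<close> gives a displacement with Lipschitz constant at most \<open>3/8\<close>.
\<close>
lemma picard_slow_flow:
  assumes X: "slow_flow B X"
  shows "slow_flow B (picard X)"
  unfolding slow_flow_def
proof (intro conjI allI)
  let ?u = "flow_velocity \<mu> X"
  have bound: "\<bar>?u r z\<bar> \<le> B" for r z unfolding flow_velocity_def by (rule V_bound)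
  have mono_case: "\<bar>picard X s z - picard X s' z\<bar> \<le> B * \<bar>clock s - clock s'\<bar>" if "clock s \<le> clock s'" for s s' z
  proof -
    have "integral {0..clock s} (\<lambda>r. ?u r z) + integral {clock s..clock s'} (\<lambda>r. ?u r z)
        = integral {0..clock s'} (\<lambda>r. ?u r z)"
      by (rule Henstock_Kurzweil_Integration.integral_combine)
         (use that clock flow_velocity_integrable[OF X] in auto)
    moreover have "\<bar>integral {clock s..clock s'} (\<lambda>r. ?u r z)\<bar> \<le> B * (clock s' - clock s)"
      by (rule integral_abs_le_Icc) (use bound that clock flow_velocity_integrable[OF X] in auto)
    ultimately show ?thesis using that by (simp add: picard_def)
  qed
  show "\<bar>picard X s z - picard X s' z\<bar> \<le> B * \<bar>s - s'\<bar>" for s s' z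
  proof -
    have "\<bar>picard X s z - picard X s' z\<bar> \<le> B * \<bar>clock s - clock s'\<bar>"
      using mono_case[of s s' z] mono_case[of s' s z] by (cases "clock s \<le> clock s'") (auto simp: abs_minus_commute)
    also have "\<dots> \<le> B * \<bar>s - s'\<bar>" by (intro mult_left_mono clock B_nonneg)
    finally show ?thesis .
  qed
  show "near_identity (picard X s)" for s
    unfolding near_identity_def
  proof (intro allI)
    fix z z'
    have "\<bar>integral {0..clock s} (\<lambda>r. ?u r z - ?u r z')\<bar> \<le> (3 / 2 * \<Lambda> * \<bar>z - z'\<bar>) * (clock s - 0)"
      by (rule integral_abs_le_Icc)
         (use flow_velocity_lipschitz[OF X, of r z r z' for r] clock in \<open>auto intro!: integrable_diff flow_velocity_integrable X\<close>)
    also have "\<dots> = 3 / 2 * \<bar>z - z'\<bar> * (\<Lambda> * clock s)" by simp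
    also have "\<dots> \<le> 3 / 2 * \<bar>z - z'\<bar> * (1 / 4)"
      by (intro mult_left_mono \<Lambda>_clock) auto
    finally have "\<bar>integral {0..clock s} (\<lambda>r. ?u r z - ?u r z')\<bar> \<le> 3 / 2 * \<bar>z - z'\<bar> * (1 / 4)" .
    moreover have "picard X s z - z - (picard X s z' - z') = integral {0..clock s} (\<lambda>r. ?u r z - ?u r z')"
      using flow_velocity_integrable[OF X] by (simp add: picard_def Henstock_Kurzweil_Integration.integral_diff)
    ultimately show "\<bar>picard X s z - z - (picard X s z' - z')\<bar> \<le> \<bar>z - z'\<bar> / 2"
      using abs_ge_zero[of "z - z'"] by linarith
  qed
qed

lemma picard_contracts:
  assumes X: "slow_flow B X" and Y: "slow_flow B Y" and d: "\<And>r z. \<bar>X r z - Y r z\<bar> \<le> d"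
  shows "\<bar>picard X s z - picard Y s z\<bar> \<le> d / 2"
proof -
  have "\<bar>integral {0..clock s} (\<lambda>r. flow_velocity \<mu> X r z - flow_velocity \<mu> Y r z)\<bar> \<le> (2 * \<Lambda> * d) * (clock s - 0)"
    by (rule integral_abs_le_Icc)
       (use flow_velocity_diff_flow[OF X Y d] clock in \<open>auto intro!: integrable_diff flow_velocity_integrable X Y\<close>)
  also have "\<dots> = 2 * d * (\<Lambda> * clock s)" by simp
  also have "\<dots> \<le> 2 * d * (1 / 4)"
  proof (intro mult_left_mono)
    show "\<Lambda> * clock s \<le> 1 / 4" by (rule \<Lambda>_clock)
    show "0 \<le> 2 * d" using d[of 0 0] by linarith
  qed
  finally show ?thesis
    using flow_velocity_integrable[OF X] flow_velocity_integrable[OF Y]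
    by (simp add: picard_def flip: Henstock_Kurzweil_Integration.integral_diff)
qed

text \<open>
  Banach's theorem is applied to the displacements \<open>X s z - z\<close>, which, unlike the flows, are
  bounded functions of \<open>(s, z)\<close>.
\<close>
lemma flow_exists:
  obtains X where "slow_flow B X" "\<And>z. X 0 z = z"
    "\<And>s z. s \<in> {0..T} \<Longrightarrow>
      ((\<lambda>r. X r z) has_real_derivative V v w (distr \<mu> borel (X s)) (X s z)) (at s within {0..T})"
proof -
  define flow where "flow D s z = z + apply_bcontfun D (s, z)" for D :: "(real \<times> real) \<Rightarrow>\<^sub>C real" and s z
  define G where "G D = Bcontfun (\<lambda>q. picard (flow D) (fst q) (snd q) - snd q)" for D
  define S where "S = {D. slow_flow B (flow D)}"
  have G: "apply_bcontfun (G D) (s, z) = picard (flow D) s z - z" if "D \<in> S" for D s z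
  proof -
    have P: "slow_flow B (picard (flow D))" using that picard_slow_flow by (simp add: S_def)
    have "continuous_on UNIV (\<lambda>q. picard (flow D) (fst q) (snd q) - snd q)"
    proof (rule continuous_on_lipschitz_prod[where a=B and b="1/2"])
      fix s s' z z'
      show "\<bar>picard (flow D) s z - z - (picard (flow D) s' z' - z')\<bar> \<le> B * \<bar>s - s'\<bar> + 1 / 2 * \<bar>z - z'\<bar>"
        using slow_flow_time[OF P, of s z s'] slow_flow_space[OF P, of s', unfolded near_identity_def, rule_format, of z z']
        by linarith
    qed (use B_nonneg in auto)
    moreover have "\<bar>picard (flow D) s z - z\<bar> \<le> B * T" for s z
    proof -
      have "\<bar>integral {0..clock s} (\<lambda>r. flow_velocity \<mu> (flow D) r z)\<bar> \<le> B * (clock s - 0)"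
        by (rule integral_abs_le_Icc)
           (use that clock V_bound in \<open>auto simp: S_def flow_velocity_def intro: flow_velocity_integrable[unfolded flow_velocity_def]\<close>)
      also have "\<dots> \<le> B * T" using clock by (intro mult_left_mono B_nonneg) auto
      finally show ?thesis by (simp add: picard_def)
    qed
    ultimately have "(\<lambda>q. picard (flow D) (fst q) (snd q) - snd q) \<in> bcontfun"
      by (intro bcontfun_normI) auto
    then show ?thesis by (simp add: G_def Bcontfun_inverse)
  qed
  have flow_G: "flow (G D) = picard (flow D)" if "D \<in> S" for D
    by (intro ext) (simp add: flow_def[of "G D"] G[OF that])
  have "\<exists>!D\<in>S. G D = D"
  proof (rule Banach_fix[where c="1/2"])
    have "S = (\<Inter>s s' z. {D. \<bar>apply_bcontfun D (s, z) - apply_bcontfun D (s', z)\<bar> \<le> B * \<bar>s - s'\<bar>})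
        \<inter> (\<Inter>s z z'. {D. \<bar>apply_bcontfun D (s, z) - apply_bcontfun D (s, z')\<bar> \<le> \<bar>z - z'\<bar> / 2})"
      by (auto simp: S_def slow_flow_def near_identity_def flow_def)
    moreover have "closed \<dots>" by (intro closed_Int closed_INT ballI closed_eval_le)
    ultimately have "closed S" by simp
    then show "Topological_Spaces.complete S" by (simp add: complete_eq_closed)
    have "(0 :: (real \<times> real) \<Rightarrow>\<^sub>C real) \<in> S"
      using B_nonneg by (simp add: S_def slow_flow_def near_identity_def flow_def)
    then show "S \<noteq> {}" by blast
    show "G ` S \<subseteq> S"
      using flow_G picard_slow_flow by (auto simp: S_def)
    fix D E assume DE: "D \<in> S" "E \<in> S"
    show "dist (G D) (G E) \<le> 1 / 2 * dist D E"
    proof (rule dist_bound)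
      fix q :: "real \<times> real"
      obtain s z where q: "q = (s, z)" by (cases q)
      have "\<bar>picard (flow D) s z - picard (flow E) s z\<bar> \<le> dist D E / 2"
      proof (rule picard_contracts)
        show "\<bar>flow D r z - flow E r z\<bar> \<le> dist D E" for r z
          using dist_bounded[of D "(r, z)" E] by (simp add: flow_def dist_real_def)
      qed (use DE in \<open>auto simp: S_def\<close>)
      then show "dist (apply_bcontfun (G D) q) (apply_bcontfun (G E) q) \<le> 1 / 2 * dist D E"
        by (simp add: q G DE dist_real_def)
    qed
  qed auto
  then obtain D where D: "D \<in> S" "G D = D" by blast
  define X where "X = flow D"
  have X: "slow_flow B X" using D by (simp add: S_def X_def)
  have fix_X: "X s z = z + integral {0..clock s} (\<lambda>r. flow_velocity \<mu> X r z)" for s z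
    using flow_G[OF D(1)] D(2) by (simp add: X_def picard_def fun_eq_iff)
  show thesis
  proof
    show "slow_flow B X" by (rule X)
    show "X 0 z = z" for z using fix_X[of 0 z] T by (simp add: clock_def)
    fix s z assume s: "s \<in> {0..T}"
    have "((\<lambda>r. z + integral {0..r} (\<lambda>r. flow_velocity \<mu> X r z)) has_real_derivative 0 + flow_velocity \<mu> X s z) (at s within {0..T})"
      by (intro DERIV_add DERIV_const integral_has_real_derivative flow_velocity_continuous_time X s)
    then have "((\<lambda>r. z + integral {0..r} (\<lambda>r. flow_velocity \<mu> X r z)) has_real_derivative flow_velocity \<mu> X s z) (at s within {0..T})"
      by simp
    then have "((\<lambda>r. X r z) has_real_derivative flow_velocity \<mu> X s z) (at s within {0..T})"
      by (rule has_field_derivative_transform_within[OF _ zero_less_one s]) (use fix_X in \<open>auto simp: clock_def\<close>)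
    then show "((\<lambda>r. X r z) has_real_derivative V v w (distr \<mu> borel (X s)) (X s z)) (at s within {0..T})"
      by (simp add: flow_velocity_def)
  qed
qed

text \<open>
  After a change of variables the weak formulation integrates \<open>d/ds \<phi> (s, X s z)\<close> over \<open>s\<close> and
  \<open>z\<close>. Integrating in \<open>s\<close> first gives boundary values of \<open>\<phi>\<close>, which vanish.
\<close>
lemma pushforward_weak_solution:
  assumes X: "slow_flow B X" and X0: "\<And>z. X 0 z = z" and t: "0 < t" "t \<le> T"
    and deriv: "\<And>s z. s \<in> {0..T} \<Longrightarrow>
      ((\<lambda>r. X r z) has_real_derivative V v w (distr \<mu> borel (X s)) (X s z)) (at s within {0..T})"
    and R: "AE z in \<mu>. \<bar>z\<bar> \<le> R"
  shows "weak_solution v w \<mu> t (\<lambda>s. distr \<mu> borel (X s))"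
  unfolding weak_solution_def
proof (intro conjI ballI)
  note \<mu>.events_eq_borel[measurable_cong]
  have "X 0 = (\<lambda>z. z)" using X0 by auto
  then show "distr \<mu> borel (X 0) = \<mu>"
    by (simp add: distr_id2 \<mu>.events_eq_borel)
  fix \<phi> :: "real \<times> real \<Rightarrow> real" assume \<phi>: "\<phi> \<in> Cc_inf ({0<..<t} \<times> UNIV)"
  obtain \<phi>' where \<phi>': "\<And>q. (\<phi> has_derivative \<phi>' q) (at q)" "\<And>h. continuous_on UNIV (\<lambda>q. \<phi>' q h)"
    using Cc_inf_has_derivative[OF \<phi>] by blast
  define g where "g s x = \<phi>' (s, x) (1, 0) + V v w (distr \<mu> borel (X s)) x * \<phi>' (s, x) (0, 1)" for s x
  have g_eq: "deriv (\<lambda>r. \<phi> (r, x)) s + V v w (distr \<mu> borel (X s)) x * deriv (\<lambda>y. \<phi> (s, y)) x = g s x" for s x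
    unfolding g_def deriv_partial[OF \<phi>'(1)] ..
  define h where "h q = g (fst q) (X (fst q) (snd q))" for q
  have X_cont: "continuous_on UNIV (\<lambda>q. X (fst q) (snd q))"
  proof (rule continuous_on_lipschitz_prod[where a=B and b="3/2"])
    fix s s' z z'
    show "\<bar>X s z - X s' z'\<bar> \<le> B * \<bar>s - s'\<bar> + 3 / 2 * \<bar>z - z'\<bar>"
      using slow_flow_time[OF X, of s z s'] near_identity_bounds(2)[OF slow_flow_space[OF X], of s' z z'] by linarith
  qed (use B_nonneg in auto)
  have h_cont: "continuous_on UNIV h"
  proof -
    have "continuous_on UNIV (\<lambda>q. \<phi>' (fst q, X (fst q) (snd q)) k)" for k
      by (rule continuous_on_compose2[OF \<phi>'(2)]) (auto intro!: continuous_intros X_cont)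
    then show ?thesis
      unfolding h_def g_def using flow_velocity_continuous[OF X]
      by (auto intro!: continuous_intros simp: flow_velocity_def)
  qed
  have g_meas: "g s \<in> borel_measurable borel" for s
  proof (rule borel_measurable_continuous_onI)
    have "continuous_on UNIV (\<lambda>x. \<phi>' (s, x) k)" for k
      by (rule continuous_on_compose2[OF \<phi>'(2)]) (auto intro!: continuous_intros)
    moreover have "\<Lambda>-lipschitz_on UNIV (V v w (distr \<mu> borel (X s)))"
      by (rule lipschitz_onI)
         (use pushforward_V_estimate[OF slow_flow_space[OF X] slow_flow_space[OF X], of s s 0] \<Lambda>_nonneg in
           \<open>auto simp: dist_real_def\<close>)
    ultimately show "continuous_on UNIV (g s)"
      unfolding g_def by (intro continuous_intros) (auto intro: lipschitz_on_continuous_on)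
  qed
  obtain c where c: "\<And>q. q \<in> {0..t} \<times> {- R..R} \<Longrightarrow> \<bar>h q\<bar> \<le> c" "0 \<le> c"
  proof -
    have "compact (h ` ({0..t} \<times> {- R..R}))"
      by (intro compact_continuous_image continuous_on_subset[OF h_cont] compact_Times) auto
    then have "bounded (h ` ({0..t} \<times> {- R..R}))" by (rule compact_imp_bounded)
    then obtain b where "0 < b" "\<forall>q\<in>{0..t} \<times> {- R..R}. \<bar>h q\<bar> \<le> b"
      unfolding bounded_pos by auto
    then show thesis by (intro that[of b]) auto
  qed
  \<comment> \<open>Restricting \<open>z\<close> to an interval that carries \<open>\<mu>\<close> makes the integrand bounded, as Fubini requires.\<close>
  define k where "k q = indicator {0..t} (fst q) * (indicator {- R..R} (snd q) * h q)" for q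
  have h_meas: "h \<in> borel_measurable borel" using h_cont by (rule borel_measurable_continuous_onI)
  interpret P: pair_sigma_finite lborel \<mu> ..
  have k_int: "integrable (lborel \<Otimes>\<^sub>M \<mu>) k"
  proof (rule Bochner_Integration.integrable_bound)
    have "emeasure (lborel \<Otimes>\<^sub>M \<mu>) ({0..t} \<times> UNIV) = ennreal t"
      using \<mu>.emeasure_space_1 t by (subst \<mu>.emeasure_pair_measure_Times) auto
    then show "integrable (lborel \<Otimes>\<^sub>M \<mu>) (\<lambda>q. c * indicator ({0..t} \<times> UNIV) q)"
      by (intro integrable_mult_right integrable_real_indicator) auto
    show "k \<in> borel_measurable (lborel \<Otimes>\<^sub>M \<mu>)"
      unfolding k_def using h_meas[folded borel_prod] by measurable
    show "AE q in lborel \<Otimes>\<^sub>M \<mu>. norm (k q) \<le> norm (c * indicator ({0..t} \<times> UNIV) q)"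
      by (intro AE_I2) (use c in \<open>auto simp: k_def indicator_def mem_Times_iff\<close>)
  qed
  have inner: "(\<integral>s. k (s, z) \<partial>lborel) = 0" for z
  proof -
    have "(\<integral>s. indicator {0..t} s *\<^sub>R h (s, z) \<partial>lborel) = \<phi> (t, X t z) - \<phi> (0, X 0 z)"
    proof (rule integral_FTC_Icc)
      show "0 \<le> t" using t by simp
      show "continuous_on {0..t} (\<lambda>s. h (s, z))"
        by (rule continuous_on_compose2[OF h_cont]) (auto intro!: continuous_intros)
      fix s assume s: "0 \<le> s" "s \<le> t"
      have "((\<lambda>r. X r z) has_vector_derivative V v w (distr \<mu> borel (X s)) (X s z)) (at s within {0..t})"
        by (rule has_vector_derivative_within_subset[of _ _ _ "{0..T}"])
           (use deriv[of s z] s t in \<open>auto simp: has_real_derivative_iff_has_vector_derivative\<close>)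
      then have "((\<lambda>r. (r, X r z)) has_vector_derivative (1, V v w (distr \<mu> borel (X s)) (X s z))) (at s within {0..t})"
        by (intro has_vector_derivative_Pair has_vector_derivative_id)
      then have "(\<phi> \<circ> (\<lambda>r. (r, X r z)) has_vector_derivative
          \<phi>' (s, X s z) (1, V v w (distr \<mu> borel (X s)) (X s z))) (at s within {0..t})"
        by (rule vector_derivative_diff_chain_within) (rule has_derivative_at_withinI[OF \<phi>'(1)])
      then show "((\<lambda>r. \<phi> (r, X r z)) has_vector_derivative h (s, z)) (at s within {0..t})"
        using derivative_split[OF \<phi>'(1), of "(s, X s z)" "V v w (distr \<mu> borel (X s)) (X s z)"]
        unfolding comp_def h_def g_def fst_conv snd_conv by metis
    qed
    also have "\<dots> = 0" using Cc_inf_zero[OF \<phi>, of "(t, X t z)"] Cc_inf_zero[OF \<phi>, of "(0, X 0 z)"] by auto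
    finally have 0: "(\<integral>s. indicator {0..t} s * h (s, z) \<partial>lborel) = 0" by simp
    have "(\<integral>s. k (s, z) \<partial>lborel) = (\<integral>s. indicator {- R..R} z * (indicator {0..t} s * h (s, z)) \<partial>lborel)"
      by (simp add: k_def mult_ac)
    also have "\<dots> = 0" using 0 by simp
    finally show ?thesis .
  qed
  have "(LINT s:{0..t}|lborel. (\<integral>x. deriv (\<lambda>r. \<phi> (r, x)) s + V v w (distr \<mu> borel (X s)) x * deriv (\<lambda>y. \<phi> (s, y)) x \<partial>distr \<mu> borel (X s)))
      = (LINT s:{0..t}|lborel. (\<integral>z. h (s, z) \<partial>\<mu>))"
    unfolding g_eq
    by (subst integral_distr)
       (use near_identity_measurable[OF slow_flow_space[OF X]] g_meas in \<open>auto simp: h_def\<close>)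
  also have "\<dots> = (\<integral>s. (\<integral>z. k (s, z) \<partial>\<mu>) \<partial>lborel)"
    unfolding set_lebesgue_integral_def
  proof (intro Bochner_Integration.integral_cong refl)
    fix s
    have hs: "(\<lambda>z. h (s, z)) \<in> borel_measurable borel"
      by (rule borel_measurable_continuous_onI, rule continuous_on_compose2[OF h_cont]) (auto intro!: continuous_intros)
    have "(\<integral>z. h (s, z) \<partial>\<mu>) = (\<integral>z. indicator {- R..R} z * h (s, z) \<partial>\<mu>)"
    proof (rule integral_cong_AE)
      show "AE z in \<mu>. h (s, z) = indicator {- R..R} z * h (s, z)"
        using R by eventually_elim (auto simp: indicator_def)
    qed (use hs in auto)
    then show "indicator {0..t} s *\<^sub>R (\<integral>z. h (s, z) \<partial>\<mu>) = (\<integral>z. k (s, z) \<partial>\<mu>)"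
      by (simp add: k_def)
  qed
  also have "\<dots> = (\<integral>z. (\<integral>s. k (s, z) \<partial>lborel) \<partial>\<mu>)"
    using P.Fubini_integral[of "\<lambda>s z. k (s, z)"] k_int by (simp add: split_beta)
  finally show "(LINT s:{0..t}|lborel. (\<integral>x. deriv (\<lambda>r. \<phi> (r, x)) s + V v w (distr \<mu> borel (X s)) x * deriv (\<lambda>y. \<phi> (s, y)) x \<partial>distr \<mu> borel (X s))) = 0"
    by (simp add: inner)
qed

lemma pushforward_C0_weak_solution:
  assumes X: "slow_flow B X" and X0: "\<And>z. X 0 z = z" and t: "0 < t" "t \<le> T"
    and deriv: "\<And>s z. s \<in> {0..T} \<Longrightarrow>
      ((\<lambda>r. X r z) has_real_derivative V v w (distr \<mu> borel (X s)) (X s z)) (at s within {0..T})"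
    and R: "AE z in \<mu>. \<bar>z\<bar> \<le> R"
  shows "C0_weak_solution v w \<mu> t (\<lambda>s. distr \<mu> borel (X s))"
  unfolding C0_weak_solution_def
proof (intro conjI ballI)
  note meas = near_identity_measurable[OF slow_flow_space[OF X]]
  show "weak_solution v w \<mu> t (\<lambda>s. distr \<mu> borel (X s))"
    by (rule pushforward_weak_solution[OF X X0 t deriv R])
  show "distr \<mu> borel (X s) \<in> Linf_Pac_c" for s
  proof (rule Linf_Pac_c_I)
    show "real_distribution (distr \<mu> borel (X s))"
      by (intro pushforward_distribution slow_flow_space[OF X])
    show "(2 * C)-lipschitz_on UNIV (cdf (distr \<mu> borel (X s)))"
      by (intro \<mu>.cdf_distr_lipschitz slow_flow_space[OF X] C)
    have "\<bar>X s z\<bar> \<le> R + B * \<bar>s\<bar>" if "\<bar>z\<bar> \<le> R" for z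
      using slow_flow_time[OF X, of s z 0] that X0[of z] by simp
    then have "AE z in \<mu>. \<bar>X s z\<bar> \<le> R + B * \<bar>s\<bar>"
      using R by (auto elim: eventually_mono)
    then show "AE x in distr \<mu> borel (X s). \<bar>x\<bar> \<le> R + B * \<bar>s\<bar>"
      using meas by (subst AE_distr_iff) auto
  qed
  show "W_inf_continuous_on {0..t} (\<lambda>s. distr \<mu> borel (X s))"
    unfolding W_inf_continuous_on_def
  proof
    fix s
    have "((\<lambda>r. B * \<bar>r - s\<bar>) \<longlongrightarrow> B * \<bar>s - s\<bar>) (at s within {0..t})"
      by (intro tendsto_intros)
    then have lim: "((\<lambda>r. ennreal (B * \<bar>r - s\<bar>)) \<longlongrightarrow> 0) (at s within {0..t})"
      using tendsto_ennrealI by fastforce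
    show "((\<lambda>r. W_inf (distr \<mu> borel (X r)) (distr \<mu> borel (X s))) \<longlongrightarrow> 0) (at s within {0..t})"
      by (rule tendsto_sandwich[OF _ _ tendsto_const lim])
         (auto intro!: always_eventually W_inf_distr_le[OF \<mu>] meas slow_flow_time[OF X])
  qed
qed

end

end

section \<open>Curves of measures that are continuous in W-infinity\<close>

lemma (in real_distribution) integrable_continuous_bounded:
  fixes f :: "real \<Rightarrow> real"
  assumes R: "AE x in M. \<bar>x\<bar> \<le> R" and f: "continuous_on UNIV f"
  shows "integrable M f"
proof -
  have "bounded (f ` {- R..R})"
    by (intro compact_imp_bounded compact_continuous_image continuous_on_subset[OF f]) auto
  then obtain b where b: "\<forall>y \<in> f ` {- R..R}. norm y \<le> b"
    unfolding bounded_iff ..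
  show ?thesis
  proof (rule integrable_const_bound[of _ b])
    show "AE x in M. norm (f x) \<le> b"
      using R
    proof eventually_elim
      case (elim x)
      then have "x \<in> {- R..R}" unfolding atLeastAtMost_iff by linarith
      then show ?case using b by blast
    qed
    show "f \<in> borel_measurable M" using borel_measurable_continuous_onI[OF f] by simp
  qed
qed

text \<open>
  By the mean value theorem the difference quotient of the integrand deviates from its limit by
  the oscillation of \<open>deriv \<psi>\<close> on a compact set that contains all the relevant arguments.
\<close>
lemma (in real_distribution) shift_integral_derivative:
  assumes \<psi>: "\<psi> \<in> flat_algebra" and R: "AE x in M. \<bar>x\<bar> \<le> R"
  shows "((\<lambda>c. \<integral>x. \<psi> (x - c) \<partial>M) has_real_derivative - (\<integral>x. deriv \<psi> (x - c) \<partial>M)) (at c)"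
  unfolding DERIV_def
proof (rule LIM_I)
  fix e :: real assume "0 < e"
  define I where "I = {- (\<bar>R\<bar> + \<bar>c\<bar> + 1)..\<bar>R\<bar> + \<bar>c\<bar> + 1}"
  note d\<psi> = flat_algebra_deriv[OF \<psi>]
  have c\<psi>: "continuous_on S \<psi>" for S
    by (rule DERIV_continuous_on[OF has_field_derivative_at_within[OF d\<psi>(1)]])
  have cd\<psi>: "continuous_on S (deriv \<psi>)" for S
    using d\<psi>(2) by (rule continuous_on_subset) simp
  have int: "integrable M (\<lambda>x. f (x - c'))" if "\<And>S. continuous_on S f" for f :: "real \<Rightarrow> real" and c'
    by (rule integrable_continuous_bounded[OF R]) (auto intro!: continuous_on_compose2[OF that[of UNIV]] continuous_intros)
  have "uniformly_continuous_on I (deriv \<psi>)"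
    by (rule compact_uniformly_continuous[OF cd\<psi>]) (simp add: I_def)
  then obtain d where d: "0 < d" "\<And>u u'. u \<in> I \<Longrightarrow> u' \<in> I \<Longrightarrow> \<bar>u' - u\<bar> < d \<Longrightarrow> \<bar>deriv \<psi> u' - deriv \<psi> u\<bar> < e / 2"
    unfolding uniformly_continuous_on_def dist_real_def using \<open>0 < e\<close> by (metis half_gt_zero)
  show "\<exists>s>0. \<forall>h. h \<noteq> 0 \<and> norm (h - 0) < s \<longrightarrow>
    norm (((\<integral>x. \<psi> (x - (c + h)) \<partial>M) - (\<integral>x. \<psi> (x - c) \<partial>M)) / h - - (\<integral>x. deriv \<psi> (x - c) \<partial>M)) < e"
  proof (intro exI[of _ "min d 1"] conjI allI impI)
    fix h :: real assume "h \<noteq> 0 \<and> norm (h - 0) < min d 1"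
    then have h: "h \<noteq> 0" "\<bar>h\<bar> < d" "\<bar>h\<bar> < 1" by auto
    have pw: "\<bar>(\<psi> (x - (c + h)) - \<psi> (x - c)) / h + deriv \<psi> (x - c)\<bar> \<le> e / 2" if "\<bar>x\<bar> \<le> R" for x
    proof -
      obtain u where u: "min (x - c) (x - (c + h)) \<le> u" "u \<le> max (x - c) (x - (c + h))"
        "\<psi> (x - (c + h)) - \<psi> (x - c) = - h * deriv \<psi> u"
      proof (cases "h < 0")
        case True
        then obtain u where "x - c < u" "u < x - (c + h)" "\<psi> (x - (c + h)) - \<psi> (x - c) = (x - (c + h) - (x - c)) * deriv \<psi> u"
          using MVT2[of "x - c" "x - (c + h)" \<psi> "deriv \<psi>"] d\<psi>(1) by auto
        then show ?thesis by (intro that[of u]) auto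
      next
        case False
        then obtain u where u: "x - (c + h) < u" "u < x - c" "\<psi> (x - c) - \<psi> (x - (c + h)) = (x - c - (x - (c + h))) * deriv \<psi> u"
          using MVT2[of "x - (c + h)" "x - c" \<psi> "deriv \<psi>"] d\<psi>(1) h by auto
        have "\<psi> (x - (c + h)) - \<psi> (x - c) = - h * deriv \<psi> u" using u(3) by simp
        then show ?thesis using u by (intro that[of u]) auto
      qed
      have "\<bar>u - (x - c)\<bar> \<le> \<bar>h\<bar>" using u(1,2) by (auto simp: min_def max_def abs_if split: if_splits)
      moreover have "u \<in> I" "x - c \<in> I"
        using that h \<open>\<bar>u - (x - c)\<bar> \<le> \<bar>h\<bar>\<close> by (auto simp: I_def abs_if split: if_splits)
      ultimately have "\<bar>deriv \<psi> u - deriv \<psi> (x - c)\<bar> < e / 2" using d h by auto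
      moreover have "(\<psi> (x - (c + h)) - \<psi> (x - c)) / h = - deriv \<psi> u" using u(3) h by simp
      ultimately show ?thesis by linarith
    qed
    define Q where "Q x = (\<psi> (x - (c + h)) - \<psi> (x - c)) / h + deriv \<psi> (x - c)" for x
    have ints: "integrable M (\<lambda>x. \<psi> (x - (c + h)))" "integrable M (\<lambda>x. \<psi> (x - c))" "integrable M (\<lambda>x. deriv \<psi> (x - c))"
      using int[of \<psi>] int[of "deriv \<psi>"] c\<psi> cd\<psi> by auto
    have "((\<integral>x. \<psi> (x - (c + h)) \<partial>M) - (\<integral>x. \<psi> (x - c) \<partial>M)) / h - - (\<integral>x. deriv \<psi> (x - c) \<partial>M)
      = (\<integral>x. (\<psi> (x - (c + h)) - \<psi> (x - c)) / h + deriv \<psi> (x - c) \<partial>M)"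
      using ints by simp
    also have "norm \<dots> \<le> (\<integral>x. norm (Q x) \<partial>M)"
      unfolding Q_def by (rule integral_norm_bound)
    also have "\<dots> \<le> (\<integral>x. e / 2 \<partial>M)"
    proof (rule integral_mono_AE)
      show "AE x in M. norm (Q x) \<le> e / 2"
        using R
      proof eventually_elim
        case (elim x)
        then show ?case unfolding Q_def real_norm_def by (rule pw)
      qed
      show "integrable M (\<lambda>x. norm (Q x))"
        unfolding Q_def by (intro integrable_norm Bochner_Integration.integrable_add integrable_divide
            Bochner_Integration.integrable_diff ints)
    qed simp
    also have "\<dots> < e" using \<open>0 < e\<close> prob_space by simp
    finally show "norm (((\<integral>x. \<psi> (x - (c + h)) \<partial>M) - (\<integral>x. \<psi> (x - c) \<partial>M)) / h - - (\<integral>x. deriv \<psi> (x - c) \<partial>M)) < e" .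
  qed (use d in auto)
qed

context
  fixes \<sigma> :: "real \<Rightarrow> real measure" and t :: real
  assumes \<sigma>: "\<And>s. s \<in> {0..t} \<Longrightarrow> \<sigma> s \<in> Linf_Pac_c" and cont: "W_inf_continuous_on {0..t} \<sigma>"
begin

lemma curve_distribution: "s \<in> {0..t} \<Longrightarrow> real_distribution (\<sigma> s)"
  using \<sigma> Linf_Pac_c_D by blast

lemma curve_W_inf_small:
  assumes s: "s \<in> {0..t}" and "0 < e"
  shows "\<exists>d>0. \<forall>r\<in>{0..t}. \<bar>r - s\<bar> < d \<longrightarrow> W_inf (\<sigma> r) (\<sigma> s) < ennreal e"
proof -
  have "((\<lambda>r. W_inf (\<sigma> r) (\<sigma> s)) \<longlongrightarrow> 0) (at s within {0..t})"
    using cont s unfolding W_inf_continuous_on_def by blast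
  then have "\<forall>\<^sub>F r in at s within {0..t}. W_inf (\<sigma> r) (\<sigma> s) < ennreal e"
    by (rule order_tendstoD) (use \<open>0 < e\<close> in simp)
  then obtain d where d: "d > 0" "\<And>r. r \<in> {0..t} \<Longrightarrow> r \<noteq> s \<Longrightarrow> \<bar>r - s\<bar> < d \<Longrightarrow> W_inf (\<sigma> r) (\<sigma> s) < ennreal e"
    unfolding eventually_at dist_real_def by blast
  moreover have "W_inf (\<sigma> s) (\<sigma> s) < ennreal e"
    using W_inf_self[OF curve_distribution[OF s]] \<open>0 < e\<close> by simp
  ultimately show ?thesis by metis
qed

text \<open>
  Measures at \<open>W_inf\<close> distance less than \<open>1\<close> have supports within distance \<open>1\<close>; finitely many
  such neighbourhoods cover the compact time interval.
\<close>
lemma curve_uniform_support: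
  obtains R where "0 < R" "\<And>s. s \<in> {0..t} \<Longrightarrow> AE x in \<sigma> s. \<bar>x\<bar> \<le> R"
proof -
  have "\<exists>d R. 0 < d \<and> 0 < R \<and> (\<forall>r\<in>{0..t}. \<bar>r - s\<bar> < d \<longrightarrow> (AE x in \<sigma> r. \<bar>x\<bar> \<le> R))" if s: "s \<in> {0..t}" for s
  proof -
    obtain R where R: "R > 0" "AE x in \<sigma> s. \<bar>x\<bar> \<le> R" using Linf_Pac_c_D(3)[OF \<sigma>[OF s]] by blast
    obtain d where d: "d > 0" "\<And>r. r \<in> {0..t} \<Longrightarrow> \<bar>r - s\<bar> < d \<Longrightarrow> W_inf (\<sigma> r) (\<sigma> s) < ennreal 1"
      using curve_W_inf_small[OF s zero_less_one] by blast
    have "AE x in \<sigma> r. \<bar>x\<bar> \<le> R + 1" if "r \<in> {0..t}" "\<bar>r - s\<bar> < d" for r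
      by (rule W_inf_less_AE_bound[OF curve_distribution d(2) R(2)]) (use that in auto)
    then show ?thesis using R d by (intro exI[of _ d] exI[of _ "R + 1"]) auto
  qed
  then obtain d R where dR: "\<And>s. s \<in> {0..t} \<Longrightarrow> 0 < d s" "\<And>s. s \<in> {0..t} \<Longrightarrow> 0 < R s"
    "\<And>s r. s \<in> {0..t} \<Longrightarrow> r \<in> {0..t} \<Longrightarrow> \<bar>r - s\<bar> < d s \<Longrightarrow> AE x in \<sigma> r. \<bar>x\<bar> \<le> R s"
    by metis
  obtain C where C: "C \<subseteq> {0..t}" "finite C" "{0..t} \<subseteq> (\<Union>s\<in>C. ball s (d s))"
  proof (rule compactE_image[of "{0..t}" "{0..t}" "\<lambda>s. ball s (d s)"])
    show "{0..t} \<subseteq> (\<Union>s\<in>{0..t}. ball s (d s))" using dR(1) by force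
  qed auto
  define S where "S = (\<Sum>s\<in>C. R s) + 1"
  have le: "R s \<le> S" if "s \<in> C" for s
    using member_le_sum[OF that, of R] C dR(2) unfolding S_def by (force intro: less_imp_le)
  show thesis
  proof
    have "0 \<le> (\<Sum>s\<in>C. R s)" using C dR(2) by (intro sum_nonneg) (force intro: less_imp_le)
    then show "0 < S" by (simp add: S_def)
    fix r assume r: "r \<in> {0..t}"
    then obtain s where s: "s \<in> C" "\<bar>r - s\<bar> < d s"
      using C(3) by (force simp: dist_real_def)
    have "AE x in \<sigma> r. \<bar>x\<bar> \<le> R s" using dR(3)[of s r] s r C(1) by blast
    then show "AE x in \<sigma> r. \<bar>x\<bar> \<le> S" by eventually_elim (use le[OF s(1)] in linarith)
  qed
qed

text \<open>
  Couplings move points only slightly, so uniform continuity of the integrand on the common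
  support is enough. The parameter \<open>q\<close> may contain more than the time, for instance the position
  of a window.
\<close>
lemma curve_integral_continuous:
  fixes g :: "'p::metric_space \<Rightarrow> real \<Rightarrow> real"
  assumes R: "\<And>s. s \<in> {0..t} \<Longrightarrow> AE x in \<sigma> s. \<bar>x\<bar> \<le> R"
    and P: "compact P" and \<tau>: "continuous_on P \<tau>" "\<tau> ` P \<subseteq> {0..t}"
    and g: "continuous_on (P \<times> UNIV) (\<lambda>q. g (fst q) (snd q))"
  shows "continuous_on P (\<lambda>q. \<integral>x. g q x \<partial>\<sigma> (\<tau> q))"
  unfolding continuous_on_iff
proof (intro ballI allI impI)
  fix q0 and e :: real assume q0: "q0 \<in> P" and "0 < e"
  have "uniformly_continuous_on (P \<times> {- R..R}) (\<lambda>q. g (fst q) (snd q))"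
    by (intro compact_uniformly_continuous continuous_on_subset[OF g] compact_Times P) auto
  then obtain d where d: "0 < d" "\<And>q q' x x'. q \<in> P \<Longrightarrow> q' \<in> P \<Longrightarrow> x \<in> {- R..R} \<Longrightarrow> x' \<in> {- R..R} \<Longrightarrow>
      dist (q', x') (q, x) < d \<Longrightarrow> \<bar>g q' x' - g q x\<bar> < e / 2"
    unfolding uniformly_continuous_on_def dist_real_def using \<open>0 < e\<close>
    by (metis (no_types, lifting) fst_conv snd_conv half_gt_zero mem_Sigma_iff)
  have \<tau>0: "\<tau> q0 \<in> {0..t}" using q0 \<tau>(2) by auto
  obtain d1 where d1: "d1 > 0" "\<And>r. r \<in> {0..t} \<Longrightarrow> \<bar>r - \<tau> q0\<bar> < d1 \<Longrightarrow> W_inf (\<sigma> r) (\<sigma> (\<tau> q0)) < ennreal (d / 2)"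
    using curve_W_inf_small[OF \<tau>0 half_gt_zero[OF d(1)]] by blast
  obtain d2 where d2: "d2 > 0" "\<And>q. q \<in> P \<Longrightarrow> dist q q0 < d2 \<Longrightarrow> \<bar>\<tau> q - \<tau> q0\<bar> < d1"
    using \<tau>(1)[unfolded continuous_on_iff dist_real_def, rule_format, OF q0 d1(1)] by blast
  have int: "integrable (\<sigma> (\<tau> q)) (g q)" if "q \<in> P" for q
  proof -
    have t: "\<tau> q \<in> {0..t}" using \<tau>(2) that by auto
    have "continuous_on UNIV (g q)"
      using continuous_on_compose2[OF g continuous_on_Pair[OF continuous_on_const continuous_on_id], of q UNIV] that by (auto intro!: continuous_on_Pair continuous_on_const continuous_on_id)
    then show ?thesis
      by (intro real_distribution.integrable_continuous_bounded[OF curve_distribution[OF t] R[OF t]])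
  qed
  show "\<exists>d>0. \<forall>q\<in>P. dist q q0 < d \<longrightarrow> dist (\<integral>x. g q x \<partial>\<sigma> (\<tau> q)) (\<integral>x. g q0 x \<partial>\<sigma> (\<tau> q0)) < e"
  proof (intro exI[of _ "min d2 (d / 2)"] conjI ballI impI)
    fix q assume q: "q \<in> P" "dist q q0 < min d2 (d / 2)"
    have t: "\<tau> q \<in> {0..t}" "\<tau> q0 \<in> {0..t}" using \<tau>(2) q q0 by auto
    have "\<bar>(\<integral>x. g q x \<partial>\<sigma> (\<tau> q)) - (\<integral>x. g q0 x \<partial>\<sigma> (\<tau> q0))\<bar> \<le> e / 2"
    proof (rule W_inf_less_integral[where d="d/2" and R=R])
      show "W_inf (\<sigma> (\<tau> q)) (\<sigma> (\<tau> q0)) < ennreal (d / 2)"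
        by (rule d1(2)[OF t(1) d2(2)]) (use q in auto)
      fix x y :: real assume xy: "\<bar>x\<bar> \<le> R" "\<bar>y\<bar> \<le> R" "\<bar>x - y\<bar> \<le> d / 2"
      have "dist (q, x) (q0, y) \<le> dist q q0 + \<bar>x - y\<bar>"
        using sqrt_sum_squares_le_sum_abs[of "dist q q0" "x - y"] by (simp add: dist_Pair_Pair dist_real_def)
      also have "\<dots> < d" using q xy by simp
      finally show "\<bar>g q x - g q0 y\<bar> \<le> e / 2"
        using d(2)[of q0 q y x] q q0 xy by (simp add: abs_le_iff less_imp_le)
    qed (use curve_distribution R int t q q0 in auto)
    then show "dist (\<integral>x. g q x \<partial>\<sigma> (\<tau> q)) (\<integral>x. g q0 x \<partial>\<sigma> (\<tau> q0)) < e"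
      using \<open>0 < e\<close> by (simp add: dist_real_def)
  qed (use d d2 in auto)
qed

end

section \<open>Solutions tested with fixed profiles\<close>

text \<open>The derivative of the step is a nonnegative weight of total mass one on \<open>[a, a + d]\<close>.\<close>
lemma rising_average:
  fixes K :: "real \<Rightarrow> real"
  assumes K: "continuous_on {0..t} K" and a: "0 < a" "a + d < t" "0 < d"
    and e: "\<And>s. s \<in> {a..a + d} \<Longrightarrow> \<bar>K s - K a\<bar> \<le> e"
  shows "\<bar>integral {0..t} (\<lambda>s. deriv (rising d a) s * K s) - K a\<bar> \<le> e"
proof -
  let ?r = "deriv (rising d a)"
  have cont: "continuous_on S ?r" for S
    using flat_algebra_deriv(2)[OF rising_algebra] by (rule continuous_on_subset) simp
  have "(?r has_integral rising d a t - rising d a 0) {0..t}"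
    by (rule fundamental_theorem_of_calculus)
       (use a flat_algebra_deriv(1)[OF rising_algebra] in
         \<open>auto simp: has_real_derivative_iff_has_vector_derivative[symmetric] intro: has_field_derivative_at_within\<close>)
  moreover have "rising d a t = 1" "rising d a 0 = 0"
    using a by (auto simp: rising_falling falling_eq_0 falling_eq_1)
  ultimately have one: "(?r has_integral 1) {0..t}" by simp
  have "norm (integral {0..t} (\<lambda>s. ?r s * (K s - K a))) \<le> integral {0..t} (\<lambda>s. ?r s * e)"
  proof (rule integral_norm_bound_integral)
    show "(\<lambda>s. ?r s * (K s - K a)) integrable_on {0..t}" "(\<lambda>s. ?r s * e) integrable_on {0..t}"
      by (intro integrable_continuous_real continuous_intros cont K)+
    fix s
    have "?r s = 0" if "s \<notin> {a..a + d}"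
      using that deriv_falling_eq_0[of d "s - a"] a by (auto simp: deriv_rising)
    moreover have "0 \<le> ?r s" using deriv_falling_nonpos a by (simp add: deriv_rising)
    ultimately show "norm (?r s * (K s - K a)) \<le> ?r s * e"
      using e[of s] by (cases "s \<in> {a..a + d}") (auto simp: abs_mult mult_left_mono)
  qed
  also have "integral {0..t} (\<lambda>s. ?r s * e) = e"
    by (rule integral_unique) (use has_integral_mult_left[OF one, of e] in simp)
  also have "integral {0..t} (\<lambda>s. ?r s * (K s - K a)) = integral {0..t} (\<lambda>s. ?r s * K s) - integral {0..t} (\<lambda>s. ?r s * K a)"
    unfolding right_diff_distrib
    by (rule Henstock_Kurzweil_Integration.integral_diff)
       (intro integrable_continuous_real continuous_intros cont K)+
  also have "integral {0..t} (\<lambda>s. ?r s * K a) = K a"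
    by (rule integral_unique) (use has_integral_mult_left[OF one, of "K a"] in simp)
  finally show ?thesis by simp
qed

text \<open>
  The difference of two smooth steps at \<open>a\<close> and \<open>b\<close> is a test function whose derivative
  approximates the difference of the point masses at \<open>a\<close> and \<open>b\<close>.
\<close>
lemma du_Bois_Reymond:
  fixes K :: "real \<Rightarrow> real"
  assumes K: "continuous_on {0..t} K" and "0 < t"
    and test: "\<And>\<eta> a b. \<eta> \<in> flat_algebra \<Longrightarrow> 0 < a \<Longrightarrow> b < t \<Longrightarrow> (\<And>s. s \<notin> {a..b} \<Longrightarrow> \<eta> s = 0) \<Longrightarrow>
      integral {0..t} (\<lambda>s. deriv \<eta> s * K s) = 0"
    and s: "s \<in> {0..t}"
  shows "K s = K 0"
proof -
  have eq: "K a = K b" if ab: "0 < a" "a < b" "b < t" for a b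
  proof (rule ccontr)
    assume "K a \<noteq> K b"
    define e where "e = \<bar>K a - K b\<bar> / 3"
    have e: "0 < e" using \<open>K a \<noteq> K b\<close> by (simp add: e_def)
    obtain d1 where d1: "d1 > 0" "\<And>x. x \<in> {0..t} \<Longrightarrow> \<bar>x - a\<bar> < d1 \<Longrightarrow> \<bar>K x - K a\<bar> < e"
      using K[unfolded continuous_on_iff dist_real_def, rule_format, of a e] e ab by auto
    obtain d2 where d2: "d2 > 0" "\<And>x. x \<in> {0..t} \<Longrightarrow> \<bar>x - b\<bar> < d2 \<Longrightarrow> \<bar>K x - K b\<bar> < e"
      using K[unfolded continuous_on_iff dist_real_def, rule_format, of b e] e ab by auto
    define d where "d = min (min d1 d2) (t - b) / 2"
    have d: "0 < d" "d < d1" "d < d2" "b + d < t" using d1(1) d2(1) ab by (auto simp: d_def min_def field_simps)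
    define \<eta> where "\<eta> s = rising d a s - rising d b s" for s
    have \<eta>: "\<eta> \<in> flat_algebra" unfolding \<eta>_def[abs_def] by (intro flat_algebra_diff rising_algebra)
    have deriv_\<eta>: "deriv \<eta> s = deriv (rising d a) s - deriv (rising d b) s" for s
      unfolding \<eta>_def[abs_def]
      by (intro DERIV_imp_deriv DERIV_diff flat_algebra_deriv rising_algebra)
    have "integral {0..t} (\<lambda>s. deriv \<eta> s * K s) = 0"
    proof (rule test[OF \<eta>, of a "b + d"])
      fix s assume "s \<notin> {a..b + d}"
      then show "\<eta> s = 0"
        using d ab falling_eq_1[of d "s - a"] falling_eq_1[of d "s - b"]
          falling_eq_0[of d "s - a"] falling_eq_0[of d "s - b"]
        by (auto simp: \<eta>_def rising_falling not_le)
    qed (use ab d in auto)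
    moreover have "integral {0..t} (\<lambda>s. deriv \<eta> s * K s)
        = integral {0..t} (\<lambda>s. deriv (rising d a) s * K s) - integral {0..t} (\<lambda>s. deriv (rising d b) s * K s)"
      unfolding deriv_\<eta> left_diff_distrib
      by (intro Henstock_Kurzweil_Integration.integral_diff integrable_continuous_real continuous_intros K
          continuous_on_subset[OF flat_algebra_deriv(2)] rising_algebra) auto
    moreover have "\<bar>integral {0..t} (\<lambda>s. deriv (rising d a) s * K s) - K a\<bar> \<le> e"
      by (rule rising_average[OF K]) (use ab d d1(2) in \<open>auto intro!: less_imp_le\<close>)
    moreover have "\<bar>integral {0..t} (\<lambda>s. deriv (rising d b) s * K s) - K b\<bar> \<le> e"
      by (rule rising_average[OF K]) (use ab d d2(2) in \<open>auto intro!: less_imp_le\<close>)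
    ultimately have "\<bar>K a - K b\<bar> \<le> 2 * e" by linarith
    then show False using e by (simp add: e_def)
  qed
  have cl: "closure {0<..<t} = {0..t}" using \<open>0 < t\<close> by simp
  have "K s = K (t / 2)" if "s \<in> {0..t}" for s
  proof (rule continuous_constant_on_closure[of "{0<..<t}" K])
    fix x assume x: "x \<in> {0<..<t}"
    consider "x < t / 2" | "x = t / 2" | "t / 2 < x" by linarith
    then show "K x = K (t / 2)"
    proof cases
      case 1
      then show ?thesis using x by (intro eq) auto
    next
      case 2
      then show ?thesis by (simp only:)
    next
      case 3
      then show ?thesis using x by (intro eq[symmetric]) auto
    qed
  qed (use K cl that in \<open>simp_all\<close>)
  from this[OF s] this[of 0] show ?thesis using \<open>0 < t\<close> by simp
qed

context nonlocal_velocity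
begin

context
  fixes \<sigma> :: "real \<Rightarrow> real measure" and t :: real and \<mu> :: "real measure"
  assumes sol: "C0_weak_solution v w \<mu> t \<sigma>" and t: "0 < t"
begin

lemma sol_Linf: "s \<in> {0..t} \<Longrightarrow> \<sigma> s \<in> Linf_Pac_c"
  and sol_cont: "W_inf_continuous_on {0..t} \<sigma>"
  and sol_initial: "\<sigma> 0 = \<mu>"
  using sol by (auto simp: C0_weak_solution_def weak_solution_def)

lemma sol_distribution: "s \<in> {0..t} \<Longrightarrow> real_distribution (\<sigma> s)"
  by (rule Linf_Pac_c_D(1)[OF sol_Linf])

text \<open>
  The density bound at the time \<open>s\<close> where continuity is tested is all that enters, since the
  estimate uses the bound for one of the two measures. No uniformity in time is available here.
\<close>
lemma V_continuous: "continuous_on ({0..t} \<times> UNIV) (\<lambda>q. V v w (\<sigma> (fst q)) (snd q))"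
  unfolding continuous_on_iff
proof (intro ballI allI impI)
  fix q and e :: real assume q: "q \<in> {0..t} \<times> (UNIV :: real set)" and "0 < e"
  obtain s x where sx: "q = (s, x)" by (cases q)
  with q have s: "s \<in> {0..t}" by simp
  obtain C where C: "C-lipschitz_on UNIV (cdf (\<sigma> s))" using Linf_Pac_c_D(2)[OF sol_Linf[OF s]] by blast
  define c where "c = 2 * Lv * M * C"
  have c: "0 \<le> c" using lipschitz_on_nonneg[OF C] Lv_nonneg M_pos by (simp add: c_def)
  define h where "h = e / (c + 1) / 2"
  have h: "0 < h" using c \<open>0 < e\<close> by (simp add: h_def)
  have "h + h = e / (c + 1)" unfolding h_def by (rule field_sum_of_halves)
  then have "(c + 1) * (h + h) = e" using c by simp
  moreover have "c * (h + h) < (c + 1) * (h + h)" using h by (intro mult_strict_right_mono) auto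
  ultimately have ch: "c * (h + h) < e" by simp
  obtain d where d: "d > 0" "\<And>r. r \<in> {0..t} \<Longrightarrow> \<bar>r - s\<bar> < d \<Longrightarrow> W_inf (\<sigma> r) (\<sigma> s) < ennreal h"
    using curve_W_inf_small[OF sol_Linf sol_cont s h] by blast
  show "\<exists>d>0. \<forall>q'\<in>{0..t} \<times> UNIV. dist q' q < d \<longrightarrow>
      dist (V v w (\<sigma> (fst q')) (snd q')) (V v w (\<sigma> (fst q)) (snd q)) < e"
  proof (intro exI[of _ "min d h"] conjI ballI impI)
    fix q' assume q': "q' \<in> {0..t} \<times> (UNIV :: real set)" "dist q' q < min d h"
    obtain r y where ry: "q' = (r, y)" by (cases q')
    with q' have r: "r \<in> {0..t}" by simp
    have rs: "\<bar>r - s\<bar> < d" "\<bar>y - x\<bar> < h"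
      using q'(2) dist_fst_le[of q' q] dist_snd_le[of q' q] by (auto simp: ry sx dist_real_def)
    have "cdf_close h (\<sigma> s) (\<sigma> r)"
      by (rule cdf_close_sym, rule W_inf_less_cdf_close[OF sol_distribution[OF r] d(2)[OF r rs(1)]])
    then have "\<bar>V v w (\<sigma> r) y - V v w (\<sigma> s) x\<bar> \<le> c * (h + \<bar>y - x\<bar>)"
      unfolding c_def using h C by (intro V_estimate sol_distribution r s) auto
    also have "\<dots> \<le> c * (h + h)" using rs c by (intro mult_left_mono) auto
    also have "\<dots> < e" by (rule ch)
    finally show "dist (V v w (\<sigma> (fst q')) (snd q')) (V v w (\<sigma> (fst q)) (snd q)) < e"
      by (simp add: ry sx dist_real_def)
  qed (use d h in auto)
qed

text \<open>
  Test functions \<open>\<eta> s * \<psi> x\<close>, with \<open>\<psi>\<close> cut off outside the common support, express that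
  \<open>\<integral> \<psi> d\<sigma>(s)\<close> has the asserted continuous function as its distributional derivative. Integrating
  by parts, the lemma of du Bois-Reymond shows that it is a classical derivative.
\<close>
lemma weak_time_derivative:
  assumes \<psi>: "\<psi> \<in> flat_algebra" and s: "s \<in> {0..t}"
  shows "((\<lambda>r. \<integral>x. \<psi> x \<partial>\<sigma> r) has_real_derivative (\<integral>x. V v w (\<sigma> s) x * deriv \<psi> x \<partial>\<sigma> s)) (at s within {0..t})"
proof -
  obtain R where R: "0 < R" "\<And>s. s \<in> {0..t} \<Longrightarrow> AE x in \<sigma> s. \<bar>x\<bar> \<le> R"
    using curve_uniform_support[OF sol_Linf sol_cont] by blast
  define G where "G r = (\<integral>x. \<psi> x \<partial>\<sigma> r)" for r
  define H where "H r = (\<integral>x. V v w (\<sigma> r) x * deriv \<psi> x \<partial>\<sigma> r)" for r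
  note d = flat_algebra_deriv
  have c: "continuous_on S f" if "f \<in> flat_algebra" for f :: "real \<Rightarrow> real" and S
    by (rule DERIV_continuous_on[OF has_field_derivative_at_within[OF d(1)[OF that]]])
  have cd: "continuous_on S (deriv f)" if "f \<in> flat_algebra" for f and S
    using d(2)[OF that] by (rule continuous_on_subset) simp
  have G_cont: "continuous_on {0..t} G"
    unfolding G_def
    by (rule curve_integral_continuous[OF sol_Linf sol_cont R(2)])
       (auto intro!: continuous_intros continuous_on_compose2[OF c[OF \<psi>, of UNIV]])
  have H_cont: "continuous_on {0..t} H"
    unfolding H_def
    by (rule curve_integral_continuous[OF sol_Linf sol_cont R(2)])
       (auto intro!: continuous_intros V_continuous continuous_on_compose2[OF cd[OF \<psi>, of UNIV]])
  \<comment> \<open>Equal to \<open>1\<close> on \<open>[- R - 1, R + 1]\<close>, so near the common support the derivatives of \<open>\<theta>\<close> and \<open>\<psi>\<close> agree, too.\<close>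
  define cut where "cut x = smooth_step (x + (R + 2)) * smooth_step (- x + (R + 2))" for x
  have cut: "cut \<in> flat_algebra"
    using flat_algebra.mult[OF smooth_step_affine[of 1 "R + 2"] smooth_step_affine[of "-1" "R + 2"]]
    by (simp add: cut_def[abs_def])
  have cut_1: "cut x = 1" if "\<bar>x\<bar> \<le> R + 1" for x
    using that by (simp add: cut_def smooth_step_eq_1 abs_le_iff)
  have cut_0: "cut x = 0" if "x \<notin> {- (R + 2)..R + 2}" for x
    using that by (auto simp: cut_def smooth_step_eq_0)
  define \<theta> where "\<theta> x = \<psi> x * cut x" for x
  have \<theta>: "\<theta> \<in> flat_algebra" unfolding \<theta>_def[abs_def] by (intro flat_algebra.mult \<psi> cut)
  have \<theta>_eq: "\<theta> x = \<psi> x" "deriv \<theta> x = deriv \<psi> x" if "\<bar>x\<bar> \<le> R" for x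
  proof -
    show "\<theta> x = \<psi> x" using that cut_1[of x] by (simp add: \<theta>_def)
    have "(\<theta> has_real_derivative deriv \<psi> x) (at x)"
      by (rule has_field_derivative_transform_within_open[OF d(1)[OF \<psi>], of "{- R - 1<..<R + 1}"])
         (use that cut_1 in \<open>auto simp: \<theta>_def abs_le_iff\<close>)
    then show "deriv \<theta> x = deriv \<psi> x" by (rule DERIV_imp_deriv)
  qed
  have test: "integral {0..t} (\<lambda>r. deriv \<eta> r * G r + \<eta> r * H r) = 0"
    if \<eta>: "\<eta> \<in> flat_algebra" and ab: "0 < a" "b < t" "\<And>r. r \<notin> {a..b} \<Longrightarrow> \<eta> r = 0" for \<eta> a b
  proof -
    define \<phi> where "\<phi> q = \<eta> (fst q) * \<theta> (snd q)" for q :: "real \<times> real"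
    have "\<phi> \<in> flat_algebra"
      unfolding \<phi>_def[abs_def]
      by (intro flat_algebra.mult flat_algebra_compose_linear[OF \<eta>] flat_algebra_compose_linear[OF \<theta>]
          bounded_linear_fst bounded_linear_snd)
    moreover have sub: "closure {q. \<phi> q \<noteq> 0} \<subseteq> {a..b} \<times> {- (R + 2)..R + 2}"
    proof (rule closure_minimal)
      show "{q. \<phi> q \<noteq> 0} \<subseteq> {a..b} \<times> {- (R + 2)..R + 2}"
      proof
        fix q assume "q \<in> {q. \<phi> q \<noteq> 0}"
        then have "\<eta> (fst q) \<noteq> 0" "cut (snd q) \<noteq> 0" by (auto simp: \<phi>_def \<theta>_def)
        then show "q \<in> {a..b} \<times> {- (R + 2)..R + 2}" unfolding mem_Times_iff using ab(3) cut_0 by blast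
      qed
    qed (intro closed_Times closed_atLeastAtMost)
    moreover have "compact (closure {q. \<phi> q \<noteq> 0})"
      using bounded_subset[OF bounded_Times[OF bounded_closed_interval bounded_closed_interval] sub]
      by (simp add: compact_eq_bounded_closed)
    ultimately have "\<phi> \<in> Cc_inf ({0<..<t} \<times> UNIV)"
      using ab(1,2) unfolding Cc_inf_def by (auto intro: flat_algebra_C_k)
    then have "(LINT r:{0..t}|lborel.
        (\<integral>x. (deriv (\<lambda>r. \<phi> (r, x)) r + V v w (\<sigma> r) x * deriv (\<lambda>y. \<phi> (r, y)) x) \<partial>(\<sigma> r))) = 0"
      using sol unfolding C0_weak_solution_def weak_solution_def by blast
    also have "(LINT r:{0..t}|lborel.
        (\<integral>x. (deriv (\<lambda>r. \<phi> (r, x)) r + V v w (\<sigma> r) x * deriv (\<lambda>y. \<phi> (r, y)) x) \<partial>(\<sigma> r)))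
      = (LINT r:{0..t}|lborel. deriv \<eta> r * G r + \<eta> r * H r)"
    proof (rule set_lebesgue_integral_cong)
      show "\<forall>r. r \<in> {0..t} \<longrightarrow>
        (\<integral>x. (deriv (\<lambda>r. \<phi> (r, x)) r + V v w (\<sigma> r) x * deriv (\<lambda>y. \<phi> (r, y)) x) \<partial>(\<sigma> r))
        = deriv \<eta> r * G r + \<eta> r * H r"
      proof (intro allI impI)
        fix r assume r: "r \<in> {0..t}"
        interpret S: real_distribution "\<sigma> r" by (rule sol_distribution[OF r])
        have cV: "continuous_on UNIV (V v w (\<sigma> r))"
          using continuous_on_compose2[OF V_continuous continuous_on_Pair[OF continuous_on_const continuous_on_id], of r UNIV] r
          by (auto simp: image_subset_iff)
        have "deriv (\<lambda>r. \<phi> (r, x)) r = deriv \<eta> r * \<theta> x" for x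
          unfolding \<phi>_def fst_conv snd_conv by (intro DERIV_imp_deriv DERIV_cmult_right d \<eta>)
        moreover have "deriv (\<lambda>y. \<phi> (r, y)) x = \<eta> r * deriv \<theta> x" for x
          unfolding \<phi>_def fst_conv snd_conv by (intro DERIV_imp_deriv DERIV_cmult d \<theta>)
        ultimately have "(\<integral>x. (deriv (\<lambda>r. \<phi> (r, x)) r + V v w (\<sigma> r) x * deriv (\<lambda>y. \<phi> (r, y)) x) \<partial>(\<sigma> r))
          = (\<integral>x. (deriv \<eta> r * \<theta> x + V v w (\<sigma> r) x * (\<eta> r * deriv \<theta> x)) \<partial>(\<sigma> r))"
          by (simp only:)
        also have "\<dots> = (\<integral>x. (deriv \<eta> r * \<psi> x + \<eta> r * (V v w (\<sigma> r) x * deriv \<psi> x)) \<partial>(\<sigma> r))"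
        proof (rule integral_cong_AE)
          show "AE x in \<sigma> r. deriv \<eta> r * \<theta> x + V v w (\<sigma> r) x * (\<eta> r * deriv \<theta> x)
              = deriv \<eta> r * \<psi> x + \<eta> r * (V v w (\<sigma> r) x * deriv \<psi> x)"
            using R(2)[OF r] by eventually_elim (simp add: \<theta>_eq)
          have [measurable]: "V v w (\<sigma> r) \<in> borel_measurable borel" "\<theta> \<in> borel_measurable borel"
            "\<psi> \<in> borel_measurable borel" "deriv \<theta> \<in> borel_measurable borel" "deriv \<psi> \<in> borel_measurable borel"
            by (intro borel_measurable_continuous_onI cV c cd \<theta> \<psi>)+
          note S.events_eq_borel[measurable_cong]
          show "(\<lambda>x. deriv \<eta> r * \<theta> x + V v w (\<sigma> r) x * (\<eta> r * deriv \<theta> x)) \<in> borel_measurable (\<sigma> r)"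
            "(\<lambda>x. deriv \<eta> r * \<psi> x + \<eta> r * (V v w (\<sigma> r) x * deriv \<psi> x)) \<in> borel_measurable (\<sigma> r)"
            by measurable
        qed
        also have "\<dots> = deriv \<eta> r * G r + \<eta> r * H r"
        proof -
          have "integrable (\<sigma> r) \<psi>" "integrable (\<sigma> r) (\<lambda>x. V v w (\<sigma> r) x * deriv \<psi> x)"
            by (intro S.integrable_continuous_bounded[OF R(2)[OF r]] c \<psi> continuous_intros cV cd)+
          then show ?thesis by (simp add: G_def H_def)
        qed
        finally show "(\<integral>x. (deriv (\<lambda>r. \<phi> (r, x)) r + V v w (\<sigma> r) x * deriv (\<lambda>y. \<phi> (r, y)) x) \<partial>(\<sigma> r))
          = deriv \<eta> r * G r + \<eta> r * H r" .
      qed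
    qed simp
    also have "\<dots> = integral {0..t} (\<lambda>r. deriv \<eta> r * G r + \<eta> r * H r)"
      by (intro set_borel_integral_eq_integral borel_integrable_atLeastAtMost' continuous_intros cd c \<eta> G_cont H_cont)
    finally show ?thesis .
  qed
  define J where "J r = integral {0..r} H" for r
  have J: "(J has_real_derivative H r) (at r within {0..t})" if "r \<in> {0..t}" for r
    unfolding J_def by (rule integral_has_real_derivative[OF H_cont that])
  have J_cont: "continuous_on {0..t} J" by (rule DERIV_continuous_on[OF J])
  have "G r - J r = G 0 - J 0" if "r \<in> {0..t}" for r
  proof (rule du_Bois_Reymond[where K="\<lambda>r. G r - J r", OF _ t _ that])
    show "continuous_on {0..t} (\<lambda>r. G r - J r)" by (intro continuous_intros G_cont J_cont)
    fix \<eta> a b assume \<eta>: "\<eta> \<in> flat_algebra" and ab: "0 < a" "b < t" "\<And>s. s \<notin> {a..b} \<Longrightarrow> \<eta> s = 0"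
    have "((\<lambda>r. deriv \<eta> r * J r + \<eta> r * H r) has_integral \<eta> t * J t - \<eta> 0 * J 0) {0..t}"
    proof (rule fundamental_theorem_of_calculus)
      fix r assume r: "r \<in> {0..t}"
      have "((\<lambda>r. \<eta> r * J r) has_real_derivative deriv \<eta> r * J r + H r * \<eta> r) (at r within {0..t})"
        by (intro DERIV_mult has_field_derivative_at_within[OF d(1)[OF \<eta>]] J r)
      then show "((\<lambda>r. \<eta> r * J r) has_vector_derivative deriv \<eta> r * J r + \<eta> r * H r) (at r within {0..t})"
        by (simp add: has_real_derivative_iff_has_vector_derivative mult.commute)
    qed (use t in simp)
    moreover have "\<eta> t = 0" "\<eta> 0 = 0" using ab by auto
    ultimately have 1: "((\<lambda>r. deriv \<eta> r * J r + \<eta> r * H r) has_integral 0) {0..t}" by simp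
    have 2: "((\<lambda>r. deriv \<eta> r * G r + \<eta> r * H r) has_integral 0) {0..t}"
    proof -
      have "(\<lambda>r. deriv \<eta> r * G r + \<eta> r * H r) integrable_on {0..t}"
        by (intro integrable_continuous_real continuous_intros cd[OF \<eta>] c[OF \<eta>] G_cont H_cont)
      then have "((\<lambda>r. deriv \<eta> r * G r + \<eta> r * H r) has_integral
          integral {0..t} (\<lambda>r. deriv \<eta> r * G r + \<eta> r * H r)) {0..t}"
        by (rule integrable_integral)
      moreover have "integral {0..t} (\<lambda>r. deriv \<eta> r * G r + \<eta> r * H r) = 0"
        by (rule test[OF \<eta> ab])
      ultimately show ?thesis by metis
    qed
    have "((\<lambda>r. (deriv \<eta> r * G r + \<eta> r * H r) - (deriv \<eta> r * J r + \<eta> r * H r)) has_integral 0 - 0) {0..t}"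
      by (rule has_integral_diff[OF 2 1])
    then show "integral {0..t} (\<lambda>r. deriv \<eta> r * (G r - J r)) = 0"
      by (intro integral_unique) (simp add: algebra_simps)
  qed
  note const = this
  have G_eq: "G 0 - J 0 + J r = G r" if "r \<in> {0..t}" for r using const[OF that] by linarith
  have "((\<lambda>r. G 0 - J 0 + J r) has_real_derivative 0 + H s) (at s within {0..t})"
    by (intro DERIV_add DERIV_const J s)
  then have "((\<lambda>r. G 0 - J 0 + J r) has_real_derivative H s) (at s within {0..t})"
    by (simp only: add_0_left)
  then have "(G has_real_derivative H s) (at s within {0..t})"
    by (rule has_field_derivative_transform_within[OF _ zero_less_one s]) (rule G_eq)
  then show ?thesis unfolding G_def[abs_def] H_def .
qed

section \<open>Barriers and comparison with the constructed solution\<close>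
text \<open>
  The total derivative in \<open>(c, s)\<close> of \<open>\<integral> \<psi> (x - c) d\<sigma>(s)\<close>, evaluated along the curve \<open>c = a s\<close>.
  For curves that are merely differentiable the moving profile is not a smooth test function,
  which is why fixed profiles are differentiated first.
\<close>
lemma moving_window_derivative:
  assumes \<psi>: "\<psi> \<in> flat_algebra" and \<psi>_shift: "\<And>c. (\<lambda>x. \<psi> (x - c)) \<in> flat_algebra"
    and a: "(a has_real_derivative a') (at s within {0..t})" and s: "s \<in> {0..t}"
  shows "((\<lambda>r. \<integral>x. \<psi> (x - a r) \<partial>\<sigma> r) has_real_derivative
      (\<integral>x. deriv \<psi> (x - a s) * (V v w (\<sigma> s) x - a') \<partial>\<sigma> s)) (at s within {0..t})"
proof -
  obtain R where R: "0 < R" "\<And>s. s \<in> {0..t} \<Longrightarrow> AE x in \<sigma> s. \<bar>x\<bar> \<le> R"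
    using curve_uniform_support[OF sol_Linf sol_cont] by blast
  interpret S: real_distribution "\<sigma> s" by (rule sol_distribution[OF s])
  note d\<psi> = flat_algebra_deriv[OF \<psi>]
  define H where "H c r = (\<integral>x. V v w (\<sigma> r) x * deriv \<psi> (x - c) \<partial>\<sigma> r)" for c r
  define g where "g c r = (\<integral>x. \<psi> (x - c) \<partial>\<sigma> r)" for c r
  have deriv_shift: "deriv (\<lambda>x. \<psi> (x - c)) x = deriv \<psi> (x - c)" for c x
    by (rule DERIV_imp_deriv, rule DERIV_chain'[OF _ d\<psi>(1), of "\<lambda>x. x - c" 1, simplified])
       (auto intro!: derivative_eq_intros)
  have time: "((\<lambda>r. g c r) has_derivative blinfun_apply (blinfun_scaleR_left (H c r))) (at r within {0..t})"
    if "r \<in> {0..t}" for c r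
    using weak_time_derivative[OF \<psi>_shift[of c] that]
    by (simp add: g_def H_def deriv_shift has_field_derivative_def mult.commute[of _ "integral\<^sup>L _ _"] blinfun_scaleR_left.rep_eq mult_commute_abs)
  have space: "((\<lambda>c. g c s) has_derivative (*) (- (\<integral>x. deriv \<psi> (x - a s) \<partial>\<sigma> s))) (at (a s) within UNIV)"
    using S.shift_integral_derivative[OF \<psi> R(2)[OF s], of "a s"]
    by (simp add: g_def has_field_derivative_def)
  have H_cont: "continuous_on ({a s - 1..a s + 1} \<times> {0..t}) (\<lambda>q. H (fst q) (snd q))"
    unfolding H_def
  proof (rule curve_integral_continuous[OF sol_Linf sol_cont R(2)])
    show "continuous_on (({a s - 1..a s + 1} \<times> {0..t}) \<times> UNIV)
        (\<lambda>q. V v w (\<sigma> (snd (fst q))) (snd q) * deriv \<psi> (snd q - fst (fst q)))"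
    proof (rule continuous_on_mult)
      show "continuous_on (({a s - 1..a s + 1} \<times> {0..t}) \<times> UNIV) (\<lambda>q. V v w (\<sigma> (snd (fst q))) (snd q))"
        by (rule continuous_on_compose2[OF V_continuous, where f="\<lambda>q. (snd (fst q), snd q)", simplified])
           (auto intro!: continuous_intros)
      show "continuous_on (({a s - 1..a s + 1} \<times> {0..t}) \<times> UNIV) (\<lambda>q. deriv \<psi> (snd q - fst (fst q)))"
        by (rule continuous_on_compose2[OF d\<psi>(2)]) (auto intro!: continuous_intros)
    qed
  qed (auto intro!: continuous_intros compact_Times)
  have H_cont_at: "continuous (at (a s, s) within UNIV \<times> {0..t}) (\<lambda>(c, r). blinfun_scaleR_left (H c r))"
  proof -
    have "((\<lambda>q. H (fst q) (snd q)) \<longlongrightarrow> H (a s) s) (at (a s, s) within {a s - 1..a s + 1} \<times> {0..t})"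
      using H_cont s unfolding continuous_on_def by force
    moreover have "at (a s, s) within {a s - 1..a s + 1} \<times> {0..t} = at (a s, s) within UNIV \<times> {0..t}"
      by (rule at_within_nhd[of _ "{a s - 1<..<a s + 1} \<times> UNIV"]) (auto intro!: open_Times)
    ultimately have "continuous (at (a s, s) within UNIV \<times> {0..t}) (\<lambda>q. H (fst q) (snd q))"
      by (simp add: continuous_within)
    then have "continuous (at (a s, s) within UNIV \<times> {0..t}) (\<lambda>q. blinfun_scaleR_left (H (fst q) (snd q)))"
      by (rule bounded_linear.continuous[OF bounded_linear_blinfun_scaleR_left])
    then show ?thesis unfolding case_prod_unfold .
  qed
  have total: "((\<lambda>(c, r). g c r) has_derivative
      (\<lambda>(tc, tr). - (\<integral>x. deriv \<psi> (x - a s) \<partial>\<sigma> s) * tc + blinfun_apply (blinfun_scaleR_left (H (a s) s)) tr))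
      (at (a s, s) within UNIV \<times> {0..t})"
    by (rule has_derivative_partialsI[OF space time H_cont_at s]) auto
  have curve: "((\<lambda>r. (a r, r)) has_derivative (\<lambda>h. (a' * h, h))) (at s within {0..t})"
    using a by (intro has_derivative_Pair has_derivative_ident) (simp add: has_field_derivative_def)
  have "((\<lambda>r. (\<lambda>(c, r). g c r) (a r, r)) has_derivative
      (\<lambda>h. (\<lambda>(tc, tr). - (\<integral>x. deriv \<psi> (x - a s) \<partial>\<sigma> s) * tc + blinfun_apply (blinfun_scaleR_left (H (a s) s)) tr) (a' * h, h)))
      (at s within {0..t})"
    by (rule has_derivative_in_compose[OF curve], rule has_derivative_subset[OF total]) auto
  then have "((\<lambda>r. g (a r) r) has_derivative (\<lambda>h. (H (a s) s - a' * (\<integral>x. deriv \<psi> (x - a s) \<partial>\<sigma> s)) * h)) (at s within {0..t})"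
    by (simp add: algebra_simps)
  moreover have "H (a s) s - a' * (\<integral>x. deriv \<psi> (x - a s) \<partial>\<sigma> s) = (\<integral>x. deriv \<psi> (x - a s) * (V v w (\<sigma> s) x - a') \<partial>\<sigma> s)"
  proof -
    have cV: "continuous_on UNIV (V v w (\<sigma> s))"
      using continuous_on_compose2[OF V_continuous continuous_on_Pair[OF continuous_on_const continuous_on_id], of s UNIV] s
      by (auto simp: image_subset_iff)
    have c1: "continuous_on UNIV (\<lambda>x. deriv \<psi> (x - a s))"
      by (rule continuous_on_compose2[OF d\<psi>(2)]) (auto intro!: continuous_intros)
    have "integrable (\<sigma> s) (\<lambda>x. deriv \<psi> (x - a s))" "integrable (\<sigma> s) (\<lambda>x. V v w (\<sigma> s) x * deriv \<psi> (x - a s))"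
      by (intro S.integrable_continuous_bounded[OF R(2)[OF s]] continuous_on_mult cV c1)+
    then have "H (a s) s - a' * (\<integral>x. deriv \<psi> (x - a s) \<partial>\<sigma> s)
        = (\<integral>x. V v w (\<sigma> s) x * deriv \<psi> (x - a s) - a' * deriv \<psi> (x - a s) \<partial>\<sigma> s)"
      by (simp add: H_def)
    then show ?thesis by (simp add: algebra_simps)
  qed
  ultimately show ?thesis
    by (simp add: has_field_derivative_def g_def)
qed

text \<open>
  The expectation \<open>K\<close> of the smooth step attached to \<open>a\<close> is the mass to the left of \<open>a\<close> up to the
  width \<open>e\<close> of the window. Its derivative is the integral of the nonpositive slope of the step
  times the velocity relative to \<open>a\<close>, so it has a sign once the relative velocity has one in the
  window.
\<close>
lemma barrier:
  assumes a: "\<And>s. s \<in> {0..t} \<Longrightarrow> (a has_real_derivative a' s) (at s within {0..t})"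
    and e: "0 < e" and s: "s \<in> {0..t}"
  shows "(\<And>r x. r \<in> {0..t} \<Longrightarrow> x \<in> {a r..a r + e} \<Longrightarrow> V v w (\<sigma> r) x \<le> a' r) \<Longrightarrow>
      cdf (\<sigma> 0) (a 0) \<le> cdf (\<sigma> s) (a s + e)"
    and "(\<And>r x. r \<in> {0..t} \<Longrightarrow> x \<in> {a r..a r + e} \<Longrightarrow> a' r \<le> V v w (\<sigma> r) x) \<Longrightarrow>
      cdf (\<sigma> s) (a s) \<le> cdf (\<sigma> 0) (a 0 + e)"
proof -
  define K where "K r = (\<integral>x. falling e (x - a r) \<partial>\<sigma> r)" for r
  have K': "(K has_real_derivative
      (\<integral>x. deriv (falling e) (x - a r) * (V v w (\<sigma> r) x - a' r) \<partial>\<sigma> r)) (at r within {0..t})" if "r \<in> {0..t}" for r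
    unfolding K_def by (rule moving_window_derivative[OF falling_algebra falling_translate_algebra a[OF that] that])
  have K_cont: "continuous_on {0..s} K"
    using continuous_on_subset[OF DERIV_continuous_on[OF K'], of "{0..s}"] s by auto
  have K'_at: "(K has_real_derivative
      (\<integral>x. deriv (falling e) (x - a r) * (V v w (\<sigma> r) x - a' r) \<partial>\<sigma> r)) (at r)" if "0 < r" "r < s" for r
    using K'[of r] at_within_Icc_at[of 0 r t] that s by simp
  have meas: "(\<lambda>x. falling e (x - c)) \<in> borel_measurable borel" for c
    by (rule borel_measurable_continuous_onI)
       (rule DERIV_continuous_on[OF has_field_derivative_at_within[OF flat_algebra_deriv(1)[OF falling_translate_algebra]]])
  have sandwich: "cdf (\<sigma> r) (a r) \<le> K r" "K r \<le> cdf (\<sigma> r) (a r + e)" if "r \<in> {0..t}" for r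
  proof -
    interpret real_distribution "\<sigma> r" by (rule sol_distribution[OF that])
    show "cdf (\<sigma> r) (a r) \<le> K r" unfolding K_def
      by (rule cdf_le_expectation(1)[OF meas]) (use falling_01 falling_eq_1[OF e] in auto)
    show "K r \<le> cdf (\<sigma> r) (a r + e)" unfolding K_def
      by (rule cdf_le_expectation(2)[OF meas]) (use falling_01 falling_eq_0[OF e] in auto)
  qed
  have s0: "0 \<in> {0..t}" "0 \<le> s" using s by auto
  show "cdf (\<sigma> 0) (a 0) \<le> cdf (\<sigma> s) (a s + e)"
    if le: "\<And>r x. r \<in> {0..t} \<Longrightarrow> x \<in> {a r..a r + e} \<Longrightarrow> V v w (\<sigma> r) x \<le> a' r"
  proof -
    have "K 0 \<le> K s"
    proof (rule DERIV_nonneg_imp_increasing_open[OF s0(2) _ K_cont])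
      fix r assume r: "0 < r" "r < s"
      have "0 \<le> deriv (falling e) (x - a r) * (V v w (\<sigma> r) x - a' r)" for x
      proof (cases "x \<in> {a r..a r + e}")
        case True
        then show ?thesis
          using le[of r x] r s deriv_falling_nonpos[OF e, of "x - a r"] by (intro mult_nonpos_nonpos) auto
      next
        case False
        then show ?thesis using deriv_falling_eq_0[OF e, of "x - a r"] by auto
      qed
      then have "0 \<le> (\<integral>x. deriv (falling e) (x - a r) * (V v w (\<sigma> r) x - a' r) \<partial>\<sigma> r)"
        by (rule Bochner_Integration.integral_nonneg)
      then show "\<exists>y. (K has_real_derivative y) (at r) \<and> 0 \<le> y"
        using K'_at[OF r] by blast
    qed
    then show ?thesis using sandwich(1)[OF s0(1)] sandwich(2)[OF s] by linarith
  qed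
  show "cdf (\<sigma> s) (a s) \<le> cdf (\<sigma> 0) (a 0 + e)"
    if le: "\<And>r x. r \<in> {0..t} \<Longrightarrow> x \<in> {a r..a r + e} \<Longrightarrow> a' r \<le> V v w (\<sigma> r) x"
  proof -
    have "K s \<le> K 0"
    proof (rule DERIV_nonpos_imp_decreasing_open[OF s0(2) _ K_cont])
      fix r assume r: "0 < r" "r < s"
      have "0 \<le> - (deriv (falling e) (x - a r) * (V v w (\<sigma> r) x - a' r))" for x
      proof (cases "x \<in> {a r..a r + e}")
        case True
        then have "deriv (falling e) (x - a r) * (V v w (\<sigma> r) x - a' r) \<le> 0"
          using le[of r x] r s deriv_falling_nonpos[OF e, of "x - a r"] by (intro mult_nonpos_nonneg) auto
        then show ?thesis by simp
      next
        case False
        then show ?thesis using deriv_falling_eq_0[OF e, of "x - a r"] by auto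
      qed
      then have "0 \<le> (\<integral>x. - (deriv (falling e) (x - a r) * (V v w (\<sigma> r) x - a' r)) \<partial>\<sigma> r)"
        by (rule Bochner_Integration.integral_nonneg)
      then have "(\<integral>x. deriv (falling e) (x - a r) * (V v w (\<sigma> r) x - a' r) \<partial>\<sigma> r) \<le> 0" by simp
      then show "\<exists>y. (K has_real_derivative y) (at r) \<and> y \<le> 0"
        using K'_at[OF r] by blast
    qed
    then show ?thesis using sandwich(1)[OF s] sandwich(2)[OF s0(1)] by linarith
  qed
qed

context
  fixes C \<Lambda> T :: real and X :: "real \<Rightarrow> real \<Rightarrow> real"
  assumes \<mu>: "real_distribution \<mu>" and C: "C-lipschitz_on UNIV (cdf \<mu>)"
    and \<Lambda>_def: "\<Lambda> = 4 * Lv * M * C" and \<Lambda>t: "\<Lambda> * t \<le> 1 / 4"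
    and X: "slow_flow B X" and X0: "\<And>z. X 0 z = z"
    and X': "\<And>s z. s \<in> {0..t} \<Longrightarrow>
      ((\<lambda>r. X r z) has_real_derivative V v w (distr \<mu> borel (X s)) (X s z)) (at s within {0..t})"
begin

lemma stability_constant_nonneg: "0 \<le> \<Lambda>"
  using lipschitz_on_nonneg[OF C] Lv_nonneg M_pos by (auto simp: \<Lambda>_def)

text \<open>
  Curves \<open>X s z \<plusminus> k s\<close> with \<open>k = 2 (\<eta> + \<Lambda> e)\<close> are barriers for \<open>\<sigma>\<close>: one half of \<open>k\<close>
  pays for the gap \<open>\<eta>\<close> and the window \<open>e\<close>, the other half for the distance \<open>k s\<close> from the
  characteristic, over which the velocity of the constructed solution changes by at most
  \<open>\<Lambda> k s \<le> k / 4\<close>. Along characteristics the distribution function of the constructed solution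
  is constant.
\<close>
lemma velocity_gap_imp_cdf_close:
  assumes gap: "\<And>r x. r \<in> {0..t} \<Longrightarrow> \<bar>V v w (\<sigma> r) x - V v w (distr \<mu> borel (X r)) x\<bar> \<le> \<eta>"
    and e: "0 < e" and s: "s \<in> {0..t}"
  shows "cdf_close (2 * (\<eta> + \<Lambda> * e) * t + e) (distr \<mu> borel (X s)) (\<sigma> s)"
proof -
  interpret \<mu>: real_distribution \<mu> by (rule \<mu>)
  interpret S: real_distribution "\<sigma> s" by (rule sol_distribution[OF s])
  have near: "near_identity (X r)" for r by (rule slow_flow_space[OF X])
  define k where "k = 2 * (\<eta> + \<Lambda> * e)"
  have "0 \<le> \<eta>" using gap[OF s, of 0] by linarith
  then have k: "0 \<le> k" using stability_constant_nonneg e by (simp add: k_def)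
  have ks: "k * r \<le> k * t" "\<Lambda> * (k * r) \<le> k / 2" if "r \<in> {0..t}" for r
  proof -
    show 1: "k * r \<le> k * t" using that k by (intro mult_left_mono) auto
    have "\<Lambda> * (k * r) \<le> \<Lambda> * (k * t)" by (intro mult_left_mono 1 stability_constant_nonneg)
    also have "\<dots> = k * (\<Lambda> * t)" by simp
    also have "\<dots> \<le> k * (1 / 4)" by (intro mult_left_mono \<Lambda>t k)
    finally show "\<Lambda> * (k * r) \<le> k / 2" using k by simp
  qed
  have speed: "\<bar>V v w (\<sigma> r) x - V v w (distr \<mu> borel (X r)) (X r z)\<bar> \<le> k"
    if r: "r \<in> {0..t}" and x: "\<bar>x - X r z\<bar> \<le> k * r + e" for r x z
  proof -
    have "\<bar>V v w (distr \<mu> borel (X r)) x - V v w (distr \<mu> borel (X r)) (X r z)\<bar> \<le> \<Lambda> * (0 + \<bar>x - X r z\<bar>)"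
      by (rule pushforward_V_estimate[OF \<mu> C \<Lambda>_def order.refl _ near near]) auto
    also have "\<dots> \<le> \<Lambda> * (k * r + e)" using x by (intro mult_left_mono stability_constant_nonneg) auto
    also have "\<dots> \<le> k / 2 + \<Lambda> * e" using ks(2)[OF r] by (simp add: distrib_left)
    finally have "\<bar>V v w (distr \<mu> borel (X r)) x - V v w (distr \<mu> borel (X r)) (X r z)\<bar> \<le> k / 2 + \<Lambda> * e" .
    moreover have "k / 2 = \<eta> + \<Lambda> * e" by (simp add: k_def)
    ultimately show ?thesis using gap[OF r, of x] by linarith
  qed
  have cdf_X: "cdf (distr \<mu> borel (X s)) (X s z) = cdf (\<sigma> 0) z" for z
    unfolding sol_initial by (rule \<mu>.cdf_distr_near_identity[OF near])
  have up: "cdf (\<sigma> 0) z \<le> cdf (\<sigma> s) (X s z + k * s + e)" for z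
  proof -
    have "cdf (\<sigma> 0) (X 0 z + k * 0) \<le> cdf (\<sigma> s) (X s z + k * s + e)"
    proof (rule barrier(1)[OF _ e s])
      fix r assume r: "r \<in> {0..t}"
      show "((\<lambda>r. X r z + k * r) has_real_derivative V v w (distr \<mu> borel (X r)) (X r z) + k) (at r within {0..t})"
        using DERIV_add[OF X'[OF r, of z] DERIV_cmult[OF DERIV_ident, of k]] by simp
    next
      fix r x assume r: "r \<in> {0..t}" and x: "x \<in> {X r z + k * r..X r z + k * r + e}"
      have "\<bar>x - X r z\<bar> \<le> k * r + e" using x e mult_nonneg_nonneg[OF k, of r] r by (auto simp: abs_le_iff)
      then show "V v w (\<sigma> r) x \<le> V v w (distr \<mu> borel (X r)) (X r z) + k"
        using speed[OF r, of x z] by linarith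
    qed
    then show ?thesis by (simp add: X0)
  qed
  have down: "cdf (\<sigma> s) (X s z - k * s - e) \<le> cdf (\<sigma> 0) z" for z
  proof -
    have "cdf (\<sigma> s) (X s z - k * s - e) \<le> cdf (\<sigma> 0) (X 0 z - k * 0 - e + e)"
    proof (rule barrier(2)[OF _ e s])
      fix r assume r: "r \<in> {0..t}"
      show "((\<lambda>r. X r z - k * r - e) has_real_derivative V v w (distr \<mu> borel (X r)) (X r z) - k) (at r within {0..t})"
        using DERIV_diff[OF DERIV_diff[OF X'[OF r, of z] DERIV_cmult[OF DERIV_ident, of k]] DERIV_const[of e]] by simp
    next
      fix r x assume r: "r \<in> {0..t}" and x: "x \<in> {X r z - k * r - e..X r z - k * r - e + e}"
      have "\<bar>x - X r z\<bar> \<le> k * r + e" using x e mult_nonneg_nonneg[OF k, of r] r by (auto simp: abs_le_iff)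
      then show "V v w (distr \<mu> borel (X r)) (X r z) - k \<le> V v w (\<sigma> r) x"
        using speed[OF r, of x z] by linarith
    qed
    then show ?thesis by (simp add: X0)
  qed
  show ?thesis
    unfolding cdf_close_def k_def[symmetric]
  proof (intro allI conjI)
    fix x
    obtain z where z: "X s z = x" using near_identity_surj[OF near] by metis
    have "cdf (distr \<mu> borel (X s)) x \<le> cdf (\<sigma> s) (x + k * s + e)"
      using up[of z] cdf_X[of z] by (simp add: z)
    also have "\<dots> \<le> cdf (\<sigma> s) (x + (k * t + e))" by (rule S.cdf_nondecreasing) (use ks[OF s] in simp)
    finally show "cdf (distr \<mu> borel (X s)) x \<le> cdf (\<sigma> s) (x + (k * t + e))" .
    obtain z where z: "X s z = x + (k * t + e)" using near_identity_surj[OF near] by metis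
    have "cdf (\<sigma> s) x \<le> cdf (\<sigma> s) (X s z - k * s - e)" unfolding z by (rule S.cdf_nondecreasing) (use ks[OF s] in simp)
    also have "\<dots> \<le> cdf (distr \<mu> borel (X s)) (x + (k * t + e))"
      using down[of z] cdf_X[of z] by (simp add: z)
    finally show "cdf (\<sigma> s) x \<le> cdf (distr \<mu> borel (X s)) (x + (k * t + e))" .
  qed
qed

text \<open>
  Closeness up to \<open>2 (\<eta> + \<Lambda> e) t + e\<close> gives a gap of at most \<open>\<Lambda>\<close> times that quantity; let \<open>e\<close>
  tend to \<open>0\<close> and use \<open>\<Lambda> t \<le> 1/4\<close>.
\<close>
lemma velocity_gap_halves:
  assumes gap: "\<And>r x. r \<in> {0..t} \<Longrightarrow> \<bar>V v w (\<sigma> r) x - V v w (distr \<mu> borel (X r)) x\<bar> \<le> \<eta>"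
    and s: "s \<in> {0..t}"
  shows "\<bar>V v w (\<sigma> s) x - V v w (distr \<mu> borel (X s)) x\<bar> \<le> \<eta> / 2"
proof (rule field_le_epsilon)
  interpret \<mu>: real_distribution \<mu> by (rule \<mu>)
  fix h :: real assume h: "0 < h"
  define c where "c = \<Lambda> * (2 * \<Lambda> * t + 1)"
  have c: "0 \<le> c" using stability_constant_nonneg t by (simp add: c_def)
  define e where "e = h / (c + 1)"
  have e: "0 < e" using c h by (simp add: e_def)
  have "(c + 1) * e = h" using c by (simp add: e_def)
  then have ce: "c * e \<le> h" using e by (simp add: algebra_simps)
  have \<eta>: "0 \<le> \<eta>" using gap[OF s, of 0] by linarith
  let ?d = "2 * (\<eta> + \<Lambda> * e) * t + e"
  have d: "0 \<le> ?d" using \<eta> stability_constant_nonneg e t by simp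
  have "\<bar>V v w (\<sigma> s) x - V v w (distr \<mu> borel (X s)) x\<bar> \<le> 2 * Lv * M * (2 * C) * (?d + \<bar>x - x\<bar>)"
  proof (rule V_estimate[OF _ _ d])
    show "cdf_close ?d (distr \<mu> borel (X s)) (\<sigma> s)" by (rule velocity_gap_imp_cdf_close[OF gap e s])
    show "real_distribution (distr \<mu> borel (X s))"
      by (rule pushforward_distribution[OF \<mu> C \<Lambda>_def order.refl _ slow_flow_space[OF X]]) simp
    show "(2 * C)-lipschitz_on UNIV (cdf (distr \<mu> borel (X s)))"
      by (intro \<mu>.cdf_distr_lipschitz slow_flow_space[OF X] C)
  qed (rule sol_distribution[OF s])
  also have "\<dots> = 2 * \<eta> * (\<Lambda> * t) + c * e" by (simp add: \<Lambda>_def c_def algebra_simps)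
  also have "\<dots> \<le> 2 * \<eta> * (1 / 4) + h" using \<eta> \<Lambda>t by (intro add_mono mult_left_mono ce) auto
  finally show "\<bar>V v w (\<sigma> s) x - V v w (distr \<mu> borel (X s)) x\<bar> \<le> \<eta> / 2 + h" by simp
qed

text \<open>
  Iterating the halving makes the velocity gap vanish. Then the two curves are \<open>cdf_close d\<close>
  for every \<open>d > 0\<close>.
\<close>
lemma solution_eq_pushforward:
  assumes s: "s \<in> {0..t}"
  shows "\<sigma> s = distr \<mu> borel (X s)"
proof -
  \<comment> \<open>The bound on \<open>v\<close> starts the iteration.\<close>
  have gap: "\<forall>r\<in>{0..t}. \<forall>x. \<bar>V v w (\<sigma> r) x - V v w (distr \<mu> borel (X r)) x\<bar> \<le> 2 * B / 2 ^ k" for k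
  proof (induction k)
    case 0
    have "\<bar>V v w (\<sigma> r) x - V v w (distr \<mu> borel (X r)) x\<bar> \<le> 2 * B" for r x
      using V_bound[of "\<sigma> r" x] V_bound[of "distr \<mu> borel (X r)" x] by linarith
    then show ?case by simp
  next
    case (Suc k)
    then show ?case using velocity_gap_halves[of "2 * B / 2 ^ k"] by (simp add: field_simps)
  qed
  have "(\<lambda>k. 2 * B / 2 ^ k) \<longlonglongrightarrow> 0"
    using tendsto_mult_right_zero[OF LIMSEQ_inverse_realpow_zero[of 2], of "2 * B"] by (simp add: divide_inverse)
  then have zero: "\<bar>V v w (\<sigma> r) x - V v w (distr \<mu> borel (X r)) x\<bar> \<le> 0" if "r \<in> {0..t}" for r x
    by (rule tendsto_lowerbound) (use gap that in auto)
  have dist: "real_distribution (distr \<mu> borel (X s))"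
    by (rule pushforward_distribution[OF \<mu> C \<Lambda>_def order.refl _ slow_flow_space[OF X]]) simp
  have "cdf_close d (distr \<mu> borel (X s)) (\<sigma> s)" if d: "0 < d" for d
  proof -
    define c where "c = 2 * \<Lambda> * t + 1"
    have c: "0 < c" using stability_constant_nonneg t by (simp add: c_def add_nonneg_pos)
    define e where "e = d / c"
    have e: "0 < e" "c * e = d" using c d by (auto simp: e_def)
    have "2 * (0 + \<Lambda> * e) * t + e = d"
      unfolding e(2)[symmetric] by (simp add: c_def algebra_simps)
    then show ?thesis
      using velocity_gap_imp_cdf_close[OF zero e(1) s] by metis
  qed
  then show ?thesis
    by (rule cdf_close_all_imp_eq[OF _ dist sol_distribution[OF s], symmetric])
qed

end

end

end

theorem proposition18:
  fixes v w :: "real \<Rightarrow> real" and \<alpha> \<beta> :: real and \<rho>\<^sub>0 :: "real measure"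
  assumes v_lipschitz: "\<exists>L. L-lipschitz_on {0..} v"
    and v_bounded: "bounded (v ` {0..})"
    and "\<alpha> < \<beta>"
    and w_bv: "bounded_variation_on \<alpha> \<beta> w"
    and w_nonneg: "\<And>x. x \<in> {\<alpha>..\<beta>} \<Longrightarrow> 0 \<le> w x"
    and w_zero: "\<And>x. x \<notin> {\<alpha>..\<beta>} \<Longrightarrow> w x = 0"
    and w_integral: "(LINT x:{\<alpha>..\<beta>}|lborel. w x) = 1"
    and initial: "\<rho>\<^sub>0 \<in> Linf_Pac_c"
  shows "\<exists>T>0. \<forall>t\<in>{0<..<T}. \<exists>\<rho>. C0_weak_solution v w \<rho>\<^sub>0 t \<rho> \<and>
           (\<forall>\<sigma>. C0_weak_solution v w \<rho>\<^sub>0 t \<sigma> \<longrightarrow> (\<forall>s\<in>{0..t}. \<sigma> s = \<rho> s))"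
proof -
  obtain Lv where Lv: "Lv-lipschitz_on {0..} v" using v_lipschitz by blast
  obtain B where B: "\<And>x. 0 \<le> x \<Longrightarrow> \<bar>v x\<bar> \<le> B"
    using v_bounded unfolding bounded_iff by auto
  obtain p n M where pn: "mono p" "mono n" "0 < M" "\<And>x. 0 \<le> p x" "\<And>x. p x \<le> M"
    "\<And>x. 0 \<le> n x" "\<And>x. n x \<le> M" "\<And>x. w x = p x - n x"
    using bounded_variation_decomposition[OF \<open>\<alpha> < \<beta>\<close> w_bv w_nonneg w_zero] by blast
  have w0: "0 \<le> w x" for x using w_nonneg w_zero by (cases "x \<in> {\<alpha>..\<beta>}") auto
  interpret nonlocal_velocity v w p n M Lv B
    by unfold_locales (use pn w0 Lv B in auto)
  obtain C where C: "C-lipschitz_on UNIV (cdf \<rho>\<^sub>0)" using Linf_Pac_c_D(2)[OF initial] by blast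
  obtain R where R: "AE z in \<rho>\<^sub>0. \<bar>z\<bar> \<le> R" using Linf_Pac_c_D(3)[OF initial] by blast
  note \<rho>\<^sub>0 = Linf_Pac_c_D(1)[OF initial]
  define \<Lambda> where "\<Lambda> = 4 * Lv * M * C"
  have \<Lambda>: "0 \<le> \<Lambda>" using lipschitz_on_nonneg[OF C] Lv_nonneg M_pos by (simp add: \<Lambda>_def)
  \<comment> \<open>The summand \<open>1\<close> covers \<open>\<Lambda> = 0\<close>, possible for constant \<open>v\<close>.\<close>
  define T where "T = 1 / (4 * (\<Lambda> + 1))"
  have T: "0 < T" "\<Lambda> * T \<le> 1 / 4" using \<Lambda> by (auto simp: T_def field_simps)
  show ?thesis
  proof (intro exI[of _ T] conjI ballI)
    show "0 < T" by (rule T)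
    fix t assume "t \<in> {0<..<T}"
    then have t: "0 < t" "t \<le> T" by auto
    have \<Lambda>t: "\<Lambda> * t \<le> 1 / 4" using T(2) mult_left_mono[OF t(2) \<Lambda>] by linarith
    note flow_context = \<rho>\<^sub>0 C \<Lambda>_def less_imp_le[OF t(1)] \<Lambda>t
    obtain X where X: "slow_flow B X" "\<And>z. X 0 z = z" "\<And>s z. s \<in> {0..t} \<Longrightarrow>
      ((\<lambda>r. X r z) has_real_derivative V v w (distr \<rho>\<^sub>0 borel (X s)) (X s z)) (at s within {0..t})"
      using flow_exists[OF flow_context] by blast
    have "C0_weak_solution v w \<rho>\<^sub>0 t (\<lambda>s. distr \<rho>\<^sub>0 borel (X s))"
      by (rule pushforward_C0_weak_solution[OF flow_context X(1,2) t(1) order.refl X(3) R])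
    moreover have "\<sigma> s = distr \<rho>\<^sub>0 borel (X s)" if "C0_weak_solution v w \<rho>\<^sub>0 t \<sigma>" "s \<in> {0..t}" for \<sigma> s
      by (rule solution_eq_pushforward[OF that(1) t(1) \<rho>\<^sub>0 C \<Lambda>_def \<Lambda>t X that(2)])
    ultimately show "\<exists>\<rho>. C0_weak_solution v w \<rho>\<^sub>0 t \<rho> \<and>
           (\<forall>\<sigma>. C0_weak_solution v w \<rho>\<^sub>0 t \<sigma> \<longrightarrow> (\<forall>s\<in>{0..t}. \<sigma> s = \<rho> s))"
      by blast
  qed
qed

end
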